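(* Consider the problem $\inf_{\mu\in\mathcal{M}(\Omega)}J(\mu)$, $J(\mu)=F(K\mu)+\|\mu\|_{\mathrm{KR}_p^{\alpha,\beta}}$. Either the accelerated generalized conditional gradient (AGCG) algorithm described in the context terminates after a finite number of steps outputting a minimizer of $J$, or, denoting by $\mu_k$ the sequence generated by it, there exists a constant $C>0$ such that $$J(\mu_k)-\inf_{\mu\in\mathcal{M}(\Omega)}J(\mu)\le\frac{C}{1+k}$$ for all $k\in\mathbb{N}$. Moreover, the generated sequence $\mu_k$ admits at least one weak* accumulation point, and every such accumulation point is a minimizer of $J$. Finally, if $J$ has a unique minimizer $\bar\mu$, then $\mu_k$ converges weakly* to $\bar\mu$ as $k\to\infty$.
   Context: Standing assumptions: $\Omega\subset\mathbb{R}^n$ is convex and compact, $p\in(0,1]$, $\alpha>0$, $\beta>0$, $2\alpha-\beta>0$. $\mathcal{M}(\Omega)=\mathcal{C}(\Omega)^*$ is the space of finite signed Radon measures. $Y$ is a Hilbert space, $K:\mathcal{M}(\Omega)\to Y$ is linear and weak*-to-strong continuous, $F:Y\to\mathbb{R}$ is strictly convex, bounded from below, Fr\'echet differentiable, and $\nabla F$ is Lipschitz continuous on compact sets. $K_*:Y\to\mathcal{C}(\Omega)$ is the pre-adjoint: $\langle K_*v,\mu\rangle=(v,K\mu)_Y$. $W_p(\mu,\nu):=\inf\{\int|x-y|^p\,d\gamma:\gamma\in\Pi(\mu,\nu)\}$ for nonnegative measures (no $1/p$-th power), with $\Pi(\mu,\nu)$ the nonnegative measures on $\Omega\times\Omega$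 with marginals $\mu,\nu$. $\|\mu\|_{\mathrm{KR}_p^{\alpha,\beta}}:=\inf\{W_p(\nu_+,\nu_-)+\frac\beta2|\nu|(\Omega)+\alpha|\mu-\nu|(\Omega):\nu\in\mathcal{M}(\Omega),\ \nu(\Omega)=0\}$, with $\nu_\pm$ the positive/negative parts of $\nu$. $B:=\{\mu:\|\mu\|_{\mathrm{KR}_p^{\alpha,\beta}}\le1\}$, $\operatorname{Ext}(B)$ is its set of extremal points, and $\mathcal{D}_\beta(x,y):=\frac{1}{\beta+|x-y|^p}(\delta_x-\delta_y)$ for $x\ne y$. For a finite set $\mathcal{A}=\{\mu_j\}_{j=1}^N\subset\operatorname{Ext}(B)$ let $(\mathcal{P}(\mathcal{A}))$ be the problem $\min_{\lambda\in\mathbb{R}_+^N}F\big(\sum_{j=1}^N\lambda_jK\mu_j\big)+\sum_{j=1}^N\lambda_j$, where $\mathbb{R}_+^N$ is the set of componentwise nonnegative vectors. AGCG algorithm. Input: a finite set $\mathcal{A}_0=\{\mu_j^0\}_{j=1}^{N_0}\subset\operatorname{Ext}(B)$. Initialization: let $\lambda^0$ solve $(\mathcal{P}(\mathcal{A}_0))$, set $\mu_1:=\sum_j\lambda_j^0\mu_j^0$ and $\mathcal{A}_1:=\mathcal{A}_0\setminus\{\mu_j^0:\lambda_j^0=0\}$. For $k=1,2,\dots$: (i) compute $q_k=-K_*\nabla F(K\mu_k)$, $\Psi_{q_k}(x,y)=\frac{q_k(x)-q_k(y)}{|x-y|^p+\beta}$ on $\Omega\times\Omega$, and $z_k\in\arg\max_{z\in\Omega}|q_k(z)|$,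 $(x_k,y_k)\in\arg\max_{(x,y)\in\Omega\times\Omega}\Psi_{q_k}(x,y)$. (ii) If $\max_z|q_k(z)|\le\alpha$ and $\max_{(x,y)}\Psi_{q_k}(x,y)\le1$, terminate with output $\bar\mu=\mu_k$. Otherwise, if $\max_z|q_k(z)|/\alpha\ge\max_{(x,y)}\Psi_{q_k}(x,y)$, set $\widehat\mu_k=\operatorname{sign}(q_k(z_k))\delta_{z_k}/\alpha$; else set $\widehat\mu_k=\mathcal{D}_\beta(x_k,y_k)$. (iii) Set $\mathcal{A}_k^+:=\mathcal{A}_k\cup\{\widehat\mu_k\}=\{\mu_j^{k,+}\}_{j=1}^{N_k^+}$, let $\lambda^{k,+}$ solve $(\mathcal{P}(\mathcal{A}_k^+))$, and set $\mu_{k+1}:=\sum_j\lambda_j^{k,+}\mu_j^{k,+}$, $\mathcal{A}_{k+1}:=\mathcal{A}_k^+\setminus\{\mu_j^{k,+}:\lambda_j^{k,+}=0\}$. *)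

theory Defs
  imports "HOL-Analysis.Analysis" "HOL-Library.Extended_Nat"
begin

section \<open>Finite signed Borel measures\<close>

text \<open>Real-valued countably additive set functions on the Borel sets, extended by 0 to the
  other sets so that equality is equality on the Borel sets. On a compact subset of a Euclidean
  space every finite signed Borel measure is Radon, so that the measures carried by \<open>\<Omega>\<close> are,
  by the Riesz representation theorem, the dual of the continuous functions on \<open>\<Omega>\<close>.\<close>

typedef (overloaded) ('a::topological_space) signed_measure =
  "{\<mu> :: 'a set \<Rightarrow> real.
      (\<forall>A. A \<notin> sets borel \<longrightarrow> \<mu> A = 0) \<and>
      (\<forall>A :: nat \<Rightarrow> 'a set. range A \<subseteq> sets borel \<longrightarrow> disjoint_family A \<longrightarrow>
         (\<lambda>i. \<mu> (A i)) sums \<mu> (\<Union>i. A i))}"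
  morphisms smeas Abs_signed_measure
  by (rule exI[of _ "\<lambda>_. 0"]) simp

setup_lifting type_definition_signed_measure

instantiation signed_measure :: (topological_space) real_vector
begin

lift_definition zero_signed_measure :: "'a signed_measure" is "\<lambda>_. 0"
  by simp

lift_definition plus_signed_measure ::
  "'a signed_measure \<Rightarrow> 'a signed_measure \<Rightarrow> 'a signed_measure" is "\<lambda>\<mu> \<nu> A. \<mu> A + \<nu> A"
  by (auto intro: sums_add)

lift_definition minus_signed_measure ::
  "'a signed_measure \<Rightarrow> 'a signed_measure \<Rightarrow> 'a signed_measure" is "\<lambda>\<mu> \<nu> A. \<mu> A - \<nu> A"
  by (auto intro: sums_diff)

lift_definition uminus_signed_measure ::
  "'a signed_measure \<Rightarrow> 'a signed_measure" is "\<lambda>\<mu> A. - \<mu> A"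
  by (auto intro: sums_minus)

lift_definition scaleR_signed_measure ::
  "real \<Rightarrow> 'a signed_measure \<Rightarrow> 'a signed_measure" is "\<lambda>c \<mu> A. c * \<mu> A"
  by (auto intro: sums_mult)

instance
  by standard (transfer; simp add: algebra_simps fun_eq_iff)+

end

lift_definition dirac :: "'a::t2_space \<Rightarrow> 'a signed_measure"
  is "\<lambda>x A. if A \<in> sets borel then indicator A x else 0"
proof -
  fix x :: 'a
  have "(\<lambda>i. indicator (A i) x :: real) sums indicator (\<Union>i. A i) x"
    if "disjoint_family A" for A :: "nat \<Rightarrow> 'a set"
  proof (cases "x \<in> (\<Union>i. A i)")
    case True
    then obtain j where j: "x \<in> A j" by blast
    have "indicator (A i) x = (if i = j then 1 else 0 :: real)" for i
      using that j by (auto simp: disjoint_family_on_def indicator_def)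
    then show ?thesis
      using True sums_single[of j "\<lambda>_. 1 :: real"] by simp
  next
    case False
    then show ?thesis by (simp add: indicator_def)
  qed
  moreover have "(\<Union>i. A i) \<in> sets borel" if "range A \<subseteq> sets borel" for A :: "nat \<Rightarrow> 'a set"
    using that by auto
  ultimately show "(\<forall>A. A \<notin> sets borel \<longrightarrow>
        (if A \<in> sets borel then indicator A x else (0::real)) = 0) \<and>
      (\<forall>A. range A \<subseteq> sets borel \<longrightarrow> disjoint_family A \<longrightarrow>
        (\<lambda>i. if A i \<in> sets borel then indicator (A i) x else (0::real)) sums
        (if (\<Union>i. A i) \<in> sets borel then indicator (\<Union>i. A i) x else 0))"
    by (auto simp: image_subset_iff)
qed

definition measures_on :: "'a::topological_space set \<Rightarrow> 'a signed_measure set" where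
  "measures_on \<Omega> = {\<mu>. \<forall>A \<in> sets borel. A \<inter> \<Omega> = {} \<longrightarrow> smeas \<mu> A = 0}"

text \<open>Jordan decomposition: the upper variation \<open>\<mu>\<^sub>+(A) = sup {\<mu>(B) | B \<subseteq> A}\<close> and
  the lower variation \<open>\<mu>\<^sub>-(A) = - inf {\<mu>(B) | B \<subseteq> A}\<close>. The truncation of negative values
  by \<open>ennreal\<close> is harmless since \<open>B = {}\<close> is admissible.\<close>

definition pos_part :: "'a::topological_space signed_measure \<Rightarrow> 'a measure" where
  "pos_part \<mu> = measure_of UNIV (sets borel)
     (\<lambda>A. SUP B \<in> {B \<in> sets borel. B \<subseteq> A}. ennreal (smeas \<mu> B))"

definition neg_part :: "'a::topological_space signed_measure \<Rightarrow> 'a measure" where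
  "neg_part \<mu> = pos_part (- \<mu>)"

definition variation :: "'a::topological_space signed_measure \<Rightarrow> 'a set \<Rightarrow> real" where
  "variation \<mu> A = measure (pos_part \<mu>) A + measure (neg_part \<mu>) A"

definition smeas_integral ::
  "'a::topological_space set \<Rightarrow> 'a signed_measure \<Rightarrow> ('a \<Rightarrow> real) \<Rightarrow> real" where
  "smeas_integral \<Omega> \<mu> f = (LINT x:\<Omega>|pos_part \<mu>. f x) - (LINT x:\<Omega>|neg_part \<mu>. f x)"

definition weak_star_tendsto ::
  "'a::topological_space set \<Rightarrow> (nat \<Rightarrow> 'a signed_measure) \<Rightarrow> 'a signed_measure \<Rightarrow> bool" where
  "weak_star_tendsto \<Omega> s \<mu> \<longleftrightarrow> \<mu> \<in> measures_on \<Omega> \<and>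
     (\<forall>f. continuous_on \<Omega> f \<longrightarrow>
        (\<lambda>k. smeas_integral \<Omega> (s k) f) \<longlonglongrightarrow> smeas_integral \<Omega> \<mu> f)"


section \<open>The Kantorovich--Rubinstein norm\<close>

definition couplings ::
  "'a::topological_space set \<Rightarrow> 'a measure \<Rightarrow> 'a measure \<Rightarrow> ('a \<times> 'a) measure set" where
  "couplings \<Omega> \<mu> \<nu> = {\<gamma>. sets \<gamma> = sets borel \<and> emeasure \<gamma> (- (\<Omega> \<times> \<Omega>)) = 0 \<and>
     distr \<gamma> borel fst = \<mu> \<and> distr \<gamma> borel snd = \<nu>}"

text \<open>No \<open>1/p\<close>-th power is taken; the infimum is \<open>\<infinity>\<close> if the masses differ.\<close>

definition wasserstein ::
  "'a::metric_space set \<Rightarrow> real \<Rightarrow> 'a measure \<Rightarrow> 'a measure \<Rightarrow> ennreal" where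
  "wasserstein \<Omega> p \<mu> \<nu> =
     (INF \<gamma> \<in> couplings \<Omega> \<mu> \<nu>. \<integral>\<^sup>+ (x, y). ennreal (dist x y powr p) \<partial>\<gamma>)"

text \<open>The infimum is finite, as \<open>\<nu> = 0\<close> shows.\<close>

definition KR_norm ::
  "'a::metric_space set \<Rightarrow> real \<Rightarrow> real \<Rightarrow> real \<Rightarrow> 'a signed_measure \<Rightarrow> real" where
  "KR_norm \<Omega> p \<alpha> \<beta> \<mu> = enn2real
     (INF \<nu> \<in> {\<nu> \<in> measures_on \<Omega>. smeas \<nu> \<Omega> = 0}.
        wasserstein \<Omega> p (pos_part \<nu>) (neg_part \<nu>)
        + ennreal (\<beta> / 2 * variation \<nu> \<Omega>)
        + ennreal (\<alpha> * variation (\<mu> - \<nu>) \<Omega>))"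

definition KR_ball ::
  "'a::metric_space set \<Rightarrow> real \<Rightarrow> real \<Rightarrow> real \<Rightarrow> 'a signed_measure set" where
  "KR_ball \<Omega> p \<alpha> \<beta> = {\<mu> \<in> measures_on \<Omega>. KR_norm \<Omega> p \<alpha> \<beta> \<mu> \<le> 1}"

definition KR_dipole :: "real \<Rightarrow> real \<Rightarrow> 'a::metric_space \<Rightarrow> 'a \<Rightarrow> 'a signed_measure" where
  "KR_dipole p \<beta> x y = (1 / (\<beta> + dist x y powr p)) *\<^sub>R (dirac x - dirac y)"


section \<open>The minimization problem\<close>

definition strictly_convex :: "('b::real_vector \<Rightarrow> real) \<Rightarrow> bool" where
  "strictly_convex F \<longleftrightarrow> (\<forall>x y. \<forall>t \<in> {0<..<1}. x \<noteq> y \<longrightarrow>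
     F ((1 - t) *\<^sub>R x + t *\<^sub>R y) < (1 - t) * F x + t * F y)"

definition linear_on_measures ::
  "'a::topological_space set \<Rightarrow> ('a signed_measure \<Rightarrow> 'y::real_vector) \<Rightarrow> bool" where
  "linear_on_measures \<Omega> K \<longleftrightarrow>
     (\<forall>\<mu> \<in> measures_on \<Omega>. \<forall>\<nu> \<in> measures_on \<Omega>. K (\<mu> + \<nu>) = K \<mu> + K \<nu>) \<and>
     (\<forall>c. \<forall>\<mu> \<in> measures_on \<Omega>. K (c *\<^sub>R \<mu>) = c *\<^sub>R K \<mu>)"

text \<open>Weak*-to-strong continuity is taken along sequences: continuity with respect to the full
  weak* topology would force a linear \<open>K\<close> to have finite rank.\<close>

definition weak_star_to_strong_continuous ::
  "'a::topological_space set \<Rightarrow> ('a signed_measure \<Rightarrow> 'y::topological_space) \<Rightarrow> bool" where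
  "weak_star_to_strong_continuous \<Omega> K \<longleftrightarrow>
     (\<forall>s \<mu>. range s \<subseteq> measures_on \<Omega> \<longrightarrow> weak_star_tendsto \<Omega> s \<mu> \<longrightarrow>
        (\<lambda>k. K (s k)) \<longlonglongrightarrow> K \<mu>)"

definition is_preadjoint ::
  "'a::topological_space set \<Rightarrow> ('a signed_measure \<Rightarrow> 'y::real_inner) \<Rightarrow>
   ('y \<Rightarrow> 'a \<Rightarrow> real) \<Rightarrow> bool" where
  "is_preadjoint \<Omega> K Kpre \<longleftrightarrow> (\<forall>v. continuous_on \<Omega> (Kpre v) \<and>
     (\<forall>\<mu> \<in> measures_on \<Omega>. smeas_integral \<Omega> \<mu> (Kpre v) = inner v (K \<mu>)))"

definition objective ::
  "'a::metric_space set \<Rightarrow> real \<Rightarrow> real \<Rightarrow> real \<Rightarrow> ('y \<Rightarrow> real) \<Rightarrow>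
   ('a signed_measure \<Rightarrow> 'y) \<Rightarrow> 'a signed_measure \<Rightarrow> real" where
  "objective \<Omega> p \<alpha> \<beta> F K \<mu> = F (K \<mu>) + KR_norm \<Omega> p \<alpha> \<beta> \<mu>"


section \<open>The accelerated generalized conditional gradient algorithm\<close>

text \<open>Coefficient vectors are indexed by the elements of the finite set \<open>\<A>\<close> itself.\<close>

definition coeff_objective ::
  "('y::real_vector \<Rightarrow> real) \<Rightarrow> ('a::topological_space signed_measure \<Rightarrow> 'y) \<Rightarrow>
   'a signed_measure set \<Rightarrow> ('a signed_measure \<Rightarrow> real) \<Rightarrow> real" where
  "coeff_objective F K \<A> c = F (\<Sum>\<mu>\<in>\<A>. c \<mu> *\<^sub>R K \<mu>) + (\<Sum>\<mu>\<in>\<A>. c \<mu>)"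

definition solves_coeff_problem ::
  "('y::real_vector \<Rightarrow> real) \<Rightarrow> ('a::topological_space signed_measure \<Rightarrow> 'y) \<Rightarrow>
   'a signed_measure set \<Rightarrow> ('a signed_measure \<Rightarrow> real) \<Rightarrow> bool" where
  "solves_coeff_problem F K \<A> c \<longleftrightarrow>
     is_arg_min (coeff_objective F K \<A>) (\<lambda>c. \<forall>\<mu>\<in>\<A>. 0 \<le> c \<mu>) c"

text \<open>\<open>\<mu>\<close> and \<open>\<A>'\<close> are the next iterate and the pruned active set obtained from some solution
  of the coefficient problem on \<open>\<A>\<close>.\<close>

definition corrective_update ::
  "('y::real_vector \<Rightarrow> real) \<Rightarrow> ('a::topological_space signed_measure \<Rightarrow> 'y) \<Rightarrow>
   'a signed_measure set \<Rightarrow> 'a signed_measure \<Rightarrow> 'a signed_measure set \<Rightarrow> bool" where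
  "corrective_update F K \<A> \<mu> \<A>' \<longleftrightarrow> (\<exists>c. solves_coeff_problem F K \<A> c \<and>
     \<mu> = (\<Sum>\<nu>\<in>\<A>. c \<nu> *\<^sub>R \<nu>) \<and> \<A>' = \<A> - {\<nu> \<in> \<A>. c \<nu> = 0})"

definition dual_variable ::
  "('y \<Rightarrow> 'y) \<Rightarrow> ('a::topological_space signed_measure \<Rightarrow> 'y) \<Rightarrow> ('y \<Rightarrow> 'a \<Rightarrow> real) \<Rightarrow>
   'a signed_measure \<Rightarrow> 'a \<Rightarrow> real" where
  "dual_variable gradF K Kpre \<mu> x = - Kpre (gradF (K \<mu>)) x"

definition Psi :: "real \<Rightarrow> real \<Rightarrow> ('a::metric_space \<Rightarrow> real) \<Rightarrow> 'a \<times> 'a \<Rightarrow> real" where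
  "Psi p \<beta> q = (\<lambda>(x, y). (q x - q y) / (dist x y powr p + \<beta>))"

definition agcg_maximizers ::
  "'a::metric_space set \<Rightarrow> real \<Rightarrow> real \<Rightarrow> ('a \<Rightarrow> real) \<Rightarrow> 'a \<Rightarrow> 'a \<times> 'a \<Rightarrow> bool" where
  "agcg_maximizers \<Omega> p \<beta> q z w \<longleftrightarrow>
     is_arg_max (\<lambda>z. \<bar>q z\<bar>) (\<lambda>z. z \<in> \<Omega>) z \<and> is_arg_max (Psi p \<beta> q) (\<lambda>w. w \<in> \<Omega> \<times> \<Omega>) w"

text \<open>In the next two definitions \<open>z\<close> and \<open>w\<close> are maximizers, so that \<open>\<bar>q z\<bar>\<close> and \<open>Psi p \<beta> q w\<close>
  are the two maximal values.\<close>

definition agcg_stop ::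
  "real \<Rightarrow> real \<Rightarrow> real \<Rightarrow> ('a::metric_space \<Rightarrow> real) \<Rightarrow> 'a \<Rightarrow> 'a \<times> 'a \<Rightarrow> bool" where
  "agcg_stop p \<alpha> \<beta> q z w \<longleftrightarrow> \<bar>q z\<bar> \<le> \<alpha> \<and> Psi p \<beta> q w \<le> 1"

definition agcg_new_point ::
  "real \<Rightarrow> real \<Rightarrow> real \<Rightarrow> ('a::metric_space \<Rightarrow> real) \<Rightarrow> 'a \<Rightarrow> 'a \<times> 'a \<Rightarrow> 'a signed_measure" where
  "agcg_new_point p \<alpha> \<beta> q z w =
     (if \<bar>q z\<bar> / \<alpha> \<ge> Psi p \<beta> q w then (sgn (q z) / \<alpha>) *\<^sub>R dirac z
      else KR_dipole p \<beta> (fst w) (snd w))"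

definition agcg_terminates_at ::
  "'a::metric_space set \<Rightarrow> real \<Rightarrow> real \<Rightarrow> real \<Rightarrow> ('y \<Rightarrow> 'y) \<Rightarrow> ('a signed_measure \<Rightarrow> 'y) \<Rightarrow>
   ('y \<Rightarrow> 'a \<Rightarrow> real) \<Rightarrow> 'a signed_measure \<Rightarrow> bool" where
  "agcg_terminates_at \<Omega> p \<alpha> \<beta> gradF K Kpre \<mu> \<longleftrightarrow>
     (let q = dual_variable gradF K Kpre \<mu> in
      \<exists>z w. agcg_maximizers \<Omega> p \<beta> q z w \<and> agcg_stop p \<alpha> \<beta> q z w)"

definition agcg_step ::
  "'a::metric_space set \<Rightarrow> real \<Rightarrow> real \<Rightarrow> real \<Rightarrow> ('y::real_vector \<Rightarrow> real) \<Rightarrow> ('y \<Rightarrow> 'y) \<Rightarrow>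
   ('a signed_measure \<Rightarrow> 'y) \<Rightarrow> ('y \<Rightarrow> 'a \<Rightarrow> real) \<Rightarrow>
   'a signed_measure \<Rightarrow> 'a signed_measure set \<Rightarrow>
   'a signed_measure \<Rightarrow> 'a signed_measure set \<Rightarrow> bool" where
  "agcg_step \<Omega> p \<alpha> \<beta> F gradF K Kpre \<mu> \<A> \<mu>' \<A>' \<longleftrightarrow>
     (let q = dual_variable gradF K Kpre \<mu> in
      \<exists>z w. agcg_maximizers \<Omega> p \<beta> q z w \<and> \<not> agcg_stop p \<alpha> \<beta> q z w \<and>
        corrective_update F K (\<A> \<union> {agcg_new_point p \<alpha> \<beta> q z w}) \<mu>' \<A>')"

text \<open>A complete run with iterates \<open>\<mu> k\<close> and active sets \<open>\<A> k\<close>, \<open>1 \<le> k \<le> T\<close>: either \<open>T = \<infinity>\<close> and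
  the algorithm never stops, or it terminates in iteration \<open>T\<close> with output \<open>\<mu> T\<close>.
  The values of \<open>\<mu>\<close> and \<open>\<A>\<close> at other indices are irrelevant.\<close>

definition agcg_run ::
  "'a::metric_space set \<Rightarrow> real \<Rightarrow> real \<Rightarrow> real \<Rightarrow> ('y::real_vector \<Rightarrow> real) \<Rightarrow> ('y \<Rightarrow> 'y) \<Rightarrow>
   ('a signed_measure \<Rightarrow> 'y) \<Rightarrow> ('y \<Rightarrow> 'a \<Rightarrow> real) \<Rightarrow> 'a signed_measure set \<Rightarrow>
   enat \<Rightarrow> (nat \<Rightarrow> 'a signed_measure) \<Rightarrow> (nat \<Rightarrow> 'a signed_measure set) \<Rightarrow> bool" where
  "agcg_run \<Omega> p \<alpha> \<beta> F gradF K Kpre \<A>\<^sub>0 T \<mu> \<A> \<longleftrightarrow>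
     1 \<le> T \<and>
     corrective_update F K \<A>\<^sub>0 (\<mu> 1) (\<A> 1) \<and>
     (\<forall>k\<ge>1. enat k < T \<longrightarrow>
        agcg_step \<Omega> p \<alpha> \<beta> F gradF K Kpre (\<mu> k) (\<A> k) (\<mu> (Suc k)) (\<A> (Suc k))) \<and>
     (\<forall>k. T = enat k \<longrightarrow> agcg_terminates_at \<Omega> p \<alpha> \<beta> gradF K Kpre (\<mu> k))"

end

theory Submission
  imports Defs "HOL-Probability.Helly_Selection"
begin

text \<open>
  \<^bold>\<open>The norm.\<close> Everything that the convergence proof needs of the Kantorovich--Rubinstein norm
  (sublinearity, weak* lower semicontinuity, weak* compactness of its balls, the easy half of
  duality) would follow easily if the norm were the least cost of a linear program over nonnegative
  measures. The obstacle is that its definition refers to the Jordan decomposition of the measure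
  \<open>\<nu>\<close> that is transported. Consider therefore all representations
  \<open>\<mu> = (fst)\<^sub>*\<gamma> - (snd)\<^sub>*\<gamma> + a - b\<close> with nonnegative \<open>\<gamma>, a, b\<close>, at the cost
  \<open>\<integral> (|x - y|\<^sup>p + \<beta>) d\<gamma> + \<alpha> (a(\<Omega>) + b(\<Omega>))\<close>. The cost controls all masses and is weak* continuous, so
  the minimum is attained (\<open>optimal_representation\<close>). In an optimal representation the two
  marginals of \<open>\<gamma>\<close> are mutually singular: if mass arrived at a place from which mass also departs,
  joining the two transports would save \<open>\<beta>\<close> per unit, while the detour inside a small cell costs
  less than that (\<open>shortcut\<close>, \<open>optimal_representation_singular\<close>). Since the cells have positive
  size, arrivals and departures can be paired by a product measure, so that the exact gluing of
  transport plans along a common marginal is replaced by an approximate one whose error is absorbed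
  by \<open>\<beta>\<close>. Singular marginals are a Jordan decomposition, and so the least cost is the norm
  (\<open>KR_norm_attained\<close>).

  \<^bold>\<open>Compactness.\<close> A bounded sequence of nonnegative measures on a compact set has a weak*
  convergent subsequence (\<open>weak_star_compact_nonneg\<close>): the set is coded by a subset of the line such
  that coding is Borel and decoding is continuous on the closure of the set of codes, and Helly's
  selection theorem is applied to the image measures.

  \<^bold>\<open>The algorithm.\<close> Write \<open>j\<^sub>k\<close> for the value of the coefficient problem at \<open>\<mu>\<^sub>k\<close>. By sublinearity
  \<open>J \<mu>\<^sub>k \<le> j\<^sub>k\<close>. The dual variable \<open>q = - K\<^sub>* \<nabla>F(K \<mu>\<^sub>k)\<close> satisfies \<open>\<langle>q, \<nu>\<rangle> \<le> s \<parallel>\<nu>\<parallel>\<close> with \<open>s\<close> the larger of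
  the two maxima in the stopping test, and the new point \<open>h\<close> lies in the unit ball and attains \<open>s\<close>.
  If the test succeeds, then \<open>s = 1\<close> is admissible and convexity gives \<open>j\<^sub>k \<le> J \<nu>\<close> for all \<open>\<nu>\<close>
  (\<open>terminates_minimizer\<close>). Otherwise the next coefficient problem admits the candidates
  \<open>(1 - t) \<mu>\<^sub>k + t M h\<close>, where \<open>M\<close> bounds the norms of the iterates and of all competitors that are
  not worse than \<open>j\<^sub>1\<close>; their slope at \<open>t = 0\<close> is at
  most \<open>J \<nu> - j\<^sub>k\<close>, and \<open>\<nabla>F\<close> is Lipschitz continuous on the compact convex image under \<open>K\<close> of the ball
  of radius \<open>M\<close> (\<open>step_decrease\<close>). This is the recursion of conditional gradient methods, which
  yields the rate \<open>1/k\<close> for \<open>j\<^sub>k - inf J\<close> (\<open>iterates_rate\<close>). The iterates stay in a weak* compact ball,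
  and lower semicontinuity makes every accumulation point a minimizer.
\<close>

section \<open>Jordan decomposition and integration\<close>

lemma signed_measure_eqI:
  assumes "\<And>A. A \<in> sets borel \<Longrightarrow> smeas \<mu> A = smeas \<nu> A"
  shows "\<mu> = \<nu>"
proof -
  have "smeas \<mu> A = 0" "smeas \<nu> A = 0" if "A \<notin> sets borel" for A
    using smeas[of \<mu>] smeas[of \<nu>] that by auto
  then show ?thesis
    using assms by (metis smeas_inject ext)
qed

lemma smeas_notin_borel: "A \<notin> sets borel \<Longrightarrow> smeas \<mu> A = 0"
  using smeas[of \<mu>] by auto

lemma smeas_sums:
  fixes A :: "nat \<Rightarrow> 'a::topological_space set"
  assumes "range A \<subseteq> sets borel" "disjoint_family A"
  shows "(\<lambda>i. smeas \<mu> (A i)) sums smeas \<mu> (\<Union>i. A i)"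
  using smeas[of \<mu>] assms by auto

lemma smeas_empty [simp]: "smeas \<mu> {} = 0"
proof -
  have "(\<lambda>_::nat. smeas \<mu> {}) \<longlonglongrightarrow> 0"
    using smeas_sums[of "\<lambda>_. {}" \<mu>] by (auto simp: disjoint_family_on_def intro: summable_LIMSEQ_zero sums_summable)
  then show ?thesis by (simp add: LIMSEQ_const_iff)
qed

lemma smeas_Un:
  assumes "A \<in> sets borel" "B \<in> sets borel" "A \<inter> B = {}"
  shows "smeas \<mu> (A \<union> B) = smeas \<mu> A + smeas \<mu> B"
proof -
  have "(\<lambda>i. smeas \<mu> (binaryset A B i)) sums smeas \<mu> (\<Union>i. binaryset A B i)"
    by (rule smeas_sums) (use assms in \<open>auto simp: binaryset_def disjoint_family_on_def\<close>)
  moreover have "(\<lambda>i. smeas \<mu> (binaryset A B i)) sums (smeas \<mu> A + smeas \<mu> B)"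
    by (rule binaryset_sums) auto
  ultimately show ?thesis
    using sums_unique2 by (fastforce simp: UN_binaryset_eq)
qed

lemma smeas_Diff:
  assumes "A \<in> sets borel" "B \<in> sets borel" "B \<subseteq> A"
  shows "smeas \<mu> (A - B) = smeas \<mu> A - smeas \<mu> B"
  using smeas_Un[of B "A - B" \<mu>] assms by (simp add: Un_absorb1)

lemmas smeas_simps [simp] =
  zero_signed_measure.rep_eq plus_signed_measure.rep_eq minus_signed_measure.rep_eq
  uminus_signed_measure.rep_eq scaleR_signed_measure.rep_eq

lemma smeas_sum: "smeas (\<Sum>i\<in>I. f i) A = (\<Sum>i\<in>I. smeas (f i) A)"
  by (induction I rule: infinite_finite_induct) auto

text \<open>Otherwise some set would have subsets of arbitrarily large mass; splitting off a piece of
  mass larger than 1 in such a way that what remains has the same defect, again and again, would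
  give a disjoint sequence on which \<open>\<mu>\<close> does not tend to 0.\<close>

lemma smeas_bounded: "\<exists>R. \<forall>A. \<bar>smeas \<mu> A\<bar> \<le> R"
proof (rule ccontr)
  define bad where "bad A \<longleftrightarrow> A \<in> sets borel \<and> (\<forall>R. \<exists>B\<in>sets borel. B \<subseteq> A \<and> \<bar>smeas \<mu> B\<bar> > R)" for A
  assume "\<nexists>R. \<forall>A. \<bar>smeas \<mu> A\<bar> \<le> R"
  then have unb: "\<exists>A. \<bar>smeas \<mu> A\<bar> > R" for R
    by (meson not_le)
  have "\<exists>A\<in>sets borel. \<bar>smeas \<mu> A\<bar> > R" for R
  proof -
    obtain A where "\<bar>smeas \<mu> A\<bar> > max R 0" using unb by blast
    then show ?thesis using smeas_notin_borel[of A \<mu>] by (cases "A \<in> sets borel") auto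
  qed
  then have bad0: "bad UNIV" by (auto simp: bad_def)
  have badD: "\<exists>B. B \<in> sets borel \<and> B \<subseteq> A \<and> \<bar>smeas \<mu> B\<bar> > R" if "bad A" for A R
    using that unfolding bad_def by (metis (no_types, lifting))
  have step: "\<exists>A'. bad A' \<and> A' \<subseteq> A \<and> \<bar>smeas \<mu> (A - A')\<bar> > 1" if bA: "bad A" for A
  proof -
    have A: "A \<in> sets borel" using bA by (simp add: bad_def)
    obtain B where B: "B \<in> sets borel" "B \<subseteq> A" "\<bar>smeas \<mu> B\<bar> > 1 + \<bar>smeas \<mu> A\<bar>"
      using badD[OF bA] by blast
    have big: "\<bar>smeas \<mu> (A - B)\<bar> > 1" "\<bar>smeas \<mu> B\<bar> > 1"
      using smeas_Diff[OF A B(1,2), of \<mu>] B(3) by linarith+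
    have "bad B \<or> bad (A - B)"
    proof (rule ccontr)
      assume "\<not> (bad B \<or> bad (A - B))"
      then obtain R S where R: "\<And>C. C \<in> sets borel \<Longrightarrow> C \<subseteq> B \<Longrightarrow> \<bar>smeas \<mu> C\<bar> \<le> R"
        and S: "\<And>C. C \<in> sets borel \<Longrightarrow> C \<subseteq> A - B \<Longrightarrow> \<bar>smeas \<mu> C\<bar> \<le> S"
        using A B(1) unfolding bad_def by (meson not_le sets.Diff)
      obtain C where C: "C \<in> sets borel" "C \<subseteq> A" "\<bar>smeas \<mu> C\<bar> > R + S"
        using badD[OF bA] by blast
      have "smeas \<mu> C = smeas \<mu> (C \<inter> B) + smeas \<mu> (C - B)"
        using smeas_Un[of "C \<inter> B" "C - B" \<mu>] C B by (simp add: Int_Diff_Un Int_Diff_disjoint sets.Int sets.Diff)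
      moreover have "\<bar>smeas \<mu> (C \<inter> B)\<bar> \<le> R" "\<bar>smeas \<mu> (C - B)\<bar> \<le> S"
        using R[of "C \<inter> B"] S[of "C - B"] C B by (auto simp: sets.Int sets.Diff)
      ultimately show False using C(3) by linarith
    qed
    then show ?thesis
    proof
      assume "bad B" then show ?thesis using B big by blast
    next
      assume "bad (A - B)"
      moreover have "A - (A - B) = B" using B by auto
      ultimately show ?thesis using big by (intro exI[of _ "A - B"]) auto
    qed
  qed
  define A where "A = rec_nat UNIV (\<lambda>_ A. SOME A'. bad A' \<and> A' \<subseteq> A \<and> \<bar>smeas \<mu> (A - A')\<bar> > 1)"
  have A0: "A 0 = UNIV"
    and AS: "A (Suc n) = (SOME A'. bad A' \<and> A' \<subseteq> A n \<and> \<bar>smeas \<mu> (A n - A')\<bar> > 1)" for n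
    by (auto simp: A_def)
  have bad: "bad (A n)" for n
    by (induction n) (use bad0 A0 someI_ex[OF step] in \<open>auto simp: AS\<close>)
  have AP: "A (Suc n) \<subseteq> A n" "\<bar>smeas \<mu> (A n - A (Suc n))\<bar> > 1" for n
    using someI_ex[OF step[OF bad[of n]]] by (auto simp: AS)
  have anti: "A n \<subseteq> A m" if "m \<le> n" for m n
    using lift_Suc_antimono_le[of A] AP(1) that by blast
  have "disjoint_family (\<lambda>n. A n - A (Suc n))"
    unfolding disjoint_family_on_def
  proof (intro ballI impI)
    fix m n :: nat assume "m \<noteq> n"
    then consider "Suc m \<le> n" | "Suc n \<le> m" by linarith
    then show "(A m - A (Suc m)) \<inter> (A n - A (Suc n)) = {}"
      using anti by cases blast+
  qed
  moreover have "range (\<lambda>n. A n - A (Suc n)) \<subseteq> sets borel"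
    using bad by (auto simp: bad_def)
  ultimately have "(\<lambda>n. smeas \<mu> (A n - A (Suc n))) sums smeas \<mu> (\<Union>n. A n - A (Suc n))"
    by (intro smeas_sums)
  then have "(\<lambda>n. smeas \<mu> (A n - A (Suc n))) \<longlonglongrightarrow> 0"
    by (intro summable_LIMSEQ_zero sums_summable)
  then have "eventually (\<lambda>n. \<bar>smeas \<mu> (A n - A (Suc n))\<bar> < 1) sequentially"
    by (auto simp: tendsto_iff dist_real_def dest: spec[of _ 1])
  then obtain n where "\<bar>smeas \<mu> (A n - A (Suc n))\<bar> < 1"
    by (auto simp: eventually_sequentially)
  then show False using AP(2)[of n] by linarith
qed

lemma sets_pos_part [simp, measurable_cong]: "sets (pos_part \<mu>) = sets borel"
  by (simp add: pos_part_def sets.sigma_sets_eq[of borel, simplified])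

lemma space_pos_part [simp]: "space (pos_part \<mu>) = UNIV"
  by (simp add: pos_part_def space_measure_of_conv)

text \<open>Countable additivity of the upper variation: a subset of a union splits along the union,
  and nearly optimal subsets of finitely many members are put together.\<close>

lemma emeasure_pos_part:
  assumes "A \<in> sets borel"
  shows "emeasure (pos_part \<mu>) A = (SUP B \<in> {B \<in> sets borel. B \<subseteq> A}. ennreal (smeas \<mu> B))"
proof -
  define V where "V A = (SUP B \<in> {B \<in> sets borel. B \<subseteq> A}. ennreal (smeas \<mu> B))" for A
  have V_ub: "ennreal (smeas \<mu> B) \<le> V A" if "B \<in> sets borel" "B \<subseteq> A" for A B
    unfolding V_def by (rule SUP_upper) (use that in auto)
  have V_mono: "V A \<le> V B" if "A \<subseteq> B" for A B
    unfolding V_def by (rule SUP_subset_mono) (use that in auto)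
  have V2: "V A + V B \<le> V (A \<union> B)" if "A \<in> sets borel" "B \<in> sets borel" "A \<inter> B = {}" for A B
  proof -
    have "V A + V B = (SUP C \<in> {C \<in> sets borel. C \<subseteq> A}. ennreal (smeas \<mu> C) + V B)"
      unfolding V_def by (rule ennreal_SUP_add_left[symmetric]) auto
    also have "\<dots> \<le> V (A \<union> B)"
    proof (rule SUP_least)
      fix C assume C: "C \<in> {C \<in> sets borel. C \<subseteq> A}"
      have "ennreal (smeas \<mu> C) + V B
          = (SUP D \<in> {D \<in> sets borel. D \<subseteq> B}. ennreal (smeas \<mu> C) + ennreal (smeas \<mu> D))"
        unfolding V_def by (rule ennreal_SUP_add_right) auto
      also have "\<dots> \<le> V (A \<union> B)"
      proof (rule SUP_least)
        fix D assume D: "D \<in> {D \<in> sets borel. D \<subseteq> B}"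
        \<comment> \<open>Sets of negative measure are replaced by the empty set.\<close>
        define C' where "C' = (if 0 \<le> smeas \<mu> C then C else {})"
        define D' where "D' = (if 0 \<le> smeas \<mu> D then D else {})"
        have "ennreal (smeas \<mu> C) + ennreal (smeas \<mu> D) = ennreal (smeas \<mu> C') + ennreal (smeas \<mu> D')"
          by (simp add: C'_def D'_def ennreal_neg)
        also have "\<dots> = ennreal (smeas \<mu> (C' \<union> D'))"
          using C D that by (subst smeas_Un) (auto simp: C'_def D'_def)
        also have "\<dots> \<le> V (A \<union> B)"
          by (rule V_ub) (use C D in \<open>auto simp: C'_def D'_def\<close>)
        finally show "ennreal (smeas \<mu> C) + ennreal (smeas \<mu> D) \<le> V (A \<union> B)" .
      qed
      finally show "ennreal (smeas \<mu> C) + V B \<le> V (A \<union> B)" .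
    qed
    finally show ?thesis .
  qed
  have "emeasure (pos_part \<mu>) A = V A"
  proof (rule emeasure_measure_of[of "pos_part \<mu>" UNIV "sets borel" V])
    show "pos_part \<mu> = measure_of UNIV (sets borel) V"
      by (simp add: pos_part_def V_def[abs_def])
    show "positive (sets (pos_part \<mu>)) V"
    proof -
      have "{B \<in> sets borel. B \<subseteq> ({}::'a set)} = {{}}" by auto
      then show ?thesis by (simp add: positive_def V_def)
    qed
    show "countably_additive (sets (pos_part \<mu>)) V"
      unfolding countably_additive_def
    proof (intro allI impI)
      fix A :: "nat \<Rightarrow> 'a set"
      assume A: "range A \<subseteq> sets (pos_part \<mu>)" "disjoint_family A"
      then have Ab: "A i \<in> sets borel" for i by auto
      have fin: "(\<Sum>i<n. V (A i)) \<le> V (\<Union>i<n. A i)" for n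
      proof (induction n)
        case (Suc n)
        have "(\<Sum>i<Suc n. V (A i)) \<le> V (\<Union>i<n. A i) + V (A n)"
          using Suc by (simp add: add_right_mono)
        also have "\<dots> \<le> V ((\<Union>i<n. A i) \<union> A n)"
        proof (rule V2)
          show "(\<Union>i<n. A i) \<inter> A n = {}"
            using disjoint_family_onD[OF A(2), of _ n] by fastforce
        qed (use Ab in auto)
        also have "(\<Union>i<n. A i) \<union> A n = (\<Union>i<Suc n. A i)"
          by (auto simp: lessThan_Suc)
        finally show ?case .
      qed auto
      show "(\<Sum>i. V (A i)) = V (\<Union>i. A i)"
      proof (rule antisym)
        show "(\<Sum>i. V (A i)) \<le> V (\<Union>i. A i)"
        proof (rule suminf_le_const)
          fix n
          show "(\<Sum>i<n. V (A i)) \<le> V (\<Union>i. A i)"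
            by (rule order_trans[OF fin V_mono]) auto
        qed simp
        show "V (\<Union>i. A i) \<le> (\<Sum>i. V (A i))"
          unfolding V_def[of "\<Union>i. A i"]
        proof (rule SUP_least)
          fix B assume B: "B \<in> {B \<in> sets borel. B \<subseteq> (\<Union>i. A i)}"
          have "(\<lambda>i. smeas \<mu> (B \<inter> A i)) sums smeas \<mu> (\<Union>i. B \<inter> A i)"
            by (rule smeas_sums)
               (use B Ab A(2) in \<open>auto simp: disjoint_family_on_def\<close>)
          moreover have "(\<Union>i. B \<inter> A i) = B" using B by auto
          ultimately have s: "(\<lambda>n. \<Sum>i<n. smeas \<mu> (B \<inter> A i)) \<longlonglongrightarrow> smeas \<mu> B"
            by (simp add: sums_def)
          show "ennreal (smeas \<mu> B) \<le> (\<Sum>i. V (A i))"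
          proof (rule LIMSEQ_le_const2)
            show "(\<lambda>n. ennreal (\<Sum>i<n. smeas \<mu> (B \<inter> A i))) \<longlonglongrightarrow> ennreal (smeas \<mu> B)"
              using s by (rule tendsto_ennrealI)
            have "ennreal (\<Sum>i<n. smeas \<mu> (B \<inter> A i)) \<le> (\<Sum>i. V (A i))" for n
            proof -
              have "ennreal (\<Sum>i<n. smeas \<mu> (B \<inter> A i)) \<le> ennreal (\<Sum>i<n. max 0 (smeas \<mu> (B \<inter> A i)))"
                by (intro ennreal_leI sum_mono) auto
              also have "\<dots> = (\<Sum>i<n. ennreal (smeas \<mu> (B \<inter> A i)))"
                by (subst sum_ennreal[symmetric]) (auto intro!: sum.cong simp: max_def ennreal_neg simp del: sum_ennreal)
              also have "\<dots> \<le> (\<Sum>i<n. V (A i))"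
                by (intro sum_mono V_ub) (use B Ab in auto)
              also have "\<dots> \<le> (\<Sum>i. V (A i))"
                by (rule sum_le_suminf) auto
              finally show ?thesis .
            qed
            then show "\<exists>N. \<forall>n\<ge>N. ennreal (\<Sum>i<n. smeas \<mu> (B \<inter> A i)) \<le> (\<Sum>i. V (A i))"
              by blast
          qed
        qed
      qed
    qed
    show "A \<in> sets (pos_part \<mu>)" using assms by simp
  qed auto
  then show ?thesis by (simp add: V_def)
qed

lemma finite_measure_pos_part [simp]: "finite_measure (pos_part \<mu>)"
proof -
  obtain R where R: "\<And>A. \<bar>smeas \<mu> A\<bar> \<le> R" using smeas_bounded by blast
  have "emeasure (pos_part \<mu>) UNIV \<le> ennreal R"
    unfolding emeasure_pos_part[OF borel_open[OF open_UNIV]]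
    by (rule SUP_least) (rule ennreal_leI, rule abs_le_D1, rule R)
  then have "emeasure (pos_part \<mu>) UNIV \<noteq> \<infinity>"
    using ennreal_less_top[of R] by (metis infinity_ennreal_def leD top.extremum_strict le_less_trans)
  then show ?thesis
    by (intro finite_measureI) simp
qed

lemma measure_pos_part_upper:
  assumes "A \<in> sets borel" "B \<in> sets borel" "B \<subseteq> A"
  shows "smeas \<mu> B \<le> measure (pos_part \<mu>) A"
proof -
  have "ennreal (smeas \<mu> B) \<le> emeasure (pos_part \<mu>) A"
    unfolding emeasure_pos_part[OF assms(1)] by (rule SUP_upper) (use assms in auto)
  then show ?thesis
    by (simp add: finite_measure.emeasure_eq_measure ennreal_le_iff)
qed

lemma measure_pos_part_least:
  assumes "A \<in> sets borel" "\<And>B. B \<in> sets borel \<Longrightarrow> B \<subseteq> A \<Longrightarrow> smeas \<mu> B \<le> c"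
  shows "measure (pos_part \<mu>) A \<le> c"
proof -
  have "0 \<le> c" using assms(2)[of "{}"] by simp
  have "emeasure (pos_part \<mu>) A \<le> ennreal c"
    unfolding emeasure_pos_part[OF assms(1)]
    by (rule SUP_least) (use assms in \<open>auto intro!: ennreal_leI\<close>)
  then show ?thesis
    using \<open>0 \<le> c\<close> by (simp add: finite_measure.emeasure_eq_measure ennreal_le_iff)
qed

lemma sets_neg_part [simp, measurable_cong]: "sets (neg_part \<mu>) = sets borel"
  and space_neg_part [simp]: "space (neg_part \<mu>) = UNIV"
  and finite_measure_neg_part [simp]: "finite_measure (neg_part \<mu>)"
  by (auto simp: neg_part_def)

text \<open>Subtracting \<open>\<mu>(A)\<close> from the upper variation gives \<open>sup {\<mu>(B) - \<mu>(A) | B \<subseteq> A}\<close>, and passing to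
  complements in \<open>A\<close> turns this into \<open>sup {- \<mu>(B) | B \<subseteq> A}\<close>, the lower variation.\<close>

lemma smeas_eq_pos_neg:
  assumes A: "A \<in> sets borel"
  shows "smeas \<mu> A = measure (pos_part \<mu>) A - measure (neg_part \<mu>) A"
proof -
  have "measure (pos_part \<mu>) A \<le> smeas \<mu> A + measure (neg_part \<mu>) A"
  proof (rule measure_pos_part_least[OF A])
    fix B assume B: "B \<in> sets borel" "B \<subseteq> A"
    have "smeas (- \<mu>) (A - B) \<le> measure (neg_part \<mu>) A"
      unfolding neg_part_def by (rule measure_pos_part_upper) (use A B in auto)
    then show "smeas \<mu> B \<le> smeas \<mu> A + measure (neg_part \<mu>) A"
      using smeas_Diff[OF A B, of \<mu>] by simp
  qed
  moreover have "measure (neg_part \<mu>) A \<le> measure (pos_part \<mu>) A - smeas \<mu> A"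
    unfolding neg_part_def
  proof (rule measure_pos_part_least[OF A])
    fix B assume B: "B \<in> sets borel" "B \<subseteq> A"
    have "smeas \<mu> (A - B) \<le> measure (pos_part \<mu>) A"
      by (rule measure_pos_part_upper) (use A B in auto)
    then show "smeas (- \<mu>) B \<le> measure (pos_part \<mu>) A - smeas \<mu> A"
      using smeas_Diff[OF A B, of \<mu>] by simp
  qed
  ultimately show ?thesis by simp
qed

subsection \<open>Nonnegative signed measures and ordinary measures\<close>

definition smeas_of :: "'a::topological_space measure \<Rightarrow> 'a signed_measure" where
  "smeas_of M = Abs_signed_measure (measure M)"

lemma smeas_smeas_of:
  assumes "sets M = sets borel" "finite_measure M"
  shows "smeas (smeas_of M) = measure M"
  unfolding smeas_of_def
proof (rule Abs_signed_measure_inverse, safe)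
  fix A :: "'a set" assume "A \<notin> sets borel"
  then show "measure M A = 0" using assms by (simp add: measure_notin_sets)
next
  fix A :: "nat \<Rightarrow> 'a set" assume "range A \<subseteq> sets borel" "disjoint_family A"
  then show "(\<lambda>i. measure M (A i)) sums measure M (\<Union> (range A))"
    using assms by (intro finite_measure.finite_measure_UNION) auto
qed

definition nonneg_smeas :: "'a::topological_space signed_measure \<Rightarrow> bool" where
  "nonneg_smeas \<mu> \<longleftrightarrow> (\<forall>A. 0 \<le> smeas \<mu> A)"

lemma nonneg_smeasD: "nonneg_smeas \<mu> \<Longrightarrow> 0 \<le> smeas \<mu> A"
  by (simp add: nonneg_smeas_def)

lemma nonneg_smeas_0 [simp]: "nonneg_smeas 0"
  and nonneg_smeas_add: "nonneg_smeas \<mu> \<Longrightarrow> nonneg_smeas \<nu> \<Longrightarrow> nonneg_smeas (\<mu> + \<nu>)"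
  and nonneg_smeas_scaleR: "nonneg_smeas \<mu> \<Longrightarrow> 0 \<le> c \<Longrightarrow> nonneg_smeas (c *\<^sub>R \<mu>)"
  by (auto simp: nonneg_smeas_def)

lemma nonneg_smeas_of:
  "sets M = sets borel \<Longrightarrow> finite_measure M \<Longrightarrow> nonneg_smeas (smeas_of M)"
  by (simp add: nonneg_smeas_def smeas_smeas_of)

lemma nonneg_smeas_mono:
  assumes "nonneg_smeas \<mu>" "A \<subseteq> B" "A \<in> sets borel" "B \<in> sets borel"
  shows "smeas \<mu> A \<le> smeas \<mu> B"
  using smeas_Diff[of B A \<mu>] nonneg_smeasD[OF assms(1), of "B - A"] assms by simp

lemma measure_pos_part_nonneg:
  assumes "nonneg_smeas \<mu>"
  shows "measure (pos_part \<mu>) A = smeas \<mu> A"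
proof (cases "A \<in> sets borel")
  case True
  show ?thesis
    by (intro antisym measure_pos_part_least measure_pos_part_upper)
       (use True assms in \<open>auto intro: nonneg_smeas_mono\<close>)
next
  case False
  then show ?thesis by (simp add: measure_notin_sets smeas_notin_borel)
qed

lemma emeasure_pos_part_nonneg:
  assumes "nonneg_smeas \<mu>"
  shows "emeasure (pos_part \<mu>) A = ennreal (smeas \<mu> A)"
  by (simp add: finite_measure.emeasure_eq_measure measure_pos_part_nonneg[OF assms])

lemma finite_measure_eqI:
  assumes "sets M = sets borel" "sets N = sets borel" "finite_measure M" "finite_measure N"
    and "\<And>A. A \<in> sets borel \<Longrightarrow> measure M A = measure N A"
  shows "M = N"
  by (rule measure_eqI) (use assms in \<open>auto simp: finite_measure.emeasure_eq_measure\<close>)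

lemma pos_part_smeas_of:
  assumes "sets M = sets borel" "finite_measure M"
  shows "pos_part (smeas_of M) = M"
  by (rule finite_measure_eqI)
     (use assms in \<open>auto simp: measure_pos_part_nonneg nonneg_smeas_of smeas_smeas_of\<close>)

lemma smeas_of_pos_neg: "\<mu> = smeas_of (pos_part \<mu>) - smeas_of (neg_part \<mu>)"
  by (rule signed_measure_eqI) (simp add: smeas_eq_pos_neg smeas_smeas_of)

text \<open>Mutually singular parts are the Jordan decomposition of their difference: \<open>Y\<close> carries all of
  \<open>a\<close> and nothing of \<open>b\<close>, so that \<open>A \<inter> Y\<close> attains the upper variation on \<open>A\<close>.\<close>

lemma pos_part_diff_singular:
  assumes "nonneg_smeas a" "nonneg_smeas b" and Y: "Y \<in> sets borel"
    and "smeas a (- Y) = 0" "smeas b Y = 0"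
  shows "pos_part (a - b) = pos_part a"
proof (rule finite_measure_eqI)
  fix A :: "'a set" assume A: "A \<in> sets borel"
  show "measure (pos_part (a - b)) A = measure (pos_part a) A"
    unfolding measure_pos_part_nonneg[OF assms(1)]
  proof (rule antisym)
    show "measure (pos_part (a - b)) A \<le> smeas a A"
    proof (rule measure_pos_part_least[OF A])
      fix B assume "B \<in> sets borel" "B \<subseteq> A"
      then show "smeas (a - b) B \<le> smeas a A"
        using nonneg_smeas_mono[OF assms(1), of B A] nonneg_smeasD[OF assms(2), of B] A by simp
    qed
    have "smeas a (A - Y) \<le> smeas a (- Y)" "smeas b (A \<inter> Y) \<le> smeas b Y"
      by (intro nonneg_smeas_mono assms; use A Y in auto)+
    then have "smeas a (A - Y) = 0" "smeas b (A \<inter> Y) = 0"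
      using assms by (auto simp: nonneg_smeas_def intro: antisym)
    moreover have "smeas a A = smeas a (A \<inter> Y) + smeas a (A - Y)"
      using smeas_Un[of "A \<inter> Y" "A - Y" a] A Y by (simp add: Int_Diff_Un Int_Diff_disjoint)
    moreover have "smeas (a - b) (A \<inter> Y) \<le> measure (pos_part (a - b)) A"
      by (rule measure_pos_part_upper) (use A Y in auto)
    ultimately show "smeas a A \<le> measure (pos_part (a - b)) A" by simp
  qed
qed auto

lemma measure_pos_part_diff_le:
  assumes "nonneg_smeas a" "nonneg_smeas b" "A \<in> sets borel"
  shows "measure (pos_part (a - b)) A \<le> smeas a A"
proof (rule measure_pos_part_least[OF assms(3)])
  fix B assume "B \<in> sets borel" "B \<subseteq> A"
  then show "smeas (a - b) B \<le> smeas a A"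
    using nonneg_smeas_mono[OF assms(1), of B A] nonneg_smeasD[OF assms(2), of B] assms(3) by simp
qed

subsection \<open>The integral as a bilinear form\<close>

definition bounded_borel :: "('a::topological_space \<Rightarrow> real) \<Rightarrow> bool" where
  "bounded_borel f \<longleftrightarrow> f \<in> borel_measurable borel \<and> bounded (range f)"

lemma bounded_borel_measurable [measurable_dest]: "bounded_borel f \<Longrightarrow> f \<in> borel_measurable borel"
  by (simp add: bounded_borel_def)

lemma bounded_borel_bound:
  assumes "bounded_borel f" obtains B where "0 < B" "\<And>x. \<bar>f x\<bar> \<le> B"
  using assms unfolding bounded_borel_def bounded_pos by auto

lemma bounded_borelI:
  "f \<in> borel_measurable borel \<Longrightarrow> (\<And>x. \<bar>f x\<bar> \<le> B) \<Longrightarrow> bounded_borel f"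
  unfolding bounded_borel_def bounded_iff by auto

lemma bounded_borel_const [simp]: "bounded_borel (\<lambda>_. c)"
  by (rule bounded_borelI[of _ "\<bar>c\<bar>"]) auto

lemma bounded_borel_indicator [simp]: "A \<in> sets borel \<Longrightarrow> bounded_borel (indicator A)"
  by (rule bounded_borelI[of _ 1]) (auto simp: indicator_def)

lemma bounded_borel_add:
  assumes "bounded_borel f" "bounded_borel g" shows "bounded_borel (\<lambda>x. f x + g x)"
proof -
  obtain B C where "\<And>x. \<bar>f x\<bar> \<le> B" "\<And>x. \<bar>g x\<bar> \<le> C"
    using assms bounded_borel_bound by metis
  then have "\<bar>f x + g x\<bar> \<le> B + C" for x
    by (rule order_trans[OF abs_triangle_ineq add_mono])
  with assms show ?thesis
    by (intro bounded_borelI[where B = "B + C"]) (auto dest: bounded_borel_measurable)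
qed

lemma bounded_borel_mult:
  assumes "bounded_borel f" "bounded_borel g" shows "bounded_borel (\<lambda>x. f x * g x)"
proof -
  obtain B where B: "0 < B" "\<And>x. \<bar>f x\<bar> \<le> B" using assms(1) bounded_borel_bound by metis
  obtain C where C: "0 < C" "\<And>x. \<bar>g x\<bar> \<le> C" using assms(2) bounded_borel_bound by metis
  have "\<bar>f x * g x\<bar> \<le> B * C" for x
    unfolding abs_mult by (intro mult_mono) (use B C in \<open>auto intro: less_imp_le\<close>)
  with assms show ?thesis
    by (intro bounded_borelI[where B = "B * C"]) (auto dest: bounded_borel_measurable)
qed

lemma bounded_borel_cmult: "bounded_borel f \<Longrightarrow> bounded_borel (\<lambda>x. c * f x)"
  by (intro bounded_borel_mult) auto

lemma bounded_borel_minus: "bounded_borel f \<Longrightarrow> bounded_borel (\<lambda>x. - f x)"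
  using bounded_borel_cmult[of f "-1"] by simp

lemma bounded_borel_diff:
  "bounded_borel f \<Longrightarrow> bounded_borel g \<Longrightarrow> bounded_borel (\<lambda>x. f x - g x)"
  using bounded_borel_add[of f "\<lambda>x. - g x"] by (simp add: bounded_borel_minus)

lemma bounded_borel_compose:
  assumes "bounded_borel f" "g \<in> borel_measurable borel"
  shows "bounded_borel (\<lambda>x. f (g x))"
proof -
  obtain B where "\<And>x. \<bar>f x\<bar> \<le> B" using assms(1) bounded_borel_bound by metis
  with assms show ?thesis
    by (intro bounded_borelI[of _ B]) (auto dest: bounded_borel_measurable)
qed

lemma bounded_borel_continuous:
  "continuous_on UNIV f \<Longrightarrow> bounded (range f) \<Longrightarrow> bounded_borel f"
  by (simp add: bounded_borel_def borel_measurable_continuous_onI)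

lemma bounded_borel_restrict:
  fixes f :: "'a::t2_space \<Rightarrow> real"
  assumes "compact S" "continuous_on S f"
  shows "bounded_borel (\<lambda>x. indicator S x * f x)"
proof -
  have "bounded (f ` S)"
    using assms by (intro compact_imp_bounded compact_continuous_image)
  then obtain B where B: "0 < B" "\<And>x. x \<in> S \<Longrightarrow> \<bar>f x\<bar> \<le> B"
    unfolding bounded_pos by auto
  have "S \<in> sets borel" using assms(1) by (simp add: borel_closed compact_imp_closed)
  then have "(\<lambda>x. indicator S x *\<^sub>R f x) \<in> borel_measurable borel"
    using assms(2) borel_measurable_continuous_on_indicator by blast
  then show ?thesis
    using B by (intro bounded_borelI[of _ B]) (auto simp: indicator_def)
qed

lemma integrable_bounded_borel:
  assumes "sets M = sets borel" "finite_measure M" "bounded_borel f"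
  shows "integrable M f"
proof -
  obtain B where B: "\<And>x. \<bar>f x\<bar> \<le> B" using assms(3) bounded_borel_bound by metis
  show ?thesis
  proof (rule finite_measure.integrable_const_bound[OF assms(2)])
    show "AE x in M. norm (f x) \<le> B" using B by simp
    show "f \<in> borel_measurable M"
      using bounded_borel_measurable[OF assms(3)] measurable_cong_sets[OF assms(1) refl] by blast
  qed
qed

text \<open>Integration over the whole space. Functions that are only given on a compact set enter after
  multiplication by its indicator, which makes them bounded Borel functions.\<close>

definition sint :: "'a::topological_space signed_measure \<Rightarrow> ('a \<Rightarrow> real) \<Rightarrow> real" where
  "sint \<mu> f = integral\<^sup>L (pos_part \<mu>) f - integral\<^sup>L (neg_part \<mu>) f"

lemma smeas_integral_eq_sint: "smeas_integral S \<mu> f = sint \<mu> (\<lambda>x. indicator S x * f x)"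
  by (simp add: smeas_integral_def sint_def set_lebesgue_integral_def)

lemma sint_nonneg: "nonneg_smeas \<mu> \<Longrightarrow> sint \<mu> f = integral\<^sup>L (pos_part \<mu>) f"
proof -
  assume a: "nonneg_smeas \<mu>"
  have "measure (pos_part (- \<mu>)) A \<le> 0" if "A \<in> sets borel" for A
    by (rule measure_pos_part_least[OF that]) (simp add: nonneg_smeasD[OF a])
  then have "pos_part (- \<mu>) = null_measure borel"
    by (intro measure_eqI)
       (auto simp: finite_measure.emeasure_eq_measure[OF finite_measure_pos_part] measure_le_0_iff)
  then show ?thesis by (simp add: sint_def neg_part_def)
qed

text \<open>The Jordan decomposition is not additive, so linearity in the measure rests on additivity of
  the integral for nonnegative measures together with independence of the chosen decomposition.\<close>

lemma integral_add_measure: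
  fixes f :: "'a::topological_space \<Rightarrow> real"
  assumes sets: "sets M = sets borel" "sets N = sets borel" "sets Q = sets borel"
    and fin: "finite_measure M" "finite_measure N" "finite_measure Q"
    and Q: "\<And>A. A \<in> sets borel \<Longrightarrow> measure Q A = measure M A + measure N A"
    and f: "bounded_borel f"
  shows "integral\<^sup>L Q f = integral\<^sup>L M f + integral\<^sup>L N f"
proof -
  note [measurable_cong] = sets
  have space: "space M = UNIV" "space N = UNIV" "space Q = UNIV"
    using sets[THEN sets_eq_imp_space_eq] by auto
  have Qe: "emeasure Q A = emeasure M A + emeasure N A" if "A \<in> sets borel" for A
    unfolding fin[THEN finite_measure.emeasure_eq_measure] Q[OF that] by simp
  have nn: "(\<integral>\<^sup>+ x. g x \<partial>Q) = (\<integral>\<^sup>+ x. g x \<partial>M) + (\<integral>\<^sup>+ x. g x \<partial>N)"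
    if "g \<in> borel_measurable borel" for g :: "'a \<Rightarrow> ennreal"
    using that
  proof (induction rule: borel_measurable_induct)
    case (cong f g)
    then have "f = g" by auto
    with cong show ?case by simp
  next
    case (set A)
    then show ?case using sets by (simp add: Qe)
  next
    case (mult u c)
    note [measurable] = mult(2)
    from mult show ?case by (simp add: nn_integral_cmult distrib_left)
  next
    case (add u v)
    note [measurable] = add(1,3)
    from add show ?case by (simp add: nn_integral_add ac_simps)
  next
    case (seq U)
    note [measurable] = seq(1)
    have inc: "incseq (\<lambda>i. integral\<^sup>N K (U i))" for K
      using seq(3) by (intro incseq_SucI nn_integral_mono) (auto simp: incseq_def le_fun_def)
    have "(\<integral>\<^sup>+ x. (SUP i. U i) x \<partial>K) = (SUP i. integral\<^sup>N K (U i))" if "sets K = sets borel" for K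
    proof -
      note [measurable_cong] = that
      show ?thesis using seq(3) by (simp add: nn_integral_monotone_convergence_SUP image_comp)
    qed
    then show ?case
      using sets seq.IH inc by (simp add: ennreal_SUP_add)
  qed
  obtain B where B: "\<And>x. \<bar>f x\<bar> \<le> B" "0 < B" using f bounded_borel_bound by metis
  define g where "g x = f x + B" for x
  have g: "bounded_borel g" "0 \<le> g x" for x
    using B(1)[of x] f by (auto simp: g_def[abs_def] intro: bounded_borel_add)
  have int: "integrable K g" "integrable K f" if "sets K = sets borel" "finite_measure K" for K
    using that f g(1) by (auto intro: integrable_bounded_borel)
  have gK: "(\<integral>\<^sup>+ x. ennreal (g x) \<partial>K) = ennreal (integral\<^sup>L K g)" if "sets K = sets borel" "finite_measure K" for K
    using int(1)[OF that] g(2) by (intro nn_integral_eq_integral) auto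
  have pos: "0 \<le> integral\<^sup>L K g" for K using g(2) by (intro integral_nonneg_AE) auto
  have "ennreal (integral\<^sup>L Q g) = ennreal (integral\<^sup>L M g) + ennreal (integral\<^sup>L N g)"
    using nn[of "\<lambda>x. ennreal (g x)"] gK sets fin bounded_borel_measurable[OF g(1)] by simp
  then have "integral\<^sup>L Q g = integral\<^sup>L M g + integral\<^sup>L N g"
    using pos by (metis add_nonneg_nonneg ennreal_inj ennreal_plus)
  moreover have "integral\<^sup>L K g = integral\<^sup>L K f + B * measure K UNIV"
    if "sets K = sets borel" "finite_measure K" "space K = UNIV" for K
    using int(2)[OF that(1,2)] that finite_measure.emeasure_finite[OF that(2)]
    by (simp add: g_def[abs_def] finite_measure.integrable_const)
  ultimately show ?thesis
    using sets fin space Q[of UNIV] by (simp add: algebra_simps)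
qed

lemma integral_scale_finite_measure:
  assumes "sets M = sets borel" "sets Q = sets borel" "finite_measure M" "finite_measure Q" "0 \<le> c"
    and Q: "\<And>A. A \<in> sets borel \<Longrightarrow> measure Q A = c * measure M A"
    and f: "bounded_borel f"
  shows "integral\<^sup>L Q f = c * integral\<^sup>L M f"
proof -
  have "Q = density M (\<lambda>_. ennreal c)"
    by (rule measure_eqI)
       (use assms in \<open>auto simp: emeasure_density_const finite_measure.emeasure_eq_measure ennreal_mult\<close>)
  moreover have "f \<in> borel_measurable M"
    using assms(1) f by (simp add: bounded_borel_def cong: measurable_cong_sets)
  ultimately show ?thesis
    using \<open>0 \<le> c\<close> by (simp add: integral_density)
qed

lemma sint_diff_nonneg:
  assumes "nonneg_smeas a" "nonneg_smeas b" "bounded_borel f"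
  shows "sint (a - b) f = sint a f - sint b f"
proof -
  define m where "m = smeas_of (pos_part (a - b)) + b"
  have m: "nonneg_smeas m" unfolding m_def by (intro nonneg_smeas_add nonneg_smeas_of assms) auto
  have e: "smeas m A = measure (pos_part (a - b)) A + measure (pos_part b) A"
    "smeas m A = measure (neg_part (a - b)) A + measure (pos_part a) A" if "A \<in> sets borel" for A
    using smeas_eq_pos_neg[OF that, of "a - b"] assms
    by (auto simp: m_def smeas_smeas_of measure_pos_part_nonneg)
  have "integral\<^sup>L (pos_part m) f = integral\<^sup>L (pos_part (a - b)) f + integral\<^sup>L (pos_part b) f"
    using e(1) m assms(3) by (intro integral_add_measure) (auto simp: measure_pos_part_nonneg)
  moreover have "integral\<^sup>L (pos_part m) f = integral\<^sup>L (neg_part (a - b)) f + integral\<^sup>L (pos_part a) f"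
    using e(2) m assms(3) by (intro integral_add_measure) (auto simp: measure_pos_part_nonneg)
  ultimately show ?thesis
    using assms by (simp add: sint_nonneg sint_def[of "a - b"])
qed

lemma sint_add_nonneg:
  assumes "nonneg_smeas a" "nonneg_smeas b" "bounded_borel f"
  shows "sint (a + b) f = sint a f + sint b f"
  using assms by (auto simp: sint_nonneg nonneg_smeas_add measure_pos_part_nonneg
      intro!: integral_add_measure)

lemma sint_smeas_of:
  "sets M = sets borel \<Longrightarrow> finite_measure M \<Longrightarrow> sint (smeas_of M) f = integral\<^sup>L M f"
  by (simp add: sint_nonneg nonneg_smeas_of pos_part_smeas_of)

lemma sint_add:
  assumes "bounded_borel f" shows "sint (\<mu> + \<nu>) f = sint \<mu> f + sint \<nu> f"
proof -
  let ?p = "\<lambda>\<mu>. smeas_of (pos_part \<mu>)" and ?n = "\<lambda>\<mu>. smeas_of (neg_part \<mu>)"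
  have nn: "nonneg_smeas (?p \<mu>)" "nonneg_smeas (?n \<mu>)" for \<mu> :: "'a signed_measure"
    by (auto intro: nonneg_smeas_of)
  have "\<mu> + \<nu> = (?p \<mu> + ?p \<nu>) - (?n \<mu> + ?n \<nu>)"
    by (subst (1 2) smeas_of_pos_neg) (simp add: algebra_simps)
  then have "sint (\<mu> + \<nu>) f = sint (?p \<mu> + ?p \<nu>) f - sint (?n \<mu> + ?n \<nu>) f"
    using nn assms by (metis sint_diff_nonneg nonneg_smeas_add)
  then show ?thesis
    using nn assms by (simp add: sint_add_nonneg sint_smeas_of sint_def[of \<mu>] sint_def[of \<nu>])
qed

lemma sint_uminus: "sint (- \<mu>) f = - sint \<mu> f"
  by (simp add: sint_def neg_part_def)

lemma sint_diff: "bounded_borel f \<Longrightarrow> sint (\<mu> - \<nu>) f = sint \<mu> f - sint \<nu> f"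
  using sint_add[of f \<mu> "- \<nu>"] by (simp add: sint_uminus)

lemma sint_scaleR:
  assumes f: "bounded_borel f" shows "sint (c *\<^sub>R \<mu>) f = c * sint \<mu> f"
proof -
  have nn: "sint (c *\<^sub>R a) f = c * sint a f" if "nonneg_smeas a" "0 \<le> c" for a c
    using that f
    by (auto simp: sint_nonneg nonneg_smeas_scaleR measure_pos_part_nonneg
      intro!: integral_scale_finite_measure)
  have pos: "sint (c *\<^sub>R \<mu>) f = c * sint \<mu> f" if "0 \<le> c" for c
  proof -
    have "sint (c *\<^sub>R \<mu>) f
        = sint (c *\<^sub>R smeas_of (pos_part \<mu>)) f - sint (c *\<^sub>R smeas_of (neg_part \<mu>)) f"
      by (subst smeas_of_pos_neg[of \<mu>]) (simp add: scaleR_diff_right sint_diff f)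
    also have "\<dots> = c * sint \<mu> f"
      using that by (simp add: nn nonneg_smeas_of sint_smeas_of sint_def[of \<mu>] right_diff_distrib)
    finally show ?thesis .
  qed
  show ?thesis
    using pos[of c] pos[of "- c"] by (cases "0 \<le> c") (auto simp: sint_uminus)
qed

lemma sint_zero [simp]: "sint 0 f = 0"
  using sint_uminus[of 0 f] by simp

lemma sint_indicator: "A \<in> sets borel \<Longrightarrow> sint \<mu> (indicator A) = smeas \<mu> A"
  by (simp add: sint_def smeas_eq_pos_neg)

lemma integrable_pos_neg:
  assumes "bounded_borel f" shows "integrable (pos_part \<mu>) f" "integrable (neg_part \<mu>) f"
  using assms by (auto intro: integrable_bounded_borel)

lemma sint_add_fun:
  "bounded_borel f \<Longrightarrow> bounded_borel g \<Longrightarrow> sint \<mu> (\<lambda>x. f x + g x) = sint \<mu> f + sint \<mu> g"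
  by (simp add: sint_def integrable_pos_neg)

lemma sint_diff_fun:
  "bounded_borel f \<Longrightarrow> bounded_borel g \<Longrightarrow> sint \<mu> (\<lambda>x. f x - g x) = sint \<mu> f - sint \<mu> g"
  by (simp add: sint_def integrable_pos_neg)

lemma sint_cmult_fun: "sint \<mu> (\<lambda>x. c * f x) = c * sint \<mu> f"
  by (simp add: sint_def right_diff_distrib)

lemma sint_const: "sint \<mu> (\<lambda>_. c) = c * smeas \<mu> UNIV"
  by (simp add: sint_def smeas_eq_pos_neg right_diff_distrib)

lemma AE_pos_part:
  assumes "nonneg_smeas \<mu>" "\<mu> \<in> measures_on S" "S \<in> sets borel"
  shows "AE x in pos_part \<mu>. x \<in> S"
proof (rule AE_I)
  show "emeasure (pos_part \<mu>) (- S) = 0"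
    using assms by (simp add: emeasure_pos_part_nonneg measures_on_def)
qed (use assms in auto)

lemma measures_on_pos_neg:
  assumes "\<mu> \<in> measures_on S" "S \<in> sets borel"
  shows "smeas_of (pos_part \<mu>) \<in> measures_on S" "smeas_of (neg_part \<mu>) \<in> measures_on S"
proof -
  have "measure (pos_part \<nu>) A \<le> 0" if "A \<in> sets borel" "A \<inter> S = {}" "\<nu> \<in> measures_on S"
    for A and \<nu> :: "'a signed_measure"
  proof (rule measure_pos_part_least[OF that(1)])
    fix B assume B: "B \<in> sets borel" "B \<subseteq> A"
    then have "B \<inter> S = {}" using that(2) by blast
    then show "smeas \<nu> B \<le> 0" using that(3) B(1) by (simp add: measures_on_def)
  qed
  moreover have "- \<mu> \<in> measures_on S" using assms by (simp add: measures_on_def)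
  ultimately have "measure (pos_part \<mu>) A = 0" "measure (neg_part \<mu>) A = 0"
    if "A \<in> sets borel" "A \<inter> S = {}" for A
    using that assms(1) by (simp_all add: neg_part_def measure_le_0_iff)
  then show "smeas_of (pos_part \<mu>) \<in> measures_on S" "smeas_of (neg_part \<mu>) \<in> measures_on S"
    by (simp_all add: measures_on_def smeas_smeas_of)
qed

lemma measures_on_0 [simp]: "0 \<in> measures_on S"
  and measures_on_add: "\<mu> \<in> measures_on S \<Longrightarrow> \<nu> \<in> measures_on S \<Longrightarrow> \<mu> + \<nu> \<in> measures_on S"
  and measures_on_diff: "\<mu> \<in> measures_on S \<Longrightarrow> \<nu> \<in> measures_on S \<Longrightarrow> \<mu> - \<nu> \<in> measures_on S"
  and measures_on_scaleR: "\<mu> \<in> measures_on S \<Longrightarrow> c *\<^sub>R \<mu> \<in> measures_on S"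
  by (auto simp: measures_on_def)

lemma measures_on_sum:
  "(\<And>i. i \<in> I \<Longrightarrow> \<mu> i \<in> measures_on S) \<Longrightarrow> (\<Sum>i\<in>I. \<mu> i) \<in> measures_on S"
  by (auto simp: measures_on_def smeas_sum)

lemma smeas_measures_on:
  assumes "\<mu> \<in> measures_on S" "S \<in> sets borel" "A \<in> sets borel" "S \<subseteq> A"
  shows "smeas \<mu> A = smeas \<mu> UNIV"
proof -
  have "(UNIV - A) \<inter> S = {}" using assms(4) by auto
  then have "smeas \<mu> (UNIV - A) = 0"
    using assms(1,3) unfolding measures_on_def by (simp del: Compl_eq_Diff_UNIV)
  then show ?thesis using smeas_Diff[of UNIV A \<mu>] assms(3) by simp
qed

lemma sint_mono:
  assumes "nonneg_smeas \<mu>" "\<mu> \<in> measures_on S" "S \<in> sets borel" "bounded_borel f" "bounded_borel g"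
    and "\<And>x. x \<in> S \<Longrightarrow> f x \<le> g x"
  shows "sint \<mu> f \<le> sint \<mu> g"
  unfolding sint_nonneg[OF assms(1)]
proof (intro integral_mono_AE integrable_pos_neg assms(4,5))
  show "AE x in pos_part \<mu>. f x \<le> g x"
    using AE_pos_part[OF assms(1-3)] by eventually_elim (rule assms(6))
qed

lemma sint_cong:
  assumes "\<mu> \<in> measures_on S" "S \<in> sets borel" "bounded_borel f" "bounded_borel g"
    and "\<And>x. x \<in> S \<Longrightarrow> f x = g x"
  shows "sint \<mu> f = sint \<mu> g"
proof -
  have "sint \<nu> f = sint \<nu> g" if "nonneg_smeas \<nu>" "\<nu> \<in> measures_on S" for \<nu>
    by (intro antisym sint_mono[OF that assms(2)] assms) (use assms(5) in auto)
  then have "sint (smeas_of (pos_part \<mu>)) f = sint (smeas_of (pos_part \<mu>)) g"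
    "sint (smeas_of (neg_part \<mu>)) f = sint (smeas_of (neg_part \<mu>)) g"
    using measures_on_pos_neg[OF assms(1,2)] by (auto simp: nonneg_smeas_of)
  then show ?thesis by (simp add: sint_smeas_of sint_def[of \<mu>])
qed

lemma smeas_integral_eq_sint_on:
  assumes "\<mu> \<in> measures_on S" "S \<in> sets borel" "bounded_borel f"
  shows "smeas_integral S \<mu> f = sint \<mu> f"
  unfolding smeas_integral_eq_sint using assms
  by (intro sint_cong[OF assms(1,2)] bounded_borel_mult) auto

subsection \<open>Images, densities and point masses\<close>

definition push :: "('a::topological_space \<Rightarrow> 'b::topological_space) \<Rightarrow> 'a signed_measure \<Rightarrow> 'b signed_measure" where
  "push g \<mu> = smeas_of (distr (pos_part \<mu>) borel g) - smeas_of (distr (neg_part \<mu>) borel g)"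

lemma finite_measure_distr_part:
  assumes "g \<in> borel_measurable borel"
  shows "finite_measure (distr (pos_part \<mu>) borel g)" "finite_measure (distr (neg_part \<mu>) borel g)"
  using assms by (auto intro!: finite_measure.finite_measure_distr cong: measurable_cong_sets)

lemma smeas_push:
  assumes "g \<in> borel_measurable borel" "A \<in> sets borel"
  shows "smeas (push g \<mu>) A = smeas \<mu> (g -` A)"
proof -
  have "g -` A \<in> sets borel" using measurable_sets[OF assms] by simp
  then show ?thesis using assms
    by (simp add: push_def smeas_smeas_of finite_measure_distr_part smeas_eq_pos_neg[of "g -` A"]
      measure_distr cong: measurable_cong_sets)
qed

lemma sint_push:
  assumes g: "g \<in> borel_measurable borel" and f: "bounded_borel f"
  shows "sint (push g \<mu>) f = sint \<mu> (\<lambda>x. f (g x))"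
proof -
  have "f \<in> borel_measurable borel" using f by (rule bounded_borel_measurable)
  then show ?thesis
    using assms by (simp add: push_def sint_diff sint_smeas_of finite_measure_distr_part sint_def[of \<mu>]
      integral_distr cong: measurable_cong_sets)
qed

lemma push_add: "g \<in> borel_measurable borel \<Longrightarrow> push g (\<mu> + \<nu>) = push g \<mu> + push g \<nu>"
  and push_scaleR: "g \<in> borel_measurable borel \<Longrightarrow> push g (c *\<^sub>R \<mu>) = c *\<^sub>R push g \<mu>"
  by (rule signed_measure_eqI; simp add: smeas_push)+

lemma push_push:
  assumes "g \<in> borel_measurable borel" "h \<in> borel_measurable borel"
  shows "push h (push g \<mu>) = push (\<lambda>x. h (g x)) \<mu>"
proof (rule signed_measure_eqI)
  fix A :: "'c set" assume A: "A \<in> sets borel"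
  have "h -` A \<in> sets borel" using measurable_sets[OF assms(2) A] by simp
  moreover have "(\<lambda>x. h (g x)) \<in> borel_measurable borel"
    using assms by measurable
  ultimately show "smeas (push h (push g \<mu>)) A = smeas (push (\<lambda>x. h (g x)) \<mu>) A"
    using A assms by (simp add: smeas_push vimage_def)
qed

lemma nonneg_push:
  assumes "g \<in> borel_measurable borel" "nonneg_smeas \<mu>" shows "nonneg_smeas (push g \<mu>)"
  unfolding nonneg_smeas_def
proof
  fix A show "0 \<le> smeas (push g \<mu>) A"
    using assms by (cases "A \<in> sets borel") (auto simp: smeas_push smeas_notin_borel nonneg_smeasD)
qed

lemma pos_part_push:
  assumes "g \<in> borel_measurable borel" "nonneg_smeas \<mu>"
  shows "pos_part (push g \<mu>) = distr (pos_part \<mu>) borel g"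
proof (rule finite_measure_eqI)
  fix A :: "'b set" assume A: "A \<in> sets borel"
  have "g -` A \<in> sets borel" using measurable_sets[OF assms(1) A] by simp
  then show "measure (pos_part (push g \<mu>)) A = measure (distr (pos_part \<mu>) borel g) A"
    using assms A by (simp add: measure_pos_part_nonneg nonneg_push smeas_push measure_distr cong: measurable_cong_sets)
qed (use assms in \<open>auto intro: finite_measure_distr_part\<close>)

lemma measures_on_push:
  assumes "g \<in> borel_measurable borel" "\<mu> \<in> measures_on S" "g ` S \<subseteq> T"
  shows "push g \<mu> \<in> measures_on T"
  unfolding measures_on_def
proof safe
  fix A :: "'b set" assume A: "A \<in> sets borel" "A \<inter> T = {}"
  have "g -` A \<in> sets borel" using measurable_sets[OF assms(1) A(1)] by simp
  moreover have "g -` A \<inter> S = {}" using A(2) assms(3) by auto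
  ultimately show "smeas (push g \<mu>) A = 0"
    using assms(1,2) A(1) by (simp add: smeas_push measures_on_def)
qed

text \<open>Meant for nonnegative \<open>w\<close> and \<open>\<mu>\<close>; negative values of \<open>w\<close> and the negative part of \<open>\<mu>\<close> are cut off.\<close>

definition dens :: "('a::topological_space \<Rightarrow> real) \<Rightarrow> 'a signed_measure \<Rightarrow> 'a signed_measure" where
  "dens w \<mu> = smeas_of (density (pos_part \<mu>) (\<lambda>x. ennreal (w x)))"

context
  fixes w :: "'a::topological_space \<Rightarrow> real"
  assumes w: "bounded_borel w" "\<And>x. 0 \<le> w x"
begin

lemma finite_measure_density_pos_part: "finite_measure (density (pos_part \<mu>) (\<lambda>x. ennreal (w x)))"
proof (rule finite_measureI)
  have [measurable]: "w \<in> borel_measurable borel" by (rule bounded_borel_measurable[OF w(1)])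
  have "emeasure (density (pos_part \<mu>) (\<lambda>x. ennreal (w x))) UNIV = (\<integral>\<^sup>+ x. ennreal (w x) \<partial>pos_part \<mu>)"
    by (subst emeasure_density) auto
  also have "\<dots> = ennreal (integral\<^sup>L (pos_part \<mu>) w)"
    by (intro nn_integral_eq_integral integrable_pos_neg w) (use w(2) in auto)
  finally show "emeasure (density (pos_part \<mu>) (\<lambda>x. ennreal (w x)))
      (space (density (pos_part \<mu>) (\<lambda>x. ennreal (w x)))) \<noteq> \<infinity>"
    by simp
qed

lemma nonneg_dens: "nonneg_smeas (dens w \<mu>)"
  unfolding dens_def by (intro nonneg_smeas_of finite_measure_density_pos_part) auto

lemma sint_dens:
  assumes "nonneg_smeas \<mu>" "bounded_borel f"
  shows "sint (dens w \<mu>) f = sint \<mu> (\<lambda>x. w x * f x)"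
proof -
  have "w \<in> borel_measurable borel" "f \<in> borel_measurable borel"
    using w(1) assms(2) by (auto dest: bounded_borel_measurable)
  then show ?thesis
    using w(2) assms by (simp add: dens_def sint_smeas_of finite_measure_density_pos_part
      sint_nonneg integral_density cong: measurable_cong_sets)
qed

lemma smeas_dens:
  assumes "nonneg_smeas \<mu>" "A \<in> sets borel"
  shows "smeas (dens w \<mu>) A = sint \<mu> (\<lambda>x. w x * indicator A x)"
  using sint_dens[OF assms(1), of "indicator A"] assms(2) by (simp add: sint_indicator)

lemma measures_on_dens:
  assumes "nonneg_smeas \<mu>" "\<mu> \<in> measures_on S" "S \<in> sets borel" "T \<in> sets borel"
    and "\<And>x. x \<in> S \<Longrightarrow> x \<notin> T \<Longrightarrow> w x = 0"
  shows "dens w \<mu> \<in> measures_on T"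
  unfolding measures_on_def
proof safe
  fix A assume A: "A \<in> sets borel" "A \<inter> T = {}"
  have "sint \<mu> (\<lambda>x. w x * indicator A x) = sint \<mu> (\<lambda>x. 0)"
  proof (rule sint_cong[OF assms(2,3)])
    show "bounded_borel (\<lambda>x. w x * indicator A x)"
      by (intro bounded_borel_mult w bounded_borel_indicator A)
    fix x assume "x \<in> S"
    then show "w x * indicator A x = 0"
      using A(2) assms(5)[of x] by (cases "x \<in> A") auto
  qed simp
  then show "smeas (dens w \<mu>) A = 0"
    using A assms(1) by (simp add: smeas_dens sint_const)
qed

end

lemma smeas_dirac: "A \<in> sets borel \<Longrightarrow> smeas (dirac x) A = indicator A x"
  by (simp add: dirac.rep_eq)

lemma nonneg_dirac: "nonneg_smeas (dirac x)"
  by (simp add: nonneg_smeas_def dirac.rep_eq)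

lemma dirac_measures_on: "x \<in> S \<Longrightarrow> dirac x \<in> measures_on S"
  by (auto simp: measures_on_def smeas_dirac indicator_def)

lemma sint_dirac:
  assumes "bounded_borel f" shows "sint (dirac x) f = f x"
proof -
  have "sint (dirac x) f = sint (dirac x) (\<lambda>_. f x)"
    by (rule sint_cong[of _ "{x}"]) (use assms in \<open>auto intro: dirac_measures_on\<close>)
  then show ?thesis by (simp add: sint_const smeas_dirac)
qed

lemma push_dirac:
  assumes "g \<in> borel_measurable borel" shows "push g (dirac x) = dirac (g x)"
proof (rule signed_measure_eqI)
  fix A :: "'b set" assume A: "A \<in> sets borel"
  have "g -` A \<in> sets borel" using measurable_sets[OF assms A] by simp
  then show "smeas (push g (dirac x)) A = smeas (dirac (g x)) A"
    using A assms by (simp add: smeas_push smeas_dirac indicator_def)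
qed

subsection \<open>Continuous functions separate measures\<close>

text \<open>The indicator of a closed set is a decreasing limit of continuous functions, and closed sets
  form an intersection-stable generator of the Borel sets.\<close>

lemma signed_measure_eq_if_continuous:
  fixes \<mu> \<nu> :: "'a::metric_space signed_measure"
  assumes eq: "\<And>f. continuous_on UNIV f \<Longrightarrow> bounded (range f) \<Longrightarrow> sint \<mu> f = sint \<nu> f"
  shows "\<mu> = \<nu>"
proof -
  have closed_eq: "smeas \<mu> C = smeas \<nu> C" if C: "closed C" for C
  proof (cases "C = {}")
    case False
    define f where "f n x = max 0 (1 - real n * infdist x C)" for n x
    have cont: "continuous_on UNIV (f n)" for n
      unfolding f_def by (intro continuous_intros)
    have bd: "\<bar>f n x\<bar> \<le> 1" for n x by (auto simp: f_def infdist_nonneg)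
    have bb: "bounded_borel (f n)" for n
      by (rule bounded_borelI[OF borel_measurable_continuous_onI[OF cont] bd])
    have lim: "(\<lambda>n. f n x) \<longlonglongrightarrow> indicator C x" for x
    proof (cases "x \<in> C")
      case False
      then have pos: "infdist x C > 0"
        using C \<open>C \<noteq> {}\<close> infdist_pos_not_in_closed by blast
      have "f n x = 0" if "n \<ge> nat \<lceil>1 / infdist x C\<rceil>" for n
      proof -
        have "1 / infdist x C \<le> real n" using that by linarith
        then show ?thesis using pos by (simp add: f_def field_simps)
      qed
      then have "eventually (\<lambda>n. f n x = 0) sequentially"
        by (rule eventually_sequentiallyI)
      then show ?thesis using False by (simp add: tendsto_eventually)
    qed (simp add: f_def)
    have dct: "(\<lambda>n. integral\<^sup>L M (f n)) \<longlonglongrightarrow> integral\<^sup>L M (indicator C)"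
      if M: "sets M = sets borel" "finite_measure M" for M :: "'a measure"
    proof (rule integral_dominated_convergence)
      show "integrable M (\<lambda>_. 1 :: real)"
        by (rule integrable_bounded_borel[OF M bounded_borel_const])
      show "f n \<in> borel_measurable M" for n
        by (rule borel_measurable_integrable[OF integrable_bounded_borel[OF M bb]])
      show "(indicator C :: 'a \<Rightarrow> real) \<in> borel_measurable M"
        by (intro borel_measurable_integrable integrable_bounded_borel[OF M]
          bounded_borel_indicator borel_closed C)
      show "AE x in M. (\<lambda>n. f n x) \<longlonglongrightarrow> indicator C x" using lim by simp
      show "AE x in M. norm (f n x) \<le> 1" for n using bd by simp
    qed
    have L: "(\<lambda>n. sint \<kappa> (f n)) \<longlonglongrightarrow> sint \<kappa> (indicator C)" for \<kappa> :: "'a signed_measure"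
      unfolding sint_def by (intro tendsto_diff dct) auto
    have "sint \<mu> (f n) = sint \<nu> (f n)" for n
      using bb[of n] cont[of n] by (intro eq) (auto simp: bounded_borel_def)
    then have "(\<lambda>n. sint \<mu> (f n)) \<longlonglongrightarrow> sint \<nu> (indicator C)" using L[of \<nu>] by simp
    then have "sint \<mu> (indicator C) = sint \<nu> (indicator C)" by (rule LIMSEQ_unique[OF L])
    then show ?thesis using C by (simp add: sint_indicator borel_closed)
  qed simp
  \<comment> \<open>Moving the negative parts to the other side leaves an equation between finite measures.\<close>
  define a where "a = pos_part (smeas_of (pos_part \<mu>) + smeas_of (neg_part \<nu>))"
  define b where "b = pos_part (smeas_of (neg_part \<mu>) + smeas_of (pos_part \<nu>))"
  have ma: "measure a A = measure (pos_part \<mu>) A + measure (neg_part \<nu>) A"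
    and mb: "measure b A = measure (neg_part \<mu>) A + measure (pos_part \<nu>) A" for A
    by (simp_all add: a_def b_def measure_pos_part_nonneg nonneg_smeas_add nonneg_smeas_of smeas_smeas_of)
  have fin: "finite_measure a" "finite_measure b" "sets a = sets borel" "sets b = sets borel"
    by (auto simp: a_def b_def)
  have "a = b"
  proof (rule measure_eqI_generator_eq[where E = "Collect closed" and \<Omega> = UNIV and A = "\<lambda>_. UNIV"])
    show "Int_stable (Collect closed :: 'a set set)"
      by (auto simp: Int_stable_def)
    show "sets a = sigma_sets UNIV (Collect closed)" "sets b = sigma_sets UNIV (Collect closed)"
      using fin by (simp_all add: borel_eq_closed)
    fix X :: "'a set" assume "X \<in> Collect closed"
    then have "measure a X = measure b X"
      using closed_eq[of X] smeas_eq_pos_neg[of X \<mu>] smeas_eq_pos_neg[of X \<nu>] ma mb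
      by (simp add: borel_closed)
    then show "emeasure a X = emeasure b X"
      using fin by (simp add: finite_measure.emeasure_eq_measure)
  next
    show "emeasure a UNIV \<noteq> \<infinity>"
      using fin by (simp add: finite_measure.emeasure_eq_measure)
  qed auto
  show ?thesis
  proof (rule signed_measure_eqI)
    fix A :: "'a set" assume A: "A \<in> sets borel"
    show "smeas \<mu> A = smeas \<nu> A"
      using ma[of A] mb[of A] \<open>a = b\<close> smeas_eq_pos_neg[OF A, of \<mu>] smeas_eq_pos_neg[OF A, of \<nu>] by simp
  qed
qed

lemma weak_star_limit_unique:
  fixes \<mu> \<nu> :: "'a::metric_space signed_measure"
  assumes "compact S" "weak_star_tendsto S s \<mu>" "weak_star_tendsto S s \<nu>"
  shows "\<mu> = \<nu>"
proof (rule signed_measure_eq_if_continuous)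
  fix f :: "'a \<Rightarrow> real" assume f: "continuous_on UNIV f" "bounded (range f)"
  then have "continuous_on S f" using continuous_on_subset by blast
  then have "smeas_integral S \<mu> f = smeas_integral S \<nu> f"
    using assms unfolding weak_star_tendsto_def by (meson LIMSEQ_unique)
  moreover have "S \<in> sets borel" using assms(1) by (simp add: borel_closed compact_imp_closed)
  ultimately show "sint \<mu> f = sint \<nu> f"
    using assms f smeas_integral_eq_sint_on[of \<mu> S f] smeas_integral_eq_sint_on[of \<nu> S f]
    by (simp add: weak_star_tendsto_def bounded_borel_continuous)
qed

section \<open>Weak* compactness\<close>

subsection \<open>Coding a compact set by a subset of the line\<close>

text \<open>The first digit in which two expansions differ outweighs all later ones.\<close>

lemma ternary_digits_eq:
  fixes a b :: "nat \<Rightarrow> real"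
  assumes a: "\<And>i. a i \<in> {0, 1}" and b: "\<And>i. b i \<in> {0, 1}"
    and close: "\<bar>(\<Sum>i. a i * (1/3) ^ i) - (\<Sum>i. b i * (1/3) ^ i)\<bar> < (1/3) ^ m / 2"
    and "i \<le> m"
  shows "a i = b i"
proof (rule ccontr)
  assume "a i \<noteq> b i"
  define j where "j = (LEAST j. a j \<noteq> b j)"
  have j: "a j \<noteq> b j" unfolding j_def using \<open>a i \<noteq> b i\<close> by (rule LeastI)
  have before: "a l = b l" if "l < j" for l
    using that not_less_Least unfolding j_def by blast
  have "j \<le> i" unfolding j_def using \<open>a i \<noteq> b i\<close> by (rule Least_le)
  define d where "d i = a i - b i" for i
  have d: "\<bar>d i\<bar> \<le> 1" "\<bar>d j\<bar> = 1" for i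
    using a[of i] b[of i] a[of j] b[of j] j by (auto simp: d_def)
  have geo: "summable (\<lambda>i. (1/3 :: real) ^ i)" by (rule summable_geometric) simp
  have summ: "summable (\<lambda>i. c i * (1/3) ^ i)" if "\<And>i. \<bar>c i\<bar> \<le> 1" for c :: "nat \<Rightarrow> real"
    by (rule summable_comparison_test[OF _ geo])
       (use that in \<open>auto simp: abs_mult intro!: exI[of _ 0] mult_left_le_one_le\<close>)
  have "\<bar>a i\<bar> \<le> 1" "\<bar>b i\<bar> \<le> 1" for i using a[of i] b[of i] by auto
  then have "(\<Sum>i. a i * (1/3) ^ i) - (\<Sum>i. b i * (1/3) ^ i) = (\<Sum>i. d i * (1/3) ^ i)"
    by (simp add: suminf_diff summ d_def left_diff_distrib)
  also have "\<dots> = (\<Sum>i. d (i + Suc j) * (1/3) ^ (i + Suc j)) + (\<Sum>i<Suc j. d i * (1/3) ^ i)"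
    by (rule suminf_split_initial_segment) (rule summ[OF d(1)])
  also have "(\<Sum>i<Suc j. d i * (1/3) ^ i) = d j * (1/3) ^ j"
    using before by (simp add: d_def)
  finally have split: "(\<Sum>i. a i * (1/3) ^ i) - (\<Sum>i. b i * (1/3) ^ i)
      = (\<Sum>i. d (i + Suc j) * (1/3) ^ (i + Suc j)) + d j * (1/3) ^ j" .
  have geo_tail: "(\<lambda>i. (1/3 :: real) ^ (i + Suc j)) sums ((1/3) ^ j / 2)"
  proof -
    have "(\<lambda>i. (1/3) ^ Suc j * (1/3 :: real) ^ i) sums ((1/3) ^ Suc j * (1 / (1 - 1/3)))"
      by (intro sums_mult geometric_sums) simp
    then show ?thesis by (simp add: power_add field_simps)
  qed
  have tail: "\<bar>\<Sum>i. d (i + Suc j) * (1/3) ^ (i + Suc j)\<bar> \<le> (1/3) ^ j / 2"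
  proof -
    have "norm (\<Sum>i. d (i + Suc j) * (1/3) ^ (i + Suc j)) \<le> (\<Sum>i. (1/3 :: real) ^ (i + Suc j))"
      using geo_tail d(1)
      by (intro norm_suminf_le) (auto simp: abs_mult sums_iff intro!: mult_left_le_one_le)
    then show ?thesis using geo_tail by (simp add: sums_iff)
  qed
  have "\<bar>d j * (1/3) ^ j\<bar> = (1/3) ^ j" using d(2) by (simp add: abs_mult)
  then have "(1/3) ^ j / 2 \<le> \<bar>(\<Sum>i. a i * (1/3) ^ i) - (\<Sum>i. b i * (1/3) ^ i)\<bar>"
    using tail unfolding split by linarith
  moreover have "(1/3 :: real) ^ m \<le> (1/3) ^ j"
    using \<open>j \<le> i\<close> \<open>i \<le> m\<close> by (intro power_decreasing) auto
  ultimately show False using close by linarith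
qed

text \<open>The digits of \<open>s x\<close> record which of countably many small balls contain \<open>x\<close>. So \<open>s\<close> is
  Borel, while codes that are close together belong to points that share a small ball; the decoding
  map therefore extends continuously to the closure of the set of codes.\<close>

lemma compact_real_code:
  fixes S :: "'a::complete_space set"
  assumes "compact S"
  obtains s :: "'a \<Rightarrow> real" and g :: "real \<Rightarrow> 'a" and C
  where "s \<in> borel_measurable borel" "closed C" "C \<subseteq> {0..2}" "s ` S \<subseteq> C"
    "continuous_on C g" "g ` C \<subseteq> S" "\<And>x. x \<in> S \<Longrightarrow> g (s x) = x"
proof -
  have "\<exists>k. finite k \<and> S \<subseteq> (\<Union>x\<in>k. ball x (1 / real (Suc n)))" for n
    using assms unfolding compact_eq_totally_bounded by auto
  then obtain k where k: "\<And>n. finite (k n)" "\<And>n. S \<subseteq> (\<Union>x\<in>k n. ball x (1 / real (Suc n)))"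
    by metis
  define U where "U = insert {} (\<Union>n. (\<lambda>x. ball x (1 / real (Suc n))) ` k n)"
  have U: "countable U" "U \<noteq> {}" using k(1) by (auto simp: U_def countable_finite)
  define A where "A = from_nat_into U"
  have rangeA: "range A = U" unfolding A_def by (rule range_from_nat_into[OF U(2,1)])
  have openA: "open (A i)" for i
  proof -
    have "A i \<in> U" using rangeA by auto
    then show ?thesis by (auto simp: U_def)
  qed
  have fine: "\<exists>m. \<forall>x\<in>S. \<exists>i\<le>m. x \<in> A i \<and> (\<forall>y\<in>A i. dist x y < \<epsilon>)" if "0 < \<epsilon>" for \<epsilon>
  proof -
    from half_gt_zero[OF \<open>0 < \<epsilon>\<close>] obtain n where n: "1 / real (Suc n) < \<epsilon> / 2"
      by (rule nat_approx_posE)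
    have "\<exists>i. A i = ball x (1 / real (Suc n))" if "x \<in> k n" for x
    proof -
      have "ball x (1 / real (Suc n)) \<in> range A" unfolding rangeA U_def using that by blast
      then show ?thesis by auto
    qed
    then obtain \<iota> where \<iota>: "\<And>x. x \<in> k n \<Longrightarrow> A (\<iota> x) = ball x (1 / real (Suc n))" by metis
    show ?thesis
    proof (rule exI, rule ballI)
      fix x assume "x \<in> S"
      then obtain c where c: "c \<in> k n" "dist c x < 1 / real (Suc n)" using k(2)[of n] by auto
      have "dist x y < \<epsilon>" if "dist c y < 1 / real (Suc n)" for y
        using dist_triangle3[of x y c] c(2) that n by simp
      then have "\<iota> c \<le> Max (\<iota> ` k n) \<and> x \<in> A (\<iota> c) \<and> (\<forall>y\<in>A (\<iota> c). dist x y < \<epsilon>)"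
        using c k(1)[of n] by (auto simp: \<iota>)
      then show "\<exists>i\<le>Max (\<iota> ` k n). x \<in> A i \<and> (\<forall>y\<in>A i. dist x y < \<epsilon>)" by blast
    qed
  qed
  define s where "s x = (\<Sum>i. indicator (A i) x * (1/3 :: real) ^ i)" for x
  have s_meas: "s \<in> borel_measurable borel"
    unfolding s_def[abs_def] using openA
    by (intro borel_measurable_suminf borel_measurable_times borel_measurable_indicator) auto
  have sum_ind: "summable (\<lambda>i. indicator (A i) x * (1/3 :: real) ^ i)" for x
  proof (rule summable_comparison_test)
    show "\<exists>N. \<forall>n\<ge>N. norm (indicator (A n) x * (1/3 :: real) ^ n) \<le> (1/3) ^ n"
      by (auto simp: indicator_def)
  qed (rule summable_geometric, simp)
  have s_range: "s x \<in> {0..2}" for x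
  proof -
    have "s x \<le> (\<Sum>i. (1/3 :: real) ^ i)"
      unfolding s_def
      by (intro suminf_le sum_ind summable_geometric) (auto simp: indicator_def)
    moreover have "(\<Sum>i. (1/3 :: real) ^ i) = 3/2" by (subst suminf_geometric) auto
    moreover have "0 \<le> s x" unfolding s_def by (intro suminf_nonneg sum_ind) auto
    ultimately show ?thesis by auto
  qed
  have close: "\<exists>\<delta>>0. \<forall>x\<in>S. \<forall>y. \<bar>s x - s y\<bar> < \<delta> \<longrightarrow> dist x y < \<epsilon>" if "0 < \<epsilon>" for \<epsilon>
  proof -
    obtain m where m: "\<And>x. x \<in> S \<Longrightarrow> \<exists>i\<le>m. x \<in> A i \<and> (\<forall>y\<in>A i. dist x y < \<epsilon>)"
      using fine[OF \<open>0 < \<epsilon>\<close>] by blast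
    show ?thesis
    proof (intro exI conjI ballI allI impI)
      show "0 < (1/3 :: real) ^ m / 2" by simp
      fix x y assume "x \<in> S" and xy: "\<bar>s x - s y\<bar> < (1/3) ^ m / 2"
      obtain i where i: "i \<le> m" "x \<in> A i" "\<forall>y\<in>A i. dist x y < \<epsilon>" using m[OF \<open>x \<in> S\<close>] by blast
      have "indicator (A i) x = (indicator (A i) y :: real)"
        by (rule ternary_digits_eq[of "\<lambda>i. indicator (A i) x" "\<lambda>i. indicator (A i) y" m])
           (use xy i(1) in \<open>auto simp: s_def indicator_def\<close>)
      then have "y \<in> A i" using i(2) by (auto simp: indicator_def split: if_splits)
      then show "dist x y < \<epsilon>" using i(3) by blast
    qed
  qed
  have inj: "inj_on s S"
  proof (rule inj_onI, rule ccontr)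
    fix x y assume xy: "x \<in> S" "s x = s y" "x \<noteq> y"
    have "0 < dist x y" using xy(3) by simp
    then obtain \<delta> where "0 < \<delta>" "\<forall>x'\<in>S. \<forall>y'. \<bar>s x' - s y'\<bar> < \<delta> \<longrightarrow> dist x' y' < dist x y"
      using close by blast
    then have "\<bar>s x - s y\<bar> < \<delta> \<longrightarrow> dist x y < dist x y" using xy(1) by blast
    then show False using xy(2) \<open>0 < \<delta>\<close> by simp
  qed
  define h where "h = inv_into S s"
  have h: "h (s x) = x" if "x \<in> S" for x using inv_into_f_f[OF inj that] by (simp add: h_def)
  have ucont: "uniformly_continuous_on (s ` S) h"
    unfolding uniformly_continuous_on_def
  proof (intro allI impI)
    fix \<epsilon> :: real assume "0 < \<epsilon>"
    then obtain \<delta> where \<delta>: "\<delta> > 0" "\<forall>x\<in>S. \<forall>y. \<bar>s x - s y\<bar> < \<delta> \<longrightarrow> dist x y < \<epsilon>"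
      using close by blast
    show "\<exists>d>0. \<forall>x\<in>s ` S. \<forall>x'\<in>s ` S. dist x' x < d \<longrightarrow> dist (h x') (h x) < \<epsilon>"
      using \<delta> by (intro exI[of _ \<delta>]) (auto simp: h dist_real_def)
  qed
  from ucont obtain g where g: "uniformly_continuous_on (closure (s ` S)) g"
    "\<And>t. t \<in> s ` S \<Longrightarrow> h t = g t"
    by (rule uniformly_continuous_on_extension_on_closure) blast
  have cont: "continuous_on (closure (s ` S)) g"
    using g(1) by (rule uniformly_continuous_imp_continuous)
  show thesis
  proof (rule that[OF s_meas closed_closure _ closure_subset cont])
    show "closure (s ` S) \<subseteq> {0..2}"
      using s_range by (intro closure_minimal) auto
    show gs: "g (s x) = x" if "x \<in> S" for x using g(2)[of "s x"] h[OF that] that by simp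
    show "g ` closure (s ` S) \<subseteq> S"
      by (rule image_closure_subset[OF cont compact_imp_closed[OF assms]]) (auto simp: gs)
  qed
qed

subsection \<open>Bounded sequences of nonnegative measures\<close>

text \<open>Codes turn the sequence into measures on the line, where Helly's selection theorem applies.
  The missing mass is put at the point -1, which is isolated from the codes: this makes all
  the measures probability measures, and test functions that vanish at -1 do not see it.\<close>

lemma weak_star_compact_nonneg:
  fixes S :: "'a::complete_space set" and m :: "nat \<Rightarrow> 'a signed_measure"
  assumes "compact S" and m: "\<And>k. nonneg_smeas (m k)" "\<And>k. m k \<in> measures_on S"
    and bound: "\<And>k. smeas (m k) UNIV \<le> R"
  obtains r \<mu> where "strict_mono r" "nonneg_smeas \<mu>" "weak_star_tendsto S (m \<circ> r) \<mu>"
proof -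
  obtain s :: "'a \<Rightarrow> real" and g C where s [measurable]: "s \<in> borel_measurable borel" and C: "closed C" "C \<subseteq> {0..2}"
    and sS: "s ` S \<subseteq> C" and g: "continuous_on C g" "g ` C \<subseteq> S" "\<And>x. x \<in> S \<Longrightarrow> g (s x) = x"
    using compact_real_code[OF \<open>compact S\<close>] by metis
  have S_borel: "S \<in> sets borel" using \<open>compact S\<close> by (simp add: borel_closed compact_imp_closed)
  \<comment> \<open>A positive bound, to be divided by.\<close>
  define R' where "R' = max 1 R"
  have R': "0 < R'" "\<And>k. smeas (m k) UNIV \<le> R'" using bound by (auto simp: R'_def intro: max.coboundedI2)
  define D where "D = insert (-1) C"
  have D: "closed D" "D \<subseteq> {-2<..2}" and D_borel: "D \<in> sets borel" and C_borel: "C \<in> sets borel"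
    using C by (auto simp: D_def closed_insert)
  define P where "P k = (1 / R') *\<^sub>R (push s (m k) + (R' - smeas (m k) UNIV) *\<^sub>R dirac (-1))" for k
  have P_nonneg: "nonneg_smeas (P k)" for k
    using R' m unfolding P_def
    by (intro nonneg_smeas_scaleR nonneg_smeas_add nonneg_push nonneg_dirac) auto
  have P_D: "P k \<in> measures_on D" for k
    unfolding P_def
    by (intro measures_on_scaleR measures_on_add measures_on_push[OF s m(2)] dirac_measures_on)
       (use sS in \<open>auto simp: D_def\<close>)
  have P_UNIV: "smeas (P k) UNIV = 1" for k
    using R'(1) by (simp add: P_def smeas_push smeas_dirac)
  have prob: "prob_space (pos_part (P k))" for k
    by (rule prob_spaceI) (simp add: emeasure_pos_part_nonneg P_nonneg P_UNIV)
  define Q where "Q k = pos_part (P k)" for k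
  have tight: "tight Q"
    unfolding tight_def
  proof (intro conjI allI impI)
    fix k show "real_distribution (Q k)"
      by (simp add: Q_def real_distribution_def real_distribution_axioms_def prob)
  next
    fix \<epsilon> :: real assume "0 < \<epsilon>"
    have "measure (Q k) {-2<..2} = 1" for k
      using smeas_measures_on[OF P_D D_borel _ D(2)] P_UNIV by (simp add: Q_def measure_pos_part_nonneg P_nonneg)
    then show "\<exists>a b. a < b \<and> (\<forall>n. 1 - \<epsilon> < measure (Q n) {a<..b})"
      using \<open>0 < \<epsilon>\<close> by (intro exI[of _ "-2"] exI[of _ 2]) auto
  qed
  obtain r N where r: "strict_mono r" and N: "real_distribution N" and QN: "weak_conv_m (Q \<circ> id \<circ> r) N"
    using tight_imp_convergent_subsubsequence[OF tight strict_mono_id] by blast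
  interpret N: real_distribution N by (rule N)
  have real_dist: "real_distribution ((Q \<circ> id \<circ> r) k)" for k
    using tight by (simp add: tight_def)
  have conv: "(\<lambda>k. sint (P (r k)) \<phi>) \<longlonglongrightarrow> integral\<^sup>L N \<phi>"
    if "continuous_on UNIV \<phi>" "\<And>x. \<bar>\<phi> x\<bar> \<le> B" for \<phi> :: "real \<Rightarrow> real" and B
  proof -
    have "(\<lambda>k. integral\<^sup>L ((Q \<circ> id \<circ> r) k) \<phi>) \<longlonglongrightarrow> integral\<^sup>L N \<phi>"
      by (rule weak_conv_imp_integral_bdd_continuous_conv[OF real_dist N QN])
         (use that in \<open>auto simp: continuous_on_eq_continuous_at\<close>)
    then show ?thesis by (simp add: Q_def sint_nonneg P_nonneg)
  qed
  have AE_D: "AE t in N. t \<in> D"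
  proof -
    \<comment> \<open>A bounded continuous function that vanishes exactly on \<open>D\<close>.\<close>
    define \<psi> where "\<psi> t = min 1 (infdist t D)" for t
    have cont: "continuous_on UNIV \<psi>" unfolding \<psi>_def by (intro continuous_intros)
    have bd: "\<bar>\<psi> t\<bar> \<le> 1" and nn: "0 \<le> \<psi> t" for t by (auto simp: \<psi>_def infdist_nonneg)
    have bb: "bounded_borel \<psi>" by (rule bounded_borelI[OF borel_measurable_continuous_onI[OF cont] bd])
    have "sint (P k) \<psi> = sint (P k) (\<lambda>_. 0)" for k
      by (rule sint_cong[OF P_D D_borel bb]) (auto simp: \<psi>_def)
    then have "sint (P k) \<psi> = 0" for k by (simp add: sint_const)
    then have "integral\<^sup>L N \<psi> = 0" using conv[OF cont bd] by (simp add: LIMSEQ_const_iff)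
    moreover have "integrable N \<psi>"
      by (rule integrable_bounded_borel[OF _ _ bb]) (simp_all add: N.finite_measure_axioms)
    ultimately have "AE t in N. \<psi> t = 0" using nn by (simp add: integral_nonneg_eq_0_iff_AE)
    then show ?thesis
    proof eventually_elim
      case (elim t)
      then have "infdist t D = 0" by (simp add: \<psi>_def min_def split: if_splits)
      then show ?case using in_closed_iff_infdist_zero[OF D(1)] by (auto simp: D_def)
    qed
  qed
  define g' where "g' t = (if t \<in> C then g t else undefined)" for t
  have g' [measurable]: "g' \<in> borel_measurable borel"
    unfolding g'_def[abs_def] by (rule borel_measurable_continuous_on_if[OF C_borel g(1)]) auto
  \<comment> \<open>The limit may have mass at -1, which has to be removed before decoding.\<close>
  define \<mu> where "\<mu> = R' *\<^sub>R push g' (dens (indicator C) (smeas_of N))"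
  have bb_C: "bounded_borel (indicator C)" "\<And>t. 0 \<le> (indicator C t :: real)"
    using C_borel by auto
  have N_nonneg: "nonneg_smeas (smeas_of N)"
    by (rule nonneg_smeas_of) (simp_all add: N.finite_measure_axioms)
  have N_UNIV: "smeas_of N \<in> measures_on UNIV" by (auto simp: measures_on_def)
  have "dens (indicator C) (smeas_of N) \<in> measures_on C"
    by (rule measures_on_dens[OF bb_C N_nonneg N_UNIV _ C_borel]) auto
  then have \<mu>_S: "\<mu> \<in> measures_on S"
    unfolding \<mu>_def by (intro measures_on_scaleR measures_on_push[OF g']) (use g(2) in \<open>auto simp: g'_def\<close>)
  have \<mu>_nonneg: "nonneg_smeas \<mu>"
    unfolding \<mu>_def using R'(1) by (intro nonneg_smeas_scaleR nonneg_push g' nonneg_dens bb_C) auto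
  have "(\<lambda>k. smeas_integral S ((m \<circ> r) k) f) \<longlonglongrightarrow> smeas_integral S \<mu> f" if f: "continuous_on S f" for f
  proof -
    define f' where "f' x = indicator S x * f x" for x
    have bb_f': "bounded_borel f'"
      unfolding f'_def[abs_def] by (rule bounded_borel_restrict[OF \<open>compact S\<close> f])
    then obtain B where B: "0 < B" "\<And>x. \<bar>f' x\<bar> \<le> B" using bounded_borel_bound by blast
    define \<phi> where "\<phi> t = (if t \<in> C then f (g t) else 0)" for t
    have "continuous_on C \<phi>"
      using continuous_on_compose2[OF f g(1,2)] by (rule continuous_on_eq) (simp add: \<phi>_def)
    moreover have "continuous_on {-1} \<phi>" by simp
    ultimately have "continuous_on D \<phi>"
      unfolding D_def using continuous_on_closed_Un[of "{-1}" C \<phi>] C(1) by simp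
    moreover have "\<bar>\<phi> t\<bar> \<le> B" for t
      using B(1) B(2)[of "g t"] g(2) by (auto simp: \<phi>_def f'_def)
    ultimately obtain \<Phi> where \<Phi>: "continuous_on UNIV \<Phi>" "\<And>t. t \<in> D \<Longrightarrow> \<Phi> t = \<phi> t" "\<And>t. \<bar>\<Phi> t\<bar> \<le> B"
      using Tietze[of D \<phi> UNIV B] D(1) B(1) by auto
    have bb_\<Phi>: "bounded_borel \<Phi>"
      by (rule bounded_borelI[OF borel_measurable_continuous_onI[OF \<Phi>(1)] \<Phi>(3)])
    have "\<Phi> (-1) = 0" using \<Phi>(2)[of "-1"] C(2) by (auto simp: \<phi>_def D_def)
    moreover have "sint (m k) (\<lambda>x. \<Phi> (s x)) = sint (m k) f'" for k
    proof (rule sint_cong[OF m(2) S_borel bounded_borel_compose[OF bb_\<Phi> s] bb_f'])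
      fix x assume "x \<in> S"
      then show "\<Phi> (s x) = f' x" using sS \<Phi>(2)[of "s x"] g(3)[of x] by (auto simp: \<phi>_def f'_def D_def)
    qed
    ultimately have left: "R' * sint (P k) \<Phi> = sint (m k) f'" for k
      using R'(1) by (simp add: P_def sint_scaleR sint_add sint_push sint_dirac bb_\<Phi>)
    have "integral\<^sup>L N \<Phi> = integral\<^sup>L N (\<lambda>t. indicator C t * f' (g' t))"
    proof (rule integral_cong_AE)
      show "AE t in N. \<Phi> t = indicator C t * f' (g' t)"
        using AE_D
      proof eventually_elim
        case (elim t)
        then show ?case using \<Phi>(2)[of t] g(2) by (auto simp: \<phi>_def f'_def g'_def indicator_def)
      qed
      show "\<Phi> \<in> borel_measurable N"
        using bounded_borel_measurable[OF bb_\<Phi>] by simp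
      have "(\<lambda>t. indicator C t * f' (g' t)) \<in> borel_measurable borel"
        by (intro bounded_borel_measurable bounded_borel_mult bb_C bounded_borel_compose[OF bb_f' g'])
      then show "(\<lambda>t. indicator C t * f' (g' t)) \<in> borel_measurable N" by simp
    qed
    also have "\<dots> = sint (smeas_of N) (\<lambda>t. indicator C t * f' (g' t))"
      by (simp add: sint_smeas_of N.finite_measure_axioms)
    also have "R' * \<dots> = sint \<mu> f'"
      unfolding \<mu>_def
      by (simp add: sint_scaleR bb_f' sint_push g' sint_dens[OF bb_C N_nonneg] bounded_borel_compose)
    finally have "R' * integral\<^sup>L N \<Phi> = sint \<mu> f'" by simp
    moreover have "(\<lambda>k. R' * sint (P (r k)) \<Phi>) \<longlonglongrightarrow> R' * integral\<^sup>L N \<Phi>"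
      by (intro tendsto_mult tendsto_const conv[OF \<Phi>(1,3)])
    ultimately show ?thesis
      by (simp add: left smeas_integral_eq_sint f'_def[abs_def])
  qed
  then have "weak_star_tendsto S (m \<circ> r) \<mu>" using \<mu>_S by (simp add: weak_star_tendsto_def)
  then show thesis using that[OF r \<mu>_nonneg] by blast
qed

subsection \<open>Product measures and bounded densities\<close>

definition prod_smeas ::
  "'a::second_countable_topology signed_measure \<Rightarrow> 'b::second_countable_topology signed_measure \<Rightarrow>
   ('a \<times> 'b) signed_measure" where
  "prod_smeas \<mu> \<nu> = smeas_of (pos_part \<mu> \<Otimes>\<^sub>M pos_part \<nu>)"

lemma borel_measurable_fst_snd:
  "fst \<in> borel_measurable (borel :: ('a::second_countable_topology \<times> 'b::second_countable_topology) measure)"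
  "snd \<in> borel_measurable (borel :: ('a::second_countable_topology \<times> 'b::second_countable_topology) measure)"
  by (auto intro!: borel_measurable_continuous_onI continuous_intros)

lemma sets_pair_pos_part:
  "sets (pos_part \<mu> \<Otimes>\<^sub>M pos_part \<nu>) =
   sets (borel :: ('a::second_countable_topology \<times> 'b::second_countable_topology) measure)"
  unfolding borel_prod[symmetric] by (intro sets_pair_measure_cong sets_pos_part)

lemma nonneg_prod_smeas: "nonneg_smeas (prod_smeas \<mu> \<nu>)"
  unfolding prod_smeas_def by (intro nonneg_smeas_of sets_pair_pos_part finite_measure_pair_measure) auto

lemma smeas_prod_Times:
  assumes "nonneg_smeas \<mu>" "nonneg_smeas \<nu>" "A \<in> sets borel" "B \<in> sets borel"
  shows "smeas (prod_smeas \<mu> \<nu>) (A \<times> B) = smeas \<mu> A * smeas \<nu> B"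
proof -
  have fin: "finite_measure (pos_part \<mu> \<Otimes>\<^sub>M pos_part \<nu>)" by (intro finite_measure_pair_measure) auto
  interpret N: finite_measure "pos_part \<nu>" by simp
  have "emeasure (pos_part \<mu> \<Otimes>\<^sub>M pos_part \<nu>) (A \<times> B) = emeasure (pos_part \<mu>) A * emeasure (pos_part \<nu>) B"
    using assms by (intro N.emeasure_pair_measure_Times) auto
  then have "measure (pos_part \<mu> \<Otimes>\<^sub>M pos_part \<nu>) (A \<times> B) = smeas \<mu> A * smeas \<nu> B"
    by (simp add: measure_def emeasure_pos_part_nonneg assms(1,2) enn2real_mult nonneg_smeasD)
  then show ?thesis
    unfolding prod_smeas_def smeas_smeas_of[OF sets_pair_pos_part fin] .
qed

lemma push_prod_smeas:
  assumes "nonneg_smeas \<mu>" "nonneg_smeas \<nu>"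
  shows "push fst (prod_smeas \<mu> \<nu>) = smeas \<nu> UNIV *\<^sub>R \<mu>"
    and "push snd (prod_smeas \<mu> \<nu>) = smeas \<mu> UNIV *\<^sub>R \<nu>"
proof -
  show "push fst (prod_smeas \<mu> \<nu>) = smeas \<nu> UNIV *\<^sub>R \<mu>"
  proof (rule signed_measure_eqI)
    fix A :: "'a set" assume "A \<in> sets borel"
    moreover have "fst -` A = A \<times> (UNIV :: 'b set)" by auto
    ultimately show "smeas (push fst (prod_smeas \<mu> \<nu>)) A = smeas (smeas \<nu> UNIV *\<^sub>R \<mu>) A"
      by (simp add: smeas_push borel_measurable_fst_snd smeas_prod_Times assms)
  qed
  show "push snd (prod_smeas \<mu> \<nu>) = smeas \<mu> UNIV *\<^sub>R \<nu>"
  proof (rule signed_measure_eqI)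
    fix A :: "'b set" assume "A \<in> sets borel"
    moreover have "snd -` A = (UNIV :: 'a set) \<times> A" by auto
    ultimately show "smeas (push snd (prod_smeas \<mu> \<nu>)) A = smeas (smeas \<mu> UNIV *\<^sub>R \<nu>) A"
      by (simp add: smeas_push borel_measurable_fst_snd smeas_prod_Times assms)
  qed
qed

lemma prod_smeas_measures_on:
  assumes "nonneg_smeas \<mu>" "nonneg_smeas \<nu>" "\<mu> \<in> measures_on S" "\<nu> \<in> measures_on T"
    and S: "S \<in> sets borel" and T: "T \<in> sets borel"
  shows "prod_smeas \<mu> \<nu> \<in> measures_on (S \<times> T)"
  unfolding measures_on_def
proof safe
  fix A :: "('a \<times> 'b) set" assume A: "A \<in> sets borel" "A \<inter> (S \<times> T) = {}"
  let ?S = "(- S) \<times> (UNIV :: 'b set)" and ?T = "S \<times> (- T)"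
  have sets: "?S \<in> sets borel" "?T \<in> sets borel"
    using S T by (simp_all add: borel_prod[symmetric])
  have "smeas \<mu> (- S) = 0" "smeas \<nu> (- T) = 0"
    using assms by (auto simp: measures_on_def)
  then have "smeas (prod_smeas \<mu> \<nu>) ?S = 0" "smeas (prod_smeas \<mu> \<nu>) ?T = 0"
    using S T smeas_prod_Times[OF assms(1,2)] by (simp_all add: sets.compl_sets)
  moreover have "smeas (prod_smeas \<mu> \<nu>) (?S \<union> ?T) = smeas (prod_smeas \<mu> \<nu>) ?S + smeas (prod_smeas \<mu> \<nu>) ?T"
    by (rule smeas_Un[OF sets]) auto
  moreover have "smeas (prod_smeas \<mu> \<nu>) A \<le> smeas (prod_smeas \<mu> \<nu>) (?S \<union> ?T)"
    using A sets by (intro nonneg_smeas_mono nonneg_prod_smeas) auto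
  ultimately show "smeas (prod_smeas \<mu> \<nu>) A = 0"
    using nonneg_smeasD[OF nonneg_prod_smeas, of \<mu> \<nu> A] by simp
qed

text \<open>A Radon--Nikodym derivative of a measure that is dominated setwise is at most 1 almost
  everywhere, so it may be truncated.\<close>

lemma dominated_density:
  assumes "nonneg_smeas a" "nonneg_smeas c" and le: "\<And>A. A \<in> sets borel \<Longrightarrow> smeas c A \<le> smeas a A"
  obtains f where "bounded_borel f" "\<And>x. 0 \<le> f x" "\<And>x. f x \<le> 1" "dens f a = c"
proof -
  let ?A = "pos_part a" and ?C = "pos_part c"
  interpret A: finite_measure ?A by simp
  have eA: "emeasure ?A X = ennreal (smeas a X)" and eC: "emeasure ?C X = ennreal (smeas c X)" for X
    by (simp_all add: emeasure_pos_part_nonneg assms)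
  have "absolutely_continuous ?A ?C"
    unfolding absolutely_continuous_def
  proof
    fix X assume "X \<in> null_sets ?A"
    then have "X \<in> sets borel" "smeas a X \<le> 0"
      by (auto simp: null_sets_def eA ennreal_eq_0_iff)
    then show "X \<in> null_sets ?C"
      using le[of X] by (auto simp: null_sets_def eC ennreal_eq_0_iff)
  qed
  then obtain f0 where f0 [measurable]: "f0 \<in> borel_measurable ?A" and dens0: "density ?A f0 = ?C"
    using A.Radon_Nikodym[of ?C] by auto
  have f0_borel [measurable]: "f0 \<in> borel_measurable borel"
    using f0 measurable_cong_sets[OF sets_pos_part refl] by blast
  have AE: "AE x in ?A. f0 x \<le> 1"
  proof (rule ccontr)
    assume not: "\<not> (AE x in ?A. f0 x \<le> 1)"
    define N where "N = {x. 1 < f0 x}"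
    have N: "N \<in> sets borel" unfolding N_def by measurable
    then have N': "N \<in> sets ?A" by simp
    have "(\<integral>\<^sup>+x. indicator N x \<partial>?A) < (\<integral>\<^sup>+x. f0 x * indicator N x \<partial>?A)"
    proof (rule nn_integral_less)
      show "(\<integral>\<^sup>+x. indicator N x \<partial>?A) \<noteq> \<infinity>" using N' by (simp add: eA)
      show "AE x in ?A. indicator N x \<le> f0 x * indicator N x"
        by (auto simp: N_def indicator_def)
      show "\<not> (AE x in ?A. f0 x * indicator N x \<le> indicator N x)"
      proof
        assume "AE x in ?A. f0 x * indicator N x \<le> indicator N x"
        then have "AE x in ?A. f0 x \<le> 1"
          by eventually_elim (auto simp: N_def indicator_def not_le[symmetric] of_bool_def split: if_splits)
        with not show False by blast
      qed
    qed (use N' in measurable)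
    also have "\<dots> = emeasure ?C N"
      unfolding dens0[symmetric] by (rule emeasure_density[OF f0 N', symmetric])
    also have "\<dots> \<le> emeasure ?A N" using le[OF N] by (simp add: eA eC ennreal_leI)
    finally show False using N' by simp
  qed
  define f where "f x = enn2real (min 1 (f0 x))" for x
  have f01: "0 \<le> f x" "f x \<le> 1" for x
  proof -
    have "enn2real (min 1 (f0 x)) \<le> enn2real 1" by (rule enn2real_mono) auto
    then show "f x \<le> 1" by (simp add: f_def)
  qed (simp add: f_def)
  have "f \<in> borel_measurable borel" unfolding f_def[abs_def] by measurable
  then have bb: "bounded_borel f" by (rule bounded_borelI[of _ 1]) (use f01 in auto)
  have "density ?A (\<lambda>x. ennreal (f x)) = density ?A f0"
  proof (rule density_cong)
    show "(\<lambda>x. ennreal (f x)) \<in> borel_measurable ?A"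
      unfolding f_def[abs_def] by measurable
    show "AE x in ?A. ennreal (f x) = f0 x"
      using AE
    proof eventually_elim
      case (elim x)
      then have "f0 x < top" using ennreal_one_less_top le_less_trans by blast
      then show ?case using elim by (simp add: f_def min_absorb2)
    qed
  qed measurable
  then have "dens f a = smeas_of ?C" by (simp add: dens_def dens0)
  also have "\<dots> = c"
    by (rule signed_measure_eqI) (simp add: smeas_smeas_of measure_pos_part_nonneg assms)
  finally show thesis using that[OF bb f01] by blast
qed

section \<open>The norm as a linear minimization problem\<close>

subsection \<open>Joining two transports\<close>

text \<open>For \<open>p \<le> 1\<close> the \<open>p\<close>-th power of a metric satisfies the triangle inequality.\<close>

lemma powr_add_le:
  fixes a b :: real
  assumes "0 < p" "p \<le> 1" "0 \<le> a" "0 \<le> b"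
  shows "(a + b) powr p \<le> a powr p + b powr p"
proof (cases "a + b = 0")
  case False
  then have s: "0 < a + b" using assms by linarith
  have "x \<le> x powr p" if "0 \<le> x" "x \<le> 1" for x
    using powr_mono'[of p 1 x] assms that by (cases "x = 0") auto
  then have "a / (a + b) \<le> (a / (a + b)) powr p" "b / (a + b) \<le> (b / (a + b)) powr p"
    using assms s by auto
  then have "a / (a + b) + b / (a + b) \<le> (a powr p + b powr p) / (a + b) powr p"
    using assms s by (simp add: powr_divide add_divide_distrib)
  moreover have "a / (a + b) + b / (a + b) = 1" using s by (simp add: add_divide_distrib[symmetric])
  ultimately show ?thesis using s by (simp add: le_divide_eq)
qed (use assms in auto)

locale KR_setting =
  fixes \<Omega> :: "'a::euclidean_space set" and p \<alpha> \<beta> :: real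
  assumes compact_\<Omega>: "compact \<Omega>" and p: "0 < p" "p \<le> 1" and \<alpha>: "0 < \<alpha>" and \<beta>: "0 < \<beta>"
begin

lemma \<Omega>_borel: "\<Omega> \<in> sets borel"
  using compact_\<Omega> by (simp add: borel_closed compact_imp_closed)

lemma compact_\<Omega>2: "compact (\<Omega> \<times> \<Omega>)"
  using compact_\<Omega> by (intro compact_Times)

lemma \<Omega>2_borel: "\<Omega> \<times> \<Omega> \<in> sets borel"
  using compact_\<Omega>2 by (simp add: borel_closed compact_imp_closed)

lemmas push_fst_snd = push_add[OF borel_measurable_fst_snd(1)] push_add[OF borel_measurable_fst_snd(2)]
  push_scaleR[OF borel_measurable_fst_snd(1)] push_scaleR[OF borel_measurable_fst_snd(2)]

text \<open>The ground cost is cut off outside \<open>\<Omega> \<times> \<Omega>\<close> to make it bounded.\<close>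

definition ground_cost :: "'a \<times> 'a \<Rightarrow> real" where
  "ground_cost w = indicator (\<Omega> \<times> \<Omega>) w * (dist (fst w) (snd w) powr p + \<beta>)"

lemma continuous_dist_powr: "continuous_on S (\<lambda>w. dist (fst w) (snd w) powr p + \<beta>)"
  using p by (intro continuous_intros continuous_on_powr') auto

lemma bounded_borel_ground_cost: "bounded_borel ground_cost"
  unfolding ground_cost_def[abs_def]
  by (rule bounded_borel_restrict[OF compact_\<Omega>2 continuous_dist_powr])

lemma ground_cost_eq: "x \<in> \<Omega> \<Longrightarrow> y \<in> \<Omega> \<Longrightarrow> ground_cost (x, y) = dist x y powr p + \<beta>"
  by (simp add: ground_cost_def)

text \<open>Mass that arrives in a cell \<open>Z\<close> and mass that leaves it can be joined: arrivals and
  departures are paired independently of each other. The detour inside \<open>Z\<close> costs at most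
  \<open>\<beta>/2\<close> per unit, while one transport instead of two saves \<open>\<beta>\<close> per unit. Only half of the
  arrivals and half of the departures are rerouted, so that a transport from \<open>Z\<close> to \<open>Z\<close>,
  which is counted among both, is not removed twice.\<close>

lemma shortcut:
  assumes \<gamma>: "\<gamma> \<in> measures_on (\<Omega> \<times> \<Omega>)" "nonneg_smeas \<gamma>"
    and Z: "Z \<in> sets borel" "Z \<subseteq> \<Omega>" "\<And>z z'. z \<in> Z \<Longrightarrow> z' \<in> Z \<Longrightarrow> dist z z' powr p \<le> \<beta> / 2"
    and pos: "0 < smeas (push snd \<gamma>) Z"
    and le: "\<And>A. A \<in> sets borel \<Longrightarrow> A \<subseteq> Z \<Longrightarrow> smeas (push snd \<gamma>) A \<le> smeas (push fst \<gamma>) A"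
  obtains \<gamma>' where "\<gamma>' \<in> measures_on (\<Omega> \<times> \<Omega>)" "nonneg_smeas \<gamma>'"
    "push fst \<gamma>' - push snd \<gamma>' = push fst \<gamma> - push snd \<gamma>" "sint \<gamma>' ground_cost < sint \<gamma> ground_cost"
proof -
  note bfst = borel_measurable_fst_snd(1) and bsnd = borel_measurable_fst_snd(2)
  define a where "a = push fst \<gamma>"
  define b where "b = push snd \<gamma>"
  have nn: "nonneg_smeas a" "nonneg_smeas b"
    unfolding a_def b_def by (intro nonneg_push bfst bsnd \<gamma>)+
  have iZ: "bounded_borel (indicator Z)" "\<And>x. 0 \<le> (indicator Z x :: real)" using Z(1) by auto
  define c where "c = dens (indicator Z) b"
  have c_nn: "nonneg_smeas c" unfolding c_def by (rule nonneg_dens[OF iZ])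
  have smeas_c: "smeas c A = smeas b (A \<inter> Z)" if "A \<in> sets borel" for A
  proof -
    have "(\<lambda>x. indicator Z x * indicator A x :: real) = indicator (A \<inter> Z)"
      by (auto simp: indicator_def)
    then show ?thesis
      unfolding c_def smeas_dens[OF iZ nn(2) that] using that Z(1) by (simp add: sint_indicator)
  qed
  define c0 where "c0 = smeas c UNIV"
  have c0: "0 < c0" using pos by (simp add: c0_def smeas_c b_def)
  have "smeas c A \<le> smeas a A" if "A \<in> sets borel" for A
  proof -
    have "smeas b (A \<inter> Z) \<le> smeas a (A \<inter> Z)" unfolding a_def b_def using that Z(1) by (intro le) auto
    also have "\<dots> \<le> smeas a A" using that Z(1) by (intro nonneg_smeas_mono nn) auto
    finally show ?thesis using that by (simp add: smeas_c)
  qed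
  then obtain f0 where f0: "bounded_borel f0" "\<And>x. 0 \<le> f0 x" "\<And>x. f0 x \<le> 1" "dens f0 a = c"
    using dominated_density[OF nn(1) c_nn] by blast
  define f where "f x = indicator Z x * f0 x" for x
  have f: "bounded_borel f" "\<And>x. 0 \<le> f x" "\<And>x. f x \<le> 1"
    using bounded_borel_mult[OF iZ(1) f0(1)] f0(2,3) by (auto simp: f_def[abs_def] indicator_def)
  have sint_c: "sint c \<phi> = sint b (\<lambda>x. indicator Z x * \<phi> x)" if "bounded_borel \<phi>" for \<phi>
    unfolding c_def by (rule sint_dens[OF iZ nn(2) that])
  have sint_c': "sint c \<phi> = sint a (\<lambda>x. f x * \<phi> x)" if \<phi>: "bounded_borel \<phi>" for \<phi>
  proof -
    have "sint c \<phi> = sint c (\<lambda>x. indicator Z x * \<phi> x)"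
    proof (rule sint_cong[OF _ Z(1) \<phi> bounded_borel_mult[OF iZ(1) \<phi>]])
      show "c \<in> measures_on Z" by (auto simp: measures_on_def smeas_c)
    qed simp
    also have "\<dots> = sint a (\<lambda>x. f x * \<phi> x)"
      unfolding f0(4)[symmetric] sint_dens[OF f0(1,2) nn(1) bounded_borel_mult[OF iZ(1) \<phi>]]
      by (simp add: f_def mult.commute mult.left_commute)
    finally show ?thesis .
  qed
  \<comment> \<open>\<open>\<gamma>1\<close> arrives in \<open>Z\<close>, \<open>\<gamma>2\<close> leaves from there, and both have the marginal \<open>c\<close> on \<open>Z\<close>.\<close>
  define w1 where "w1 w = (indicator Z (snd w) :: real)" for w :: "'a \<times> 'a"
  define w2 where "w2 w = f (fst w)" for w :: "'a \<times> 'a"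
  have w1: "bounded_borel w1" "\<And>w. 0 \<le> w1 w" "\<And>w. w1 w \<le> 1"
    unfolding w1_def[abs_def] using bounded_borel_compose[OF iZ(1) bsnd] by (auto simp: indicator_def)
  have w2: "bounded_borel w2" "\<And>w. 0 \<le> w2 w" "\<And>w. w2 w \<le> 1"
    unfolding w2_def[abs_def] using bounded_borel_compose[OF f(1) bfst] f by auto
  define \<gamma>1 where "\<gamma>1 = dens w1 \<gamma>"
  define \<gamma>2 where "\<gamma>2 = dens w2 \<gamma>"
  have nn12: "nonneg_smeas \<gamma>1" "nonneg_smeas \<gamma>2"
    unfolding \<gamma>1_def \<gamma>2_def by (intro nonneg_dens w1 w2)+
  have ZO: "\<Omega> \<times> Z \<in> sets borel" "Z \<times> \<Omega> \<in> sets borel"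
    using Z(1) \<Omega>_borel by (simp_all add: borel_prod[symmetric])
  have "\<gamma>1 \<in> measures_on (\<Omega> \<times> Z)"
    unfolding \<gamma>1_def
    by (rule measures_on_dens[OF w1(1,2) \<gamma>(2,1) \<Omega>2_borel ZO(1)]) (auto simp: w1_def indicator_def split: if_splits)
  moreover have "\<gamma>2 \<in> measures_on (Z \<times> \<Omega>)"
    unfolding \<gamma>2_def
    by (rule measures_on_dens[OF w2(1,2) \<gamma>(2,1) \<Omega>2_borel ZO(2)]) (auto simp: w2_def f_def indicator_def split: if_splits)
  ultimately have on12: "\<gamma>1 \<in> measures_on (\<Omega> \<times> Z)" "\<gamma>2 \<in> measures_on (Z \<times> \<Omega>)" by auto
  have s1: "sint \<gamma>1 (\<lambda>w. \<phi> (snd w)) = sint c \<phi>" and s2: "sint \<gamma>2 (\<lambda>w. \<phi> (fst w)) = sint c \<phi>"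
    if \<phi>: "bounded_borel \<phi>" for \<phi>
  proof -
    have "sint \<gamma>1 (\<lambda>w. \<phi> (snd w)) = sint \<gamma> (\<lambda>w. indicator Z (snd w) * \<phi> (snd w))"
      unfolding \<gamma>1_def by (subst sint_dens[OF w1(1,2) \<gamma>(2)]) (auto simp: w1_def intro: bounded_borel_compose \<phi> bsnd)
    also have "\<dots> = sint c \<phi>"
      unfolding sint_c[OF \<phi>] b_def using bounded_borel_mult[OF iZ(1) \<phi>] by (simp add: sint_push bsnd)
    finally show "sint \<gamma>1 (\<lambda>w. \<phi> (snd w)) = sint c \<phi>" .
    have "sint \<gamma>2 (\<lambda>w. \<phi> (fst w)) = sint \<gamma> (\<lambda>w. f (fst w) * \<phi> (fst w))"
      unfolding \<gamma>2_def by (subst sint_dens[OF w2(1,2) \<gamma>(2)]) (auto simp: w2_def intro: bounded_borel_compose \<phi> bfst)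
    also have "\<dots> = sint c \<phi>"
      unfolding sint_c'[OF \<phi>] a_def using bounded_borel_mult[OF f(1) \<phi>] by (simp add: sint_push bfst)
    finally show "sint \<gamma>2 (\<lambda>w. \<phi> (fst w)) = sint c \<phi>" .
  qed
  have mass: "smeas \<gamma>1 UNIV = c0" "smeas \<gamma>2 UNIV = c0"
    using s1[of "\<lambda>_. 1"] s2[of "\<lambda>_. 1"] by (simp_all add: sint_const c0_def)
  define \<pi> where "\<pi> = prod_smeas \<gamma>1 \<gamma>2"
  have \<pi>: "nonneg_smeas \<pi>" "\<pi> \<in> measures_on ((\<Omega> \<times> Z) \<times> (Z \<times> \<Omega>))"
    unfolding \<pi>_def by (intro nonneg_prod_smeas prod_smeas_measures_on nn12 on12 ZO)+
  have push_\<pi>: "sint \<pi> (\<lambda>t. \<phi> (fst t)) = c0 * sint \<gamma>1 \<phi>" "sint \<pi> (\<lambda>t. \<phi> (snd t)) = c0 * sint \<gamma>2 \<phi>"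
    if "bounded_borel \<phi>" for \<phi>
    using push_prod_smeas[OF nn12] sint_push[OF bfst that, of \<pi>] sint_push[OF bsnd that, of \<pi>]
    by (simp_all add: \<pi>_def mass sint_scaleR that)
  define j where "j t = (fst (fst t), snd (snd t))" for t :: "('a \<times> 'a) \<times> ('a \<times> 'a)"
  have j: "j \<in> borel_measurable borel"
    unfolding j_def[abs_def] by (intro borel_measurable_continuous_onI continuous_intros)
  define w where "w x = 1 - w1 x / 2 - w2 x / 2" for x
  have w: "bounded_borel w" "0 \<le> w x" for x
  proof -
    have "bounded_borel (\<lambda>x. 1 - (1/2) * w1 x - (1/2) * w2 x)"
      by (intro bounded_borel_diff bounded_borel_cmult w1 w2) auto
    then show "bounded_borel w" by (simp add: w_def[abs_def])
    show "0 \<le> w x" using w1(3)[of x] w2(3)[of x] by (simp add: w_def)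
  qed
  define \<gamma>' where "\<gamma>' = dens w \<gamma> + (1 / (2 * c0)) *\<^sub>R push j \<pi>"
  have sint_\<gamma>': "sint \<gamma>' \<phi> = sint \<gamma> \<phi> - sint \<gamma>1 \<phi> / 2 - sint \<gamma>2 \<phi> / 2 + sint \<pi> (\<lambda>t. \<phi> (j t)) / (2 * c0)"
    if \<phi>: "bounded_borel \<phi>" for \<phi>
  proof -
    have "sint (dens w \<gamma>) \<phi> = sint \<gamma> (\<lambda>x. \<phi> x - (1/2) * (w1 x * \<phi> x) - (1/2) * (w2 x * \<phi> x))"
      unfolding sint_dens[OF w \<gamma>(2) \<phi>] by (simp add: w_def algebra_simps)
    also have "\<dots> = sint \<gamma> \<phi> - sint \<gamma>1 \<phi> / 2 - sint \<gamma>2 \<phi> / 2"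
      unfolding \<gamma>1_def \<gamma>2_def sint_dens[OF w1(1,2) \<gamma>(2) \<phi>] sint_dens[OF w2(1,2) \<gamma>(2) \<phi>]
      using bounded_borel_mult[OF w1(1) \<phi>] bounded_borel_mult[OF w2(1) \<phi>] \<phi>
      by (simp only: sint_diff_fun sint_cmult_fun bounded_borel_diff bounded_borel_cmult)
    finally show ?thesis
      by (simp add: \<gamma>'_def sint_add sint_scaleR \<phi> sint_push[OF j])
  qed
  show thesis
  proof (rule that[of \<gamma>'])
    have "push j \<pi> \<in> measures_on (\<Omega> \<times> \<Omega>)"
      by (rule measures_on_push[OF j \<pi>(2)]) (auto simp: j_def)
    moreover have "dens w \<gamma> \<in> measures_on (\<Omega> \<times> \<Omega>)"
      by (rule measures_on_dens[OF w \<gamma>(2,1) \<Omega>2_borel \<Omega>2_borel]) auto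
    ultimately show "\<gamma>' \<in> measures_on (\<Omega> \<times> \<Omega>)"
      unfolding \<gamma>'_def by (intro measures_on_add measures_on_scaleR)
    show "nonneg_smeas \<gamma>'"
      unfolding \<gamma>'_def using c0
      by (intro nonneg_smeas_add nonneg_smeas_scaleR nonneg_dens w nonneg_push j \<pi>) auto
    show "push fst \<gamma>' - push snd \<gamma>' = push fst \<gamma> - push snd \<gamma>"
    proof (rule signed_measure_eq_if_continuous)
      fix \<phi> :: "'a \<Rightarrow> real" assume "continuous_on UNIV \<phi>" "bounded (range \<phi>)"
      then have \<phi>: "bounded_borel \<phi>" by (rule bounded_borel_continuous)
      note \<phi>1 = bounded_borel_compose[OF \<phi> bfst] and \<phi>2 = bounded_borel_compose[OF \<phi> bsnd]
      have "sint \<gamma>' (\<lambda>w. \<phi> (fst w)) = sint \<gamma> (\<lambda>w. \<phi> (fst w)) - sint c \<phi> / 2"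
        unfolding sint_\<gamma>'[OF \<phi>1] s2[OF \<phi>] using push_\<pi>(1)[OF \<phi>1] c0 by (simp add: j_def)
      moreover have "sint \<gamma>' (\<lambda>w. \<phi> (snd w)) = sint \<gamma> (\<lambda>w. \<phi> (snd w)) - sint c \<phi> / 2"
        unfolding sint_\<gamma>'[OF \<phi>2] s1[OF \<phi>] using push_\<pi>(2)[OF \<phi>2] c0 by (simp add: j_def)
      ultimately show "sint (push fst \<gamma>' - push snd \<gamma>') \<phi> = sint (push fst \<gamma> - push snd \<gamma>) \<phi>"
        by (simp add: sint_diff sint_push \<phi> bfst bsnd)
    qed
    have joined: "ground_cost (x, y) \<le> ground_cost (x, z) + ground_cost (z', y) - \<beta> / 2"
      if "x \<in> \<Omega>" "y \<in> \<Omega>" "z \<in> Z" "z' \<in> Z" for x y z z'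
    proof -
      have "dist x y \<le> (dist x z + dist z z') + dist z' y"
        using dist_triangle[of x y z] dist_triangle[of z y z'] by simp
      then have "dist x y powr p \<le> ((dist x z + dist z z') + dist z' y) powr p"
        using p by (intro powr_mono2) auto
      also have "\<dots> \<le> (dist x z powr p + dist z z' powr p) + dist z' y powr p"
        using powr_add_le[OF p, of "dist x z + dist z z'" "dist z' y"] powr_add_le[OF p, of "dist x z" "dist z z'"]
        by simp
      finally have "dist x y powr p \<le> dist x z powr p + \<beta> / 2 + dist z' y powr p"
        using Z(3)[OF that(3,4)] by simp
      then show ?thesis using that Z(2) by (simp add: ground_cost_eq subset_iff)
    qed
    have sets: "(\<Omega> \<times> Z) \<times> (Z \<times> \<Omega>) \<in> sets borel"
      using ZO by (simp add: borel_prod[symmetric])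
    note bb = bounded_borel_ground_cost
    note bb1 = bounded_borel_compose[OF bb bfst] and bb2 = bounded_borel_compose[OF bb bsnd]
    have "sint \<pi> (\<lambda>t. ground_cost (j t)) \<le> sint \<pi> (\<lambda>t. ground_cost (fst t) + ground_cost (snd t) - \<beta> / 2)"
    proof (rule sint_mono[OF \<pi> sets bounded_borel_compose[OF bb j]])
      show "bounded_borel (\<lambda>t. ground_cost (fst t) + ground_cost (snd t) - \<beta> / 2)"
        by (intro bounded_borel_diff bounded_borel_add bb1 bb2) auto
      fix t assume "t \<in> (\<Omega> \<times> Z) \<times> (Z \<times> \<Omega>)"
      then show "ground_cost (j t) \<le> ground_cost (fst t) + ground_cost (snd t) - \<beta> / 2"
        using joined by (auto simp: j_def)
    qed
    also have "\<dots> = c0 * sint \<gamma>1 ground_cost + c0 * sint \<gamma>2 ground_cost - \<beta> / 2 * smeas \<pi> UNIV"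
      by (simp add: sint_diff_fun sint_add_fun bounded_borel_add bb1 bb2 push_\<pi> bb sint_const)
    also have "smeas \<pi> UNIV = c0 * c0"
      using push_\<pi>(1)[of "\<lambda>_. 1"] by (simp add: sint_const mass)
    finally have "sint \<pi> (\<lambda>t. ground_cost (j t)) / (2 * c0)
        \<le> (c0 * sint \<gamma>1 ground_cost + c0 * sint \<gamma>2 ground_cost - \<beta> / 2 * (c0 * c0)) / (2 * c0)"
      using c0 by (intro divide_right_mono) auto
    also have "\<dots> = sint \<gamma>1 ground_cost / 2 + sint \<gamma>2 ground_cost / 2 - \<beta> * c0 / 4"
      using c0 by (simp add: field_simps)
    finally show "sint \<gamma>' ground_cost < sint \<gamma> ground_cost"
      unfolding sint_\<gamma>'[OF bb] using mult_pos_pos[OF \<beta> c0] by linarith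
  qed
qed

end

lemma weak_star_subseq:
  "weak_star_tendsto S s \<mu> \<Longrightarrow> strict_mono r \<Longrightarrow> weak_star_tendsto S (s \<circ> r) \<mu>"
  unfolding weak_star_tendsto_def
  using LIMSEQ_subseq_LIMSEQ[of _ _ r] by (fastforce simp: comp_def)

context KR_setting
begin

subsection \<open>Representations of a measure\<close>

text \<open>In the definition of the norm the transport plan couples the Jordan decomposition of a measure
  \<open>\<nu>\<close>, which depends nonlinearly on \<open>\<nu>\<close>. Here the plan \<open>\<gamma>\<close> is arbitrary, and \<open>a\<close> and \<open>b\<close> are the mass
  that is created and destroyed outside the transport. The relation is then a closed convex cone in
  all four arguments, and the cost is linear on it: the mass of \<open>\<gamma>\<close> is half the total variation of
  \<open>\<nu>\<close> when the marginals are mutually singular, which turns the penalty \<open>\<beta>/2\<close> into the constant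
  \<open>\<beta>\<close> of the ground cost.\<close>

definition represents ::
  "('a \<times> 'a) signed_measure \<Rightarrow> 'a signed_measure \<Rightarrow> 'a signed_measure \<Rightarrow> 'a signed_measure \<Rightarrow> bool" where
  "represents \<gamma> a b \<mu> \<longleftrightarrow>
     \<gamma> \<in> measures_on (\<Omega> \<times> \<Omega>) \<and> a \<in> measures_on \<Omega> \<and> b \<in> measures_on \<Omega> \<and>
     nonneg_smeas \<gamma> \<and> nonneg_smeas a \<and> nonneg_smeas b \<and>
     \<mu> = push fst \<gamma> - push snd \<gamma> + a - b"

definition rep_cost ::
  "('a \<times> 'a) signed_measure \<Rightarrow> 'a signed_measure \<Rightarrow> 'a signed_measure \<Rightarrow> real" where
  "rep_cost \<gamma> a b = sint \<gamma> ground_cost + \<alpha> * (smeas a UNIV + smeas b UNIV)"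

lemma push_fst_snd_measures_on:
  assumes "\<gamma> \<in> measures_on (\<Omega> \<times> \<Omega>)"
  shows "push fst \<gamma> \<in> measures_on \<Omega>" "push snd \<gamma> \<in> measures_on \<Omega>"
  by (rule measures_on_push[OF _ assms]; auto intro: borel_measurable_fst_snd)+

lemma represents_measures_on: "represents \<gamma> a b \<mu> \<Longrightarrow> \<mu> \<in> measures_on \<Omega>"
  unfolding represents_def using push_fst_snd_measures_on
  by (auto intro!: measures_on_add measures_on_diff)

lemma ground_cost_mass:
  assumes "\<gamma> \<in> measures_on (\<Omega> \<times> \<Omega>)" "nonneg_smeas \<gamma>"
  shows "\<beta> * smeas \<gamma> UNIV \<le> sint \<gamma> ground_cost"
  using sint_mono[OF assms(2,1) \<Omega>2_borel bounded_borel_const bounded_borel_ground_cost, of \<beta>]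
  by (auto simp: ground_cost_eq sint_const)

lemma rep_cost_bounds:
  assumes "represents \<gamma> a b \<mu>"
  shows "\<beta> * smeas \<gamma> UNIV \<le> rep_cost \<gamma> a b" "\<alpha> * smeas a UNIV \<le> rep_cost \<gamma> a b"
    "\<alpha> * smeas b UNIV \<le> rep_cost \<gamma> a b" "0 \<le> rep_cost \<gamma> a b"
proof -
  have *: "0 \<le> \<alpha> * smeas a UNIV" "0 \<le> \<alpha> * smeas b UNIV" "0 \<le> \<beta> * smeas \<gamma> UNIV"
    using assms \<alpha> \<beta> by (auto simp: represents_def nonneg_smeasD)
  show "\<beta> * smeas \<gamma> UNIV \<le> rep_cost \<gamma> a b" "\<alpha> * smeas a UNIV \<le> rep_cost \<gamma> a b"
    "\<alpha> * smeas b UNIV \<le> rep_cost \<gamma> a b" "0 \<le> rep_cost \<gamma> a b"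
    using * ground_cost_mass[of \<gamma>] assms by (auto simp: represents_def rep_cost_def distrib_left)
qed

lemma sint_represents:
  assumes "represents \<gamma> a b \<mu>" "bounded_borel f"
  shows "sint \<mu> f = sint \<gamma> (\<lambda>w. f (fst w)) - sint \<gamma> (\<lambda>w. f (snd w)) + sint a f - sint b f"
  using assms by (simp add: represents_def sint_add sint_diff sint_push borel_measurable_fst_snd)

lemma represents_add:
  assumes "represents \<gamma> a b \<mu>" "represents \<gamma>' a' b' \<mu>'"
  shows "represents (\<gamma> + \<gamma>') (a + a') (b + b') (\<mu> + \<mu>')"
proof -
  have e: "\<mu> = push fst \<gamma> - push snd \<gamma> + a - b" "\<mu>' = push fst \<gamma>' - push snd \<gamma>' + a' - b'"
    using assms by (auto simp: represents_def)
  have "\<mu> + \<mu>' = push fst (\<gamma> + \<gamma>') - push snd (\<gamma> + \<gamma>') + (a + a') - (b + b')"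
    by (simp add: e push_fst_snd)
  then show ?thesis
    using assms unfolding represents_def by (simp add: measures_on_add nonneg_smeas_add)
qed

lemma rep_cost_add: "rep_cost (\<gamma> + \<gamma>') (a + a') (b + b') = rep_cost \<gamma> a b + rep_cost \<gamma>' a' b'"
  by (simp add: rep_cost_def sint_add bounded_borel_ground_cost algebra_simps)

lemma represents_scaleR:
  assumes "represents \<gamma> a b \<mu>" "0 \<le> c"
  shows "represents (c *\<^sub>R \<gamma>) (c *\<^sub>R a) (c *\<^sub>R b) (c *\<^sub>R \<mu>)"
  using assms unfolding represents_def
  by (auto simp: push_fst_snd scaleR_add_right scaleR_diff_right intro: measures_on_scaleR nonneg_smeas_scaleR)

lemma rep_cost_scaleR: "rep_cost (c *\<^sub>R \<gamma>) (c *\<^sub>R a) (c *\<^sub>R b) = c * rep_cost \<gamma> a b"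
  by (simp add: rep_cost_def sint_scaleR bounded_borel_ground_cost algebra_simps)

text \<open>All masses in a representation are controlled by its cost, and both the represented measure
  and the cost are continuous in the representation.\<close>

lemma represents_compact:
  assumes rep: "\<And>k. represents (\<gamma> k) (a k) (b k) (s k)"
    and cost: "\<And>k. rep_cost (\<gamma> k) (a k) (b k) \<le> c k" and c: "c \<longlonglongrightarrow> c0"
  obtains r \<mu> \<gamma>' a' b' where "strict_mono r" "weak_star_tendsto \<Omega> (s \<circ> r) \<mu>"
    "represents \<gamma>' a' b' \<mu>" "rep_cost \<gamma>' a' b' \<le> c0"
proof -
  obtain R where R: "\<And>k. c k \<le> R"
    using convergent_imp_Bseq[OF convergentI[OF c]] unfolding Bseq_def by (auto simp: abs_le_iff)
  have bnd: "\<beta> * smeas (\<gamma> k) UNIV \<le> R" "\<alpha> * smeas (a k) UNIV \<le> R" "\<alpha> * smeas (b k) UNIV \<le> R" for k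
    using rep_cost_bounds[OF rep[of k]] cost[of k] R[of k] by linarith+
  then have bnd': "smeas (\<gamma> k) UNIV \<le> R / \<beta>" "smeas (a k) UNIV \<le> R / \<alpha>" "smeas (b k) UNIV \<le> R / \<alpha>" for k
    using \<alpha> \<beta> by (simp_all add: pos_le_divide_eq mult.commute)
  have props: "nonneg_smeas (\<gamma> k)" "nonneg_smeas (a k)" "nonneg_smeas (b k)"
    "\<gamma> k \<in> measures_on (\<Omega> \<times> \<Omega>)" "a k \<in> measures_on \<Omega>" "b k \<in> measures_on \<Omega>" for k
    using rep[of k] by (auto simp: represents_def)
  obtain r1 \<gamma>' where r1: "strict_mono r1" "nonneg_smeas \<gamma>'" "weak_star_tendsto (\<Omega> \<times> \<Omega>) (\<gamma> \<circ> r1) \<gamma>'"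
    by (rule weak_star_compact_nonneg[OF compact_\<Omega>2 props(1,4) bnd'(1)])
  obtain r2 a' where r2: "strict_mono r2" "nonneg_smeas a'" "weak_star_tendsto \<Omega> ((a \<circ> r1) \<circ> r2) a'"
    by (rule weak_star_compact_nonneg[OF compact_\<Omega>, of "a \<circ> r1" "R / \<alpha>"]) (use props bnd' in auto)
  obtain r3 b' where r3: "strict_mono r3" "nonneg_smeas b'" "weak_star_tendsto \<Omega> ((b \<circ> r1 \<circ> r2) \<circ> r3) b'"
    by (rule weak_star_compact_nonneg[OF compact_\<Omega>, of "b \<circ> r1 \<circ> r2" "R / \<alpha>"]) (use props bnd' in auto)
  define r where "r = r1 \<circ> r2 \<circ> r3"
  have r: "strict_mono r" unfolding r_def by (intro strict_mono_o r1 r2 r3)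
  have lim_\<gamma>: "weak_star_tendsto (\<Omega> \<times> \<Omega>) (\<gamma> \<circ> r) \<gamma>'"
    using weak_star_subseq[OF weak_star_subseq[OF r1(3) r2(1)] r3(1)] by (simp add: r_def o_assoc)
  have lim_a: "weak_star_tendsto \<Omega> (a \<circ> r) a'"
    using weak_star_subseq[OF r2(3) r3(1)] by (simp add: r_def o_assoc)
  have lim_b: "weak_star_tendsto \<Omega> (b \<circ> r) b'"
    using r3(3) by (simp add: r_def o_assoc)
  define \<mu> where "\<mu> = push fst \<gamma>' - push snd \<gamma>' + a' - b'"
  have rep': "represents \<gamma>' a' b' \<mu>"
    using r1(2) r2(2) r3(2) lim_\<gamma> lim_a lim_b
    by (simp add: represents_def \<mu>_def weak_star_tendsto_def)
  have on2: "smeas_integral (\<Omega> \<times> \<Omega>) \<kappa> (\<lambda>w. f (h w)) = sint \<kappa> (\<lambda>w. indicator \<Omega> (h w) * f (h w))"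
    if "h = fst \<or> h = snd" "continuous_on \<Omega> f" "\<kappa> \<in> measures_on (\<Omega> \<times> \<Omega>)" for h f \<kappa>
  proof -
    have cont: "continuous_on (\<Omega> \<times> \<Omega>) (\<lambda>w. f (h w))"
      using that by (auto intro!: continuous_on_compose2[OF that(2)] continuous_intros)
    have "h \<in> borel_measurable borel" using that(1) borel_measurable_fst_snd by auto
    then show ?thesis
      unfolding smeas_integral_eq_sint using that(1)
      by (intro sint_cong[OF that(3) \<Omega>2_borel] bounded_borel_restrict[OF compact_\<Omega>2 cont]
          bounded_borel_compose[OF bounded_borel_restrict[OF compact_\<Omega> that(2)]]) auto
  qed
  have conv: "(\<lambda>k. smeas_integral \<Omega> ((s \<circ> r) k) f) \<longlonglongrightarrow> smeas_integral \<Omega> \<mu> f"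
    if f: "continuous_on \<Omega> f" for f
  proof -
    have split: "smeas_integral \<Omega> \<mu> f = smeas_integral (\<Omega> \<times> \<Omega>) \<gamma> (\<lambda>w. f (fst w))
        - smeas_integral (\<Omega> \<times> \<Omega>) \<gamma> (\<lambda>w. f (snd w)) + smeas_integral \<Omega> a f - smeas_integral \<Omega> b f"
      if "represents \<gamma> a b \<mu>" for \<gamma> a b \<mu>
      using sint_represents[OF that bounded_borel_restrict[OF compact_\<Omega> f]] that f
      by (simp add: on2[of fst] on2[of snd] smeas_integral_eq_sint[of \<Omega>] represents_def)
    have "continuous_on (\<Omega> \<times> \<Omega>) (\<lambda>w. f (fst w))" "continuous_on (\<Omega> \<times> \<Omega>) (\<lambda>w. f (snd w))"
      by (auto intro!: continuous_on_compose2[OF f] continuous_intros)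
    then show ?thesis
      using lim_\<gamma> lim_a lim_b f unfolding split[OF rep'] comp_def split[OF rep] weak_star_tendsto_def
      by (intro tendsto_intros) auto
  qed
  have "rep_cost \<gamma>' a' b' \<le> c0"
  proof (rule LIMSEQ_le)
    have mass: "smeas_integral \<Omega> \<kappa> (\<lambda>_. 1) = smeas \<kappa> UNIV" if "\<kappa> \<in> measures_on \<Omega>" for \<kappa>
      using smeas_integral_eq_sint_on[OF that \<Omega>_borel bounded_borel_const] by (simp add: sint_const)
    have gc: "smeas_integral (\<Omega> \<times> \<Omega>) \<kappa> (\<lambda>w. dist (fst w) (snd w) powr p + \<beta>) = sint \<kappa> ground_cost" for \<kappa>
      by (simp add: smeas_integral_eq_sint ground_cost_def[abs_def])
    have "(\<lambda>k. sint (\<gamma> (r k)) ground_cost) \<longlonglongrightarrow> sint \<gamma>' ground_cost"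
      using lim_\<gamma> continuous_dist_powr unfolding weak_star_tendsto_def gc[symmetric] comp_def by blast
    moreover have "(\<lambda>k. smeas (x (r k)) UNIV) \<longlonglongrightarrow> smeas x' UNIV"
      if "weak_star_tendsto \<Omega> (x \<circ> r) x'" "\<And>k. x k \<in> measures_on \<Omega>" for x x'
    proof -
      have "x' \<in> measures_on \<Omega>"
        "(\<lambda>k. smeas_integral \<Omega> ((x \<circ> r) k) (\<lambda>_. 1)) \<longlonglongrightarrow> smeas_integral \<Omega> x' (\<lambda>_. 1)"
        using that(1) unfolding weak_star_tendsto_def by (blast intro: continuous_on_const)+
      then show ?thesis by (simp add: mass that(2))
    qed
    note this[OF lim_a props(5)] this[OF lim_b props(6)]
    ultimately show "(\<lambda>k. rep_cost (\<gamma> (r k)) (a (r k)) (b (r k))) \<longlonglongrightarrow> rep_cost \<gamma>' a' b'"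
      unfolding rep_cost_def by (intro tendsto_intros)
    show "(\<lambda>k. c (r k)) \<longlonglongrightarrow> c0" using LIMSEQ_subseq_LIMSEQ[OF c r] by (simp add: comp_def)
  qed (use cost in auto)
  moreover have "weak_star_tendsto \<Omega> (s \<circ> r) \<mu>"
    using conv represents_measures_on[OF rep'] by (simp add: weak_star_tendsto_def)
  ultimately show thesis using that[OF r _ rep'] by blast
qed

lemma represents_Jordan:
  assumes "\<mu> \<in> measures_on \<Omega>"
  shows "represents 0 (smeas_of (pos_part \<mu>)) (smeas_of (neg_part \<mu>)) \<mu>"
proof -
  have "push fst (0 :: ('a \<times> 'a) signed_measure) = 0" "push snd (0 :: ('a \<times> 'a) signed_measure) = 0"
    using push_fst_snd(3)[of 0 0] push_fst_snd(4)[of 0 0] by simp_all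
  then show ?thesis
    using measures_on_pos_neg[OF assms \<Omega>_borel] smeas_of_pos_neg[of \<mu>]
    by (simp add: represents_def nonneg_smeas_of)
qed

lemma optimal_representation:
  assumes "\<mu> \<in> measures_on \<Omega>"
  obtains \<gamma> a b where "represents \<gamma> a b \<mu>"
    "\<And>\<gamma>' a' b'. represents \<gamma>' a' b' \<mu> \<Longrightarrow> rep_cost \<gamma> a b \<le> rep_cost \<gamma>' a' b'"
proof -
  define X where "X = {rep_cost \<gamma> a b |\<gamma> a b. represents \<gamma> a b \<mu>}"
  have X: "X \<noteq> {}" "bdd_below X"
    using represents_Jordan[OF assms] rep_cost_bounds(4) by (auto simp: X_def intro!: bdd_belowI[of _ 0])
  have "\<exists>\<gamma> a b. represents \<gamma> a b \<mu> \<and> rep_cost \<gamma> a b \<le> Inf X + 1 / real (Suc k)" for k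
  proof -
    have "Inf X < Inf X + 1 / real (Suc k)" by simp
    then obtain x where "x \<in> X" "x < Inf X + 1 / real (Suc k)"
      using cInf_lessD[OF X(1)] by blast
    then show ?thesis unfolding X_def by fastforce
  qed
  then obtain \<gamma> a b where rep: "\<And>k. represents (\<gamma> k) (a k) (b k) \<mu>"
    "\<And>k. rep_cost (\<gamma> k) (a k) (b k) \<le> Inf X + 1 / real (Suc k)"
    by metis
  have "(\<lambda>k. Inf X + 1 / real (Suc k)) \<longlonglongrightarrow> Inf X + 0"
    using LIMSEQ_inverse_real_of_nat by (intro tendsto_intros) (simp add: inverse_eq_divide)
  then have lim: "(\<lambda>k. Inf X + 1 / real (Suc k)) \<longlonglongrightarrow> Inf X" by simp
  obtain r :: "nat \<Rightarrow> nat" and \<mu>' \<gamma>' a' b' where "strict_mono r" "weak_star_tendsto \<Omega> ((\<lambda>_. \<mu>) \<circ> r) \<mu>'"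
    and rep': "represents \<gamma>' a' b' \<mu>'" "rep_cost \<gamma>' a' b' \<le> Inf X"
    by (rule represents_compact[OF rep(1,2) lim])
  moreover have "weak_star_tendsto \<Omega> ((\<lambda>_. \<mu>) \<circ> r) \<mu>"
    using assms by (simp add: weak_star_tendsto_def)
  ultimately have "\<mu>' = \<mu>" using weak_star_limit_unique[OF compact_\<Omega>] by blast
  moreover have "Inf X \<le> rep_cost \<gamma> a b" if "represents \<gamma> a b \<mu>" for \<gamma> a b
    using that by (intro cInf_lower X) (auto simp: X_def)
  ultimately show thesis using that[of \<gamma>' a' b'] rep' by fastforce
qed

subsection \<open>The marginals of an optimal plan are mutually singular\<close>

text \<open>Finitely many cells of the required diameter cover \<open>\<Omega>\<close>, and one of them meets \<open>Y\<close> in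
  positive mass.\<close>

lemma small_cell:
  assumes "nonneg_smeas b" "b \<in> measures_on \<Omega>" "Y \<in> sets borel" "0 < smeas b Y"
  obtains Z where "Z \<in> sets borel" "Z \<subseteq> Y \<inter> \<Omega>" "0 < smeas b Z"
    "\<And>z z'. z \<in> Z \<Longrightarrow> z' \<in> Z \<Longrightarrow> dist z z' powr p \<le> \<beta> / 2"
proof -
  \<comment> \<open>The \<open>p\<close>-th power of the diameter of a ball of radius \<open>\<delta>\<close> is at most \<open>\<beta>/2\<close>.\<close>
  define \<delta> where "\<delta> = (\<beta> / 2) powr (1 / p) / 2"
  have "0 < \<delta>" using \<beta> by (simp add: \<delta>_def)
  then obtain D where D: "finite D" "\<Omega> \<subseteq> (\<Union>x\<in>D. ball x \<delta>)"
    using compact_\<Omega> unfolding compact_eq_totally_bounded by blast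
  define Z where "Z x = Y \<inter> \<Omega> \<inter> ball x \<delta>" for x
  have Z: "Z x \<in> sets borel" for x
    unfolding Z_def using assms(3) \<Omega>_borel by auto
  have "\<exists>x\<in>D. 0 < smeas b (Z x)"
  proof (rule ccontr)
    assume "\<not> ?thesis"
    then have zero: "smeas b (Z x) = 0" if "x \<in> D" for x
      using that nonneg_smeasD[OF assms(1), of "Z x"] by force
    have "(Y - \<Omega>) \<inter> \<Omega> = {}" by auto
    then have "smeas b (Y - \<Omega>) = 0" using assms(2,3) \<Omega>_borel by (simp add: measures_on_def)
    then have "smeas b Y = smeas b (Y \<inter> \<Omega>)"
      using smeas_Un[of "Y \<inter> \<Omega>" "Y - \<Omega>" b] assms(3) \<Omega>_borel by (simp add: Int_Diff_Un Int_Diff_disjoint)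
    also have "Y \<inter> \<Omega> = (\<Union>x\<in>D. Z x)" using D(2) by (auto simp: Z_def)
    also have "smeas b (\<Union>x\<in>D. Z x) \<le> (\<Sum>x\<in>D. smeas b (Z x))"
      using measure_UNION_le[of D Z "pos_part b"] D(1) Z by (simp add: measure_pos_part_nonneg assms(1))
    also have "\<dots> = 0" using zero by simp
    finally show False using assms(4) by simp
  qed
  then obtain x where x: "0 < smeas b (Z x)" by blast
  have "dist z z' powr p \<le> \<beta> / 2" if "z \<in> Z x" "z' \<in> Z x" for z z'
  proof -
    have "dist z z' \<le> (\<beta> / 2) powr (1 / p)"
      using that dist_triangle3[of z z' x] by (auto simp: Z_def \<delta>_def)
    then have "dist z z' powr p \<le> ((\<beta> / 2) powr (1 / p)) powr p"
      using p by (intro powr_mono2) auto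
    then show ?thesis using p \<beta> by (simp add: powr_powr)
  qed
  then show thesis using that[OF Z _ x] by (auto simp: Z_def)
qed

lemma push_swap:
  assumes "\<gamma> \<in> measures_on (\<Omega> \<times> \<Omega>)" "nonneg_smeas \<gamma>"
  shows "push prod.swap \<gamma> \<in> measures_on (\<Omega> \<times> \<Omega>)" "nonneg_smeas (push prod.swap \<gamma>)"
    "push fst (push prod.swap \<gamma>) = push snd \<gamma>" "push snd (push prod.swap \<gamma>) = push fst \<gamma>"
    "sint (push prod.swap \<gamma>) ground_cost = sint \<gamma> ground_cost"
proof -
  have swap: "prod.swap \<in> borel_measurable (borel :: ('a \<times> 'a) measure)"
    unfolding prod.swap_def[abs_def] by (intro borel_measurable_continuous_onI continuous_intros)
  show "push prod.swap \<gamma> \<in> measures_on (\<Omega> \<times> \<Omega>)"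
    by (rule measures_on_push[OF swap assms(1)]) auto
  show "nonneg_smeas (push prod.swap \<gamma>)" by (rule nonneg_push[OF swap assms(2)])
  show "push fst (push prod.swap \<gamma>) = push snd \<gamma>" "push snd (push prod.swap \<gamma>) = push fst \<gamma>"
    by (simp_all add: push_push swap borel_measurable_fst_snd)
  have "(\<lambda>w. ground_cost (prod.swap w)) = ground_cost"
    by (auto simp: ground_cost_def indicator_def dist_commute fun_eq_iff)
  then show "sint (push prod.swap \<gamma>) ground_cost = sint \<gamma> ground_cost"
    by (simp add: sint_push[OF swap bounded_borel_ground_cost])
qed

text \<open>On one side of a Hahn decomposition of the two marginals the second one is dominated by the
  first, on the other side the first one by the second; if the dominated marginal had mass there,
  a shortcut would lower the cost.\<close>

lemma optimal_representation_singular: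
  assumes rep: "represents \<gamma> a b \<mu>"
    and opt: "\<And>\<gamma>' a' b'. represents \<gamma>' a' b' \<mu> \<Longrightarrow> rep_cost \<gamma> a b \<le> rep_cost \<gamma>' a' b'"
  obtains Y where "Y \<in> sets borel" "smeas (push fst \<gamma>) (- Y) = 0" "smeas (push snd \<gamma>) Y = 0"
proof -
  have \<gamma>: "\<gamma> \<in> measures_on (\<Omega> \<times> \<Omega>)" "nonneg_smeas \<gamma>" using rep by (auto simp: represents_def)
  have no_gain: "\<not> sint \<gamma>' ground_cost < sint \<gamma> ground_cost"
    if "\<gamma>' \<in> measures_on (\<Omega> \<times> \<Omega>)" "nonneg_smeas \<gamma>'"
      "push fst \<gamma>' - push snd \<gamma>' = push fst \<gamma> - push snd \<gamma>" for \<gamma>'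
  proof -
    have "represents \<gamma>' a b \<mu>" using rep that by (simp add: represents_def)
    then show ?thesis using opt by (fastforce simp: rep_cost_def)
  qed
  have null: "smeas (push snd \<gamma>') Y = 0"
    if \<gamma>': "\<gamma>' \<in> measures_on (\<Omega> \<times> \<Omega>)" "nonneg_smeas \<gamma>'" and Y: "Y \<in> sets borel"
      and le: "\<And>A. A \<in> sets borel \<Longrightarrow> A \<subseteq> Y \<Longrightarrow> smeas (push snd \<gamma>') A \<le> smeas (push fst \<gamma>') A"
      and no: "\<And>\<gamma>''. \<gamma>'' \<in> measures_on (\<Omega> \<times> \<Omega>) \<Longrightarrow> nonneg_smeas \<gamma>'' \<Longrightarrow>
        push fst \<gamma>'' - push snd \<gamma>'' = push fst \<gamma>' - push snd \<gamma>' \<Longrightarrow>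
        \<not> sint \<gamma>'' ground_cost < sint \<gamma>' ground_cost" for \<gamma>' Y
  proof (rule ccontr)
    have nn: "nonneg_smeas (push snd \<gamma>')" by (rule nonneg_push[OF borel_measurable_fst_snd(2) \<gamma>'(2)])
    assume "smeas (push snd \<gamma>') Y \<noteq> 0"
    then have "0 < smeas (push snd \<gamma>') Y" using nonneg_smeasD[OF nn, of Y] by simp
    then obtain Z where Z: "Z \<in> sets borel" "Z \<subseteq> Y \<inter> \<Omega>" "0 < smeas (push snd \<gamma>') Z"
      "\<And>z z'. z \<in> Z \<Longrightarrow> z' \<in> Z \<Longrightarrow> dist z z' powr p \<le> \<beta> / 2"
      using small_cell[OF nn push_fst_snd_measures_on(2)[OF \<gamma>'(1)] Y] by blast
    have Z': "Z \<subseteq> \<Omega>" "Z \<subseteq> Y" using Z(2) by auto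
    show False
      by (rule shortcut[OF \<gamma>' Z(1) Z'(1) Z(4,3)]) (use le Z'(2) no in blast)+
  qed
  obtain Y where Y: "Y \<in> sets (pos_part (push fst \<gamma>))"
    and Y1: "\<forall>X\<in>sets (pos_part (push fst \<gamma>)). X \<subseteq> Y \<longrightarrow>
      emeasure (pos_part (push snd \<gamma>)) X \<le> emeasure (pos_part (push fst \<gamma>)) X"
    and Y2: "\<forall>X\<in>sets (pos_part (push fst \<gamma>)). X \<inter> Y = {} \<longrightarrow>
      emeasure (pos_part (push fst \<gamma>)) X \<le> emeasure (pos_part (push snd \<gamma>)) X"
    using finite_unsigned_Hahn_decomposition[of "pos_part (push fst \<gamma>)" "pos_part (push snd \<gamma>)"] by auto
  have nn: "nonneg_smeas (push fst \<gamma>)" "nonneg_smeas (push snd \<gamma>)"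
    by (intro nonneg_push borel_measurable_fst_snd \<gamma>)+
  have le1: "smeas (push snd \<gamma>) X \<le> smeas (push fst \<gamma>) X" if "X \<in> sets borel" "X \<subseteq> Y" for X
    using Y1 that by (simp add: emeasure_pos_part_nonneg nn nonneg_smeasD ennreal_le_iff)
  have le2: "smeas (push fst \<gamma>) X \<le> smeas (push snd \<gamma>) X" if "X \<in> sets borel" "X \<subseteq> - Y" for X
  proof -
    have "X \<inter> Y = {}" using that by auto
    then show ?thesis
      using Y2 that by (simp add: emeasure_pos_part_nonneg nn nonneg_smeasD ennreal_le_iff)
  qed
  note sw = push_swap[OF \<gamma>]
  show thesis
  proof (rule that)
    show "Y \<in> sets borel" using Y by simp
    show "smeas (push snd \<gamma>) Y = 0"
      by (rule null[OF \<gamma>]) (use Y le1 no_gain in auto)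
    have "smeas (push snd (push prod.swap \<gamma>)) (- Y) = 0"
    proof (rule null[OF sw(1,2)])
      fix \<gamma>'' assume "\<gamma>'' \<in> measures_on (\<Omega> \<times> \<Omega>)" "nonneg_smeas \<gamma>''"
        and d: "push fst \<gamma>'' - push snd \<gamma>'' = push fst (push prod.swap \<gamma>) - push snd (push prod.swap \<gamma>)"
      note sw' = push_swap[OF this(1,2)]
      have "push snd \<gamma>'' - push fst \<gamma>'' = push fst \<gamma> - push snd \<gamma>"
        using d unfolding sw by (metis minus_diff_eq)
      then show "\<not> sint \<gamma>'' ground_cost < sint (push prod.swap \<gamma>) ground_cost"
        using no_gain[OF sw'(1,2)] sw sw' by simp
    qed (use Y le2 sw in auto)
    then show "smeas (push fst \<gamma>) (- Y) = 0" by (simp add: sw)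
  qed
qed

subsection \<open>The norm is the least cost of a representation\<close>

lemma transport_cost:
  assumes "\<gamma> \<in> measures_on (\<Omega> \<times> \<Omega>)" "nonneg_smeas \<gamma>"
  shows "(\<integral>\<^sup>+ (x, y). ennreal (dist x y powr p) \<partial>pos_part \<gamma>)
    = ennreal (sint \<gamma> ground_cost - \<beta> * smeas \<gamma> UNIV)"
proof -
  define d where "d w = ground_cost w - \<beta> * indicator (\<Omega> \<times> \<Omega>) w" for w
  have d_eq: "d w = indicator (\<Omega> \<times> \<Omega>) w * dist (fst w) (snd w) powr p" for w
    by (simp add: d_def ground_cost_def indicator_def)
  have bb: "bounded_borel d"
    unfolding d_def[abs_def]
    by (intro bounded_borel_diff bounded_borel_ground_cost bounded_borel_cmult bounded_borel_indicator \<Omega>2_borel)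
  have "(\<integral>\<^sup>+ (x, y). ennreal (dist x y powr p) \<partial>pos_part \<gamma>) = (\<integral>\<^sup>+ w. ennreal (d w) \<partial>pos_part \<gamma>)"
  proof (rule nn_integral_cong_AE)
    show "AE w in pos_part \<gamma>. (case w of (x, y) \<Rightarrow> ennreal (dist x y powr p)) = ennreal (d w)"
      using AE_pos_part[OF assms(2,1) \<Omega>2_borel] by eventually_elim (auto simp: d_eq)
  qed
  also have "\<dots> = ennreal (integral\<^sup>L (pos_part \<gamma>) d)"
    by (intro nn_integral_eq_integral integrable_pos_neg bb) (simp add: d_eq)
  also have "integral\<^sup>L (pos_part \<gamma>) d = sint \<gamma> d" by (simp add: sint_nonneg assms(2))
  also have "\<dots> = sint \<gamma> ground_cost - \<beta> * smeas \<gamma> (\<Omega> \<times> \<Omega>)"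
    unfolding d_def[abs_def]
    by (subst sint_diff_fun)
       (simp_all add: sint_cmult_fun sint_indicator \<Omega>2_borel bounded_borel_ground_cost bounded_borel_cmult)
  finally show ?thesis by (simp add: smeas_measures_on[OF assms(1) \<Omega>2_borel \<Omega>2_borel])
qed

lemma variation_measures_on:
  assumes "\<mu> \<in> measures_on \<Omega>"
  shows "variation \<mu> \<Omega> = measure (pos_part \<mu>) UNIV + measure (neg_part \<mu>) UNIV"
  using smeas_measures_on[OF measures_on_pos_neg(1)[OF assms \<Omega>_borel] \<Omega>_borel \<Omega>_borel]
    smeas_measures_on[OF measures_on_pos_neg(2)[OF assms \<Omega>_borel] \<Omega>_borel \<Omega>_borel]
  by (simp add: variation_def smeas_smeas_of)

text \<open>A splitting \<open>\<mu> = \<nu> + (\<mu> - \<nu>)\<close> together with a coupling of the Jordan decomposition of \<open>\<nu>\<close> is a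
  representation, in which \<open>a\<close> and \<open>b\<close> are the Jordan decomposition of \<open>\<mu> - \<nu>\<close>. Conversely, the
  marginals of an optimal representation are a Jordan decomposition, and passing from its \<open>a\<close> and
  \<open>b\<close> to the Jordan decomposition of \<open>a - b\<close> does not increase the cost.\<close>

lemma KR_norm_attained:
  assumes \<mu>: "\<mu> \<in> measures_on \<Omega>"
  obtains \<gamma> a b where "represents \<gamma> a b \<mu>" "KR_norm \<Omega> p \<alpha> \<beta> \<mu> = rep_cost \<gamma> a b"
    "\<And>\<gamma>' a' b'. represents \<gamma>' a' b' \<mu> \<Longrightarrow> rep_cost \<gamma> a b \<le> rep_cost \<gamma>' a' b'"
proof -
  obtain \<gamma> a b where rep: "represents \<gamma> a b \<mu>"
    and opt: "\<And>\<gamma>' a' b'. represents \<gamma>' a' b' \<mu> \<Longrightarrow> rep_cost \<gamma> a b \<le> rep_cost \<gamma>' a' b'"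
    using optimal_representation[OF \<mu>] by metis
  have \<gamma>: "\<gamma> \<in> measures_on (\<Omega> \<times> \<Omega>)" "nonneg_smeas \<gamma>"
    and ab: "a \<in> measures_on \<Omega>" "b \<in> measures_on \<Omega>" "nonneg_smeas a" "nonneg_smeas b"
    and \<mu>_eq: "\<mu> = push fst \<gamma> - push snd \<gamma> + a - b"
    using rep by (auto simp: represents_def)
  define cost where "cost \<nu> = wasserstein \<Omega> p (pos_part \<nu>) (neg_part \<nu>)
        + ennreal (\<beta> / 2 * variation \<nu> \<Omega>) + ennreal (\<alpha> * variation (\<mu> - \<nu>) \<Omega>)" for \<nu>
  have upper: "(INF \<nu> \<in> {\<nu> \<in> measures_on \<Omega>. smeas \<nu> \<Omega> = 0}. cost \<nu>) \<le> ennreal (rep_cost \<gamma> a b)"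
  proof -
    obtain Y where Y: "Y \<in> sets borel" "smeas (push fst \<gamma>) (- Y) = 0" "smeas (push snd \<gamma>) Y = 0"
      using optimal_representation_singular[OF rep opt] by blast
    define \<nu> where "\<nu> = push fst \<gamma> - push snd \<gamma>"
    have nn: "nonneg_smeas (push fst \<gamma>)" "nonneg_smeas (push snd \<gamma>)"
      by (intro nonneg_push borel_measurable_fst_snd \<gamma>)+
    have \<nu>: "\<nu> \<in> measures_on \<Omega>"
      unfolding \<nu>_def by (intro measures_on_diff push_fst_snd_measures_on \<gamma>)
    have mass: "smeas (push fst \<gamma>) UNIV = smeas \<gamma> UNIV" "smeas (push snd \<gamma>) UNIV = smeas \<gamma> UNIV"
      by (simp_all add: smeas_push borel_measurable_fst_snd)
    have \<nu>0: "smeas \<nu> \<Omega> = 0"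
      using smeas_measures_on[OF \<nu> \<Omega>_borel \<Omega>_borel] by (simp add: mass \<nu>_def)
    have pos: "pos_part \<nu> = pos_part (push fst \<gamma>)"
      unfolding \<nu>_def by (rule pos_part_diff_singular[OF nn Y])
    have neg: "neg_part \<nu> = pos_part (push snd \<gamma>)"
      using pos_part_diff_singular[OF nn(2,1), of "- Y"] Y by (simp add: neg_part_def \<nu>_def)
    have "emeasure (pos_part \<gamma>) (- (\<Omega> \<times> \<Omega>)) = 0"
      using \<gamma> \<Omega>2_borel by (simp add: emeasure_pos_part_nonneg measures_on_def)
    then have "pos_part \<gamma> \<in> couplings \<Omega> (pos_part \<nu>) (neg_part \<nu>)"
      unfolding couplings_def pos neg
      using pos_part_push[OF borel_measurable_fst_snd(1) \<gamma>(2)] pos_part_push[OF borel_measurable_fst_snd(2) \<gamma>(2)]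
      by simp
    then have W: "wasserstein \<Omega> p (pos_part \<nu>) (neg_part \<nu>) \<le> ennreal (sint \<gamma> ground_cost - \<beta> * smeas \<gamma> UNIV)"
      unfolding wasserstein_def transport_cost[OF \<gamma>, symmetric] by (rule INF_lower)
    have var1: "variation \<nu> \<Omega> = 2 * smeas \<gamma> UNIV"
      unfolding variation_measures_on[OF \<nu>] by (simp add: pos neg measure_pos_part_nonneg nn mass)
    have "\<mu> - \<nu> = a - b" by (simp add: \<mu>_eq \<nu>_def)
    then have var2: "variation (\<mu> - \<nu>) \<Omega> \<le> smeas a UNIV + smeas b UNIV"
      using measure_pos_part_diff_le[OF ab(3,4), of UNIV] measure_pos_part_diff_le[OF ab(4,3), of UNIV]
      by (simp add: variation_measures_on[OF measures_on_diff[OF ab(1,2)]] neg_part_def)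
    have "cost \<nu> \<le> ennreal (sint \<gamma> ground_cost - \<beta> * smeas \<gamma> UNIV) + ennreal (\<beta> * smeas \<gamma> UNIV)
        + ennreal (\<alpha> * (smeas a UNIV + smeas b UNIV))"
      unfolding cost_def using W var2 \<alpha> by (intro add_mono ennreal_leI) (auto simp: var1)
    also have "\<dots> = ennreal (rep_cost \<gamma> a b)"
    proof -
      have "0 \<le> \<beta> * smeas \<gamma> UNIV" "0 \<le> \<alpha> * (smeas a UNIV + smeas b UNIV)"
        using \<alpha> \<beta> \<gamma>(2) ab(3,4) by (simp_all add: nonneg_smeasD)
      then show ?thesis
        using ground_cost_mass[OF \<gamma>]
        by (simp add: rep_cost_def ennreal_plus[symmetric] del: ennreal_plus)
    qed
    finally show ?thesis using \<nu> \<nu>0 by (intro INF_lower2[of \<nu>]) auto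
  qed
  have lower: "ennreal (rep_cost \<gamma> a b) \<le> cost \<nu>" if \<nu>: "\<nu> \<in> measures_on \<Omega>" for \<nu>
  proof -
    define e where "e = \<beta> / 2 * variation \<nu> \<Omega> + \<alpha> * variation (\<mu> - \<nu>) \<Omega>"
    have nn: "0 \<le> \<beta> / 2 * variation \<nu> \<Omega>" "0 \<le> \<alpha> * variation (\<mu> - \<nu>) \<Omega>"
      using \<alpha> \<beta> by (auto simp: variation_def)
    have "ennreal (rep_cost \<gamma> a b - e) \<le> wasserstein \<Omega> p (pos_part \<nu>) (neg_part \<nu>)"
      unfolding wasserstein_def
    proof (rule INF_greatest)
      fix G assume "G \<in> couplings \<Omega> (pos_part \<nu>) (neg_part \<nu>)"
      then have G: "sets G = sets borel" "emeasure G (- (\<Omega> \<times> \<Omega>)) = 0"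
        "distr G borel fst = pos_part \<nu>" "distr G borel snd = neg_part \<nu>"
        by (auto simp: couplings_def)
      note [measurable_cong] = G(1)
      have space: "space G = UNIV" using sets_eq_imp_space_eq[OF G(1)] by simp
      have fst_G: "fst \<in> measurable G (borel :: 'a measure)" "snd \<in> measurable G (borel :: 'a measure)"
        using borel_measurable_fst_snd measurable_cong_sets[OF G(1) refl] by blast+
      have "emeasure G UNIV = emeasure (pos_part \<nu>) UNIV"
        unfolding G(3)[symmetric] by (subst emeasure_distr[OF fst_G(1)]) (auto simp: space)
      then have fin: "finite_measure G"
        by (intro finite_measureI) (simp add: space finite_measure.emeasure_eq_measure)
      define \<gamma>' where "\<gamma>' = smeas_of G"
      have sm: "smeas \<gamma>' = measure G" unfolding \<gamma>'_def by (rule smeas_smeas_of[OF G(1) fin])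
      have pp: "pos_part \<gamma>' = G" unfolding \<gamma>'_def by (rule pos_part_smeas_of[OF G(1) fin])
      have \<gamma>'_nn: "nonneg_smeas \<gamma>'" unfolding \<gamma>'_def by (rule nonneg_smeas_of[OF G(1) fin])
      have \<gamma>'_on: "\<gamma>' \<in> measures_on (\<Omega> \<times> \<Omega>)"
        unfolding measures_on_def
      proof safe
        fix A :: "('a \<times> 'a) set" assume A: "A \<in> sets borel" "A \<inter> (\<Omega> \<times> \<Omega>) = {}"
        have "emeasure G A \<le> emeasure G (- (\<Omega> \<times> \<Omega>))"
          using A \<Omega>2_borel G(1) by (intro emeasure_mono) auto
        then show "smeas \<gamma>' A = 0" using G(2) by (simp add: sm measure_def)
      qed
      have "smeas (push fst \<gamma>') A = measure (pos_part \<nu>) A" "smeas (push snd \<gamma>') A = measure (neg_part \<nu>) A"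
        if "A \<in> sets borel" for A
        unfolding G(3,4)[symmetric] using that
        by (simp_all add: smeas_push borel_measurable_fst_snd sm measure_distr fst_G space)
      then have marg: "push fst \<gamma>' = smeas_of (pos_part \<nu>)" "push snd \<gamma>' = smeas_of (neg_part \<nu>)"
        by (auto intro!: signed_measure_eqI simp: smeas_smeas_of)
      define \<rho> where "\<rho> = \<mu> - \<nu>"
      have \<rho>: "\<rho> \<in> measures_on \<Omega>" unfolding \<rho>_def by (intro measures_on_diff \<mu> \<nu>)
      have "\<mu> = push fst \<gamma>' - push snd \<gamma>' + smeas_of (pos_part \<rho>) - smeas_of (neg_part \<rho>)"
        unfolding marg by (simp only: add_diff_eq[symmetric] smeas_of_pos_neg[symmetric]) (simp add: \<rho>_def)
      then have "represents \<gamma>' (smeas_of (pos_part \<rho>)) (smeas_of (neg_part \<rho>)) \<mu>"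
        using measures_on_pos_neg[OF \<rho> \<Omega>_borel] \<gamma>'_on \<gamma>'_nn by (simp add: represents_def nonneg_smeas_of)
      then have "rep_cost \<gamma> a b \<le> sint \<gamma>' ground_cost + \<alpha> * variation \<rho> \<Omega>"
        using opt by (fastforce simp: rep_cost_def variation_measures_on[OF \<rho>] smeas_smeas_of)
      moreover have "smeas \<gamma>' UNIV = measure (pos_part \<nu>) UNIV" "smeas \<gamma>' UNIV = measure (neg_part \<nu>) UNIV"
        using arg_cong[OF marg(1), of "\<lambda>m. smeas m UNIV"] arg_cong[OF marg(2), of "\<lambda>m. smeas m UNIV"]
        by (simp_all add: smeas_push borel_measurable_fst_snd smeas_smeas_of)
      ultimately have "rep_cost \<gamma> a b - e \<le> sint \<gamma>' ground_cost - \<beta> * smeas \<gamma>' UNIV"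
        by (simp add: e_def \<rho>_def variation_measures_on[OF \<nu>])
      then show "ennreal (rep_cost \<gamma> a b - e) \<le> (\<integral>\<^sup>+ (x, y). ennreal (dist x y powr p) \<partial>G)"
        using transport_cost[OF \<gamma>'_on \<gamma>'_nn] by (simp add: pp ennreal_leI)
    qed
    then have "ennreal (rep_cost \<gamma> a b - e) + ennreal e \<le> wasserstein \<Omega> p (pos_part \<nu>) (neg_part \<nu>) + ennreal e"
      by (rule add_right_mono)
    moreover have "ennreal (rep_cost \<gamma> a b) \<le> ennreal (rep_cost \<gamma> a b - e) + ennreal e"
    proof (cases "e \<le> rep_cost \<gamma> a b")
      case True
      then show ?thesis using nn by (simp add: e_def ennreal_plus[symmetric] del: ennreal_plus)
    next
      case False
      then have "ennreal (rep_cost \<gamma> a b) \<le> ennreal e" by (intro ennreal_leI) simp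
      then show ?thesis by (simp add: add_increasing)
    qed
    ultimately have "ennreal (rep_cost \<gamma> a b) \<le> wasserstein \<Omega> p (pos_part \<nu>) (neg_part \<nu>) + ennreal e"
      by (rule order_trans[rotated])
    then show ?thesis using nn by (simp add: cost_def e_def add.assoc)
  qed
  have "(INF \<nu> \<in> {\<nu> \<in> measures_on \<Omega>. smeas \<nu> \<Omega> = 0}. cost \<nu>) = ennreal (rep_cost \<gamma> a b)"
    by (rule antisym[OF upper INF_greatest]) (use lower in auto)
  then have "KR_norm \<Omega> p \<alpha> \<beta> \<mu> = rep_cost \<gamma> a b"
    using rep_cost_bounds(4)[OF rep] by (simp add: KR_norm_def cost_def)
  then show thesis using that rep opt by blast
qed

abbreviation KR :: "'a signed_measure \<Rightarrow> real" where
  "KR \<equiv> KR_norm \<Omega> p \<alpha> \<beta>"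

lemma KR_le_rep_cost: "represents \<gamma> a b \<mu> \<Longrightarrow> KR \<mu> \<le> rep_cost \<gamma> a b"
  by (metis KR_norm_attained represents_measures_on)

lemma KR_representation:
  assumes "\<mu> \<in> measures_on \<Omega>"
  obtains \<gamma> a b where "represents \<gamma> a b \<mu>" "rep_cost \<gamma> a b = KR \<mu>"
  by (metis KR_norm_attained assms)

subsection \<open>Properties of the norm\<close>

lemma KR_nonneg: "0 \<le> KR \<mu>"
  by (simp add: KR_norm_def)

lemma KR_add:
  assumes "\<mu> \<in> measures_on \<Omega>" "\<nu> \<in> measures_on \<Omega>"
  shows "KR (\<mu> + \<nu>) \<le> KR \<mu> + KR \<nu>"
proof -
  obtain \<gamma> a b where 1: "represents \<gamma> a b \<mu>" "rep_cost \<gamma> a b = KR \<mu>"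
    by (rule KR_representation[OF assms(1)])
  obtain \<gamma>' a' b' where 2: "represents \<gamma>' a' b' \<nu>" "rep_cost \<gamma>' a' b' = KR \<nu>"
    by (rule KR_representation[OF assms(2)])
  show ?thesis
    using KR_le_rep_cost[OF represents_add[OF 1(1) 2(1)]] 1(2) 2(2) by (simp add: rep_cost_add)
qed

lemma KR_scaleR:
  assumes "\<mu> \<in> measures_on \<Omega>" "0 \<le> c"
  shows "KR (c *\<^sub>R \<mu>) \<le> c * KR \<mu>"
proof -
  obtain \<gamma> a b where 1: "represents \<gamma> a b \<mu>" "rep_cost \<gamma> a b = KR \<mu>"
    by (rule KR_representation[OF assms(1)])
  show ?thesis
    using KR_le_rep_cost[OF represents_scaleR[OF 1(1) assms(2)]] 1(2) by (simp add: rep_cost_scaleR)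
qed

lemma KR_zero: "KR 0 = 0"
  using KR_scaleR[of 0 0] KR_nonneg[of 0] by simp

lemma KR_conic_combination:
  assumes "finite \<A>" "\<A> \<subseteq> KR_ball \<Omega> p \<alpha> \<beta>" "\<And>\<nu>. \<nu> \<in> \<A> \<Longrightarrow> 0 \<le> c \<nu>"
  shows "KR (\<Sum>\<nu>\<in>\<A>. c \<nu> *\<^sub>R \<nu>) \<le> (\<Sum>\<nu>\<in>\<A>. c \<nu>)"
  using assms
proof (induction \<A> rule: finite_induct)
  case (insert \<nu> \<A>)
  have \<nu>: "\<nu> \<in> measures_on \<Omega>" "KR \<nu> \<le> 1" "0 \<le> c \<nu>"
    using insert.prems by (auto simp: KR_ball_def)
  have "KR (\<Sum>\<nu>\<in>insert \<nu> \<A>. c \<nu> *\<^sub>R \<nu>) \<le> KR (c \<nu> *\<^sub>R \<nu>) + KR (\<Sum>\<nu>\<in>\<A>. c \<nu> *\<^sub>R \<nu>)"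
    unfolding sum.insert[OF insert.hyps] using insert.prems
    by (intro KR_add measures_on_sum measures_on_scaleR) (auto simp: KR_ball_def)
  also have "KR (c \<nu> *\<^sub>R \<nu>) \<le> c \<nu> * KR \<nu>" by (rule KR_scaleR[OF \<nu>(1,3)])
  also have "\<dots> \<le> c \<nu>" using mult_left_mono[OF \<nu>(2,3)] by simp
  also have "KR (\<Sum>\<nu>\<in>\<A>. c \<nu> *\<^sub>R \<nu>) \<le> (\<Sum>\<nu>\<in>\<A>. c \<nu>)"
    using insert.prems by (intro insert.IH) auto
  finally show ?case using insert.hyps by simp
qed (simp add: KR_zero)

lemma KR_compact:
  assumes "\<And>k. s k \<in> measures_on \<Omega>" "\<And>k. KR (s k) \<le> c k" "c \<longlonglongrightarrow> c0"
  obtains r \<mu> where "strict_mono r" "weak_star_tendsto \<Omega> (s \<circ> r) \<mu>" "KR \<mu> \<le> c0"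
proof -
  have "\<exists>\<gamma> a b. represents \<gamma> a b (s k) \<and> rep_cost \<gamma> a b \<le> c k" for k
    using assms(2)[of k] by (metis KR_representation[OF assms(1)])
  then obtain \<gamma> a b where rep: "\<And>k. represents (\<gamma> k) (a k) (b k) (s k)" "\<And>k. rep_cost (\<gamma> k) (a k) (b k) \<le> c k"
    by metis
  obtain r \<mu> \<gamma>' a' b' where r: "strict_mono r" "weak_star_tendsto \<Omega> (s \<circ> r) \<mu>"
    and "represents \<gamma>' a' b' \<mu>" "rep_cost \<gamma>' a' b' \<le> c0"
    by (rule represents_compact[OF rep assms(3)])
  then show thesis using that[OF r] KR_le_rep_cost by (meson order_trans)
qed

text \<open>The compactness lemma bounds the norm of the limit of some subsequence, and weak* limits are
  unique.\<close>

lemma KR_lower_semicontinuous: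
  assumes "\<And>k. s k \<in> measures_on \<Omega>" "weak_star_tendsto \<Omega> s \<mu>" "(\<lambda>k. KR (s k)) \<longlonglongrightarrow> c0"
  shows "KR \<mu> \<le> c0"
proof -
  obtain r \<mu>' where r: "strict_mono r" "weak_star_tendsto \<Omega> (s \<circ> r) \<mu>'" "KR \<mu>' \<le> c0"
    by (rule KR_compact[OF assms(1) order_refl assms(3)])
  then show ?thesis
    using weak_star_limit_unique[OF compact_\<Omega> weak_star_subseq[OF assms(2) r(1)] r(2)] by simp
qed

text \<open>The easy half of Kantorovich--Rubinstein duality.\<close>

lemma smeas_integral_le_KR:
  assumes \<mu>: "\<mu> \<in> measures_on \<Omega>" and q: "continuous_on \<Omega> q"
    and q\<alpha>: "\<And>x. x \<in> \<Omega> \<Longrightarrow> \<bar>q x\<bar> \<le> t * \<alpha>"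
    and q\<beta>: "\<And>x y. x \<in> \<Omega> \<Longrightarrow> y \<in> \<Omega> \<Longrightarrow> q x - q y \<le> t * (dist x y powr p + \<beta>)"
  shows "smeas_integral \<Omega> \<mu> q \<le> t * KR \<mu>"
proof -
  obtain \<gamma> a b where rep: "represents \<gamma> a b \<mu>" "rep_cost \<gamma> a b = KR \<mu>"
    by (rule KR_representation[OF \<mu>])
  have \<gamma>: "\<gamma> \<in> measures_on (\<Omega> \<times> \<Omega>)" "nonneg_smeas \<gamma>"
    and a: "nonneg_smeas a" "a \<in> measures_on \<Omega>" and b: "nonneg_smeas b" "b \<in> measures_on \<Omega>"
    using rep(1) by (auto simp: represents_def)
  define q' where "q' x = indicator \<Omega> x * q x" for x
  have bb: "bounded_borel q'" unfolding q'_def[abs_def] by (rule bounded_borel_restrict[OF compact_\<Omega> q])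
  have bbfs: "bounded_borel (\<lambda>w :: 'a \<times> 'a. q' (fst w))" "bounded_borel (\<lambda>w :: 'a \<times> 'a. q' (snd w))"
    using bounded_borel_compose[OF bb borel_measurable_fst_snd(1)]
      bounded_borel_compose[OF bb borel_measurable_fst_snd(2)] by auto
  have "sint \<gamma> (\<lambda>w. q' (fst w)) - sint \<gamma> (\<lambda>w. q' (snd w)) = sint \<gamma> (\<lambda>w. q' (fst w) - q' (snd w))"
    using bbfs by (simp add: sint_diff_fun)
  also have "\<dots> \<le> sint \<gamma> (\<lambda>w. t * ground_cost w)"
    using q\<beta> by (intro sint_mono[OF \<gamma>(2,1) \<Omega>2_borel] bounded_borel_diff bbfs bounded_borel_cmult
        bounded_borel_ground_cost) (auto simp: q'_def ground_cost_eq)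
  also have "\<dots> = t * sint \<gamma> ground_cost" by (rule sint_cmult_fun)
  finally have 1: "sint \<gamma> (\<lambda>w. q' (fst w)) - sint \<gamma> (\<lambda>w. q' (snd w)) \<le> t * sint \<gamma> ground_cost" .
  have q\<alpha>': "q' x \<le> t * \<alpha>" "- (t * \<alpha>) \<le> q' x" if "x \<in> \<Omega>" for x
    using q\<alpha>[OF that] that by (auto simp: q'_def abs_le_iff)
  have 2: "sint a q' \<le> (t * \<alpha>) * smeas a UNIV"
    using sint_mono[OF a \<Omega>_borel bb bounded_borel_const q\<alpha>'(1)] by (simp add: sint_const)
  have 3: "- (t * \<alpha>) * smeas b UNIV \<le> sint b q'"
    using sint_mono[OF b \<Omega>_borel bounded_borel_const bb q\<alpha>'(2)] by (simp add: sint_const)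
  have "smeas_integral \<Omega> \<mu> q = sint \<mu> q'" by (simp add: smeas_integral_eq_sint q'_def[abs_def])
  also have "\<dots> \<le> t * sint \<gamma> ground_cost + t * \<alpha> * smeas a UNIV + t * \<alpha> * smeas b UNIV"
    unfolding sint_represents[OF rep(1) bb] using 1 2 3 by simp
  also have "\<dots> = t * KR \<mu>" by (simp add: rep(2)[symmetric] rep_cost_def algebra_simps)
  finally show ?thesis .
qed

lemma smeas_integral_dirac:
  assumes "continuous_on \<Omega> q" "z \<in> \<Omega>"
  shows "smeas_integral \<Omega> (c *\<^sub>R dirac z) q = c * q z"
  unfolding smeas_integral_eq_sint
  using bounded_borel_restrict[OF compact_\<Omega> assms(1)] assms(2) by (simp add: sint_scaleR sint_dirac)

lemma smeas_integral_dipole: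
  assumes "continuous_on \<Omega> q" "x \<in> \<Omega>" "y \<in> \<Omega>"
  shows "smeas_integral \<Omega> (KR_dipole p \<beta> x y) q = Psi p \<beta> q (x, y)"
  unfolding smeas_integral_eq_sint KR_dipole_def
  using bounded_borel_restrict[OF compact_\<Omega> assms(1)] assms(2,3)
  by (simp add: sint_scaleR sint_diff sint_dirac Psi_def add.commute)

lemma scaled_dirac_in_KR_ball:
  assumes "z \<in> \<Omega>"
  shows "(sgn c / \<alpha>) *\<^sub>R dirac z \<in> KR_ball \<Omega> p \<alpha> \<beta>"
proof -
  define a where "a = max 0 (sgn c / \<alpha>) *\<^sub>R dirac z"
  define b where "b = max 0 (- sgn c / \<alpha>) *\<^sub>R dirac z"
  have "push fst (0 :: ('a \<times> 'a) signed_measure) = 0" "push snd (0 :: ('a \<times> 'a) signed_measure) = 0"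
    using push_fst_snd(3)[of 0 0] push_fst_snd(4)[of 0 0] by simp_all
  moreover have "(sgn c / \<alpha>) *\<^sub>R dirac z = a - b"
    by (auto simp: a_def b_def max_def scaleR_diff_left[symmetric])
  ultimately have rep: "represents 0 a b ((sgn c / \<alpha>) *\<^sub>R dirac z)"
    unfolding represents_def
    using assms by (auto simp: a_def b_def intro!: measures_on_scaleR nonneg_smeas_scaleR dirac_measures_on nonneg_dirac)
  moreover have "rep_cost 0 a b \<le> 1"
    using \<alpha> by (auto simp: rep_cost_def a_def b_def smeas_dirac sgn_if max_def)
  ultimately show ?thesis
    using KR_le_rep_cost[OF rep] represents_measures_on[OF rep] by (simp add: KR_ball_def)
qed

lemma dipole_in_KR_ball:
  assumes "x \<in> \<Omega>" "y \<in> \<Omega>"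
  shows "KR_dipole p \<beta> x y \<in> KR_ball \<Omega> p \<alpha> \<beta>"
proof -
  define \<gamma> where "\<gamma> = (1 / (\<beta> + dist x y powr p)) *\<^sub>R dirac (x, y)"
  have pos: "0 < \<beta> + dist x y powr p" using \<beta> by (simp add: add_pos_nonneg)
  have "push fst \<gamma> - push snd \<gamma> = KR_dipole p \<beta> x y"
    by (simp add: \<gamma>_def KR_dipole_def push_fst_snd push_dirac borel_measurable_fst_snd scaleR_diff_right)
  moreover have "\<gamma> \<in> measures_on (\<Omega> \<times> \<Omega>)" "nonneg_smeas \<gamma>"
    using assms pos by (auto simp: \<gamma>_def intro!: measures_on_scaleR nonneg_smeas_scaleR dirac_measures_on nonneg_dirac)
  ultimately have rep: "represents \<gamma> 0 0 (KR_dipole p \<beta> x y)" by (simp add: represents_def)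
  have "rep_cost \<gamma> 0 0 = 1"
    using pos assms
    by (simp add: rep_cost_def \<gamma>_def sint_scaleR sint_dirac bounded_borel_ground_cost ground_cost_eq add.commute)
  then show ?thesis
    using KR_le_rep_cost[OF rep] represents_measures_on[OF rep] by (simp add: KR_ball_def)
qed

end

section \<open>Smooth convex functions\<close>

lemma GDERIV_line:
  assumes "GDERIV F (u + t *\<^sub>R h) :> D"
  shows "((\<lambda>t. F (u + t *\<^sub>R h)) has_real_derivative inner D h) (at t)"
proof -
  have "((\<lambda>t. u + t *\<^sub>R h) has_derivative (\<lambda>s. s *\<^sub>R h)) (at t)"
    by (auto intro!: derivative_eq_intros)
  from has_derivative_compose[OF this assms[unfolded gderiv_def]]
  show ?thesis by (simp add: has_field_derivative_def inner_commute mult_commute_abs)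
qed

lemma convex_gradient_le:
  assumes conv: "strictly_convex F" and grad: "GDERIV F u :> D"
  shows "F u + inner D (v - u) \<le> F v"
proof -
  have "((\<lambda>t. F (u + t *\<^sub>R (v - u))) has_real_derivative inner D (v - u)) (at 0)"
    using grad by (intro GDERIV_line) simp
  then have "((\<lambda>t. (F (u + t *\<^sub>R (v - u)) - F u) / t) \<longlongrightarrow> inner D (v - u)) (at 0)"
    by (simp add: has_field_derivative_iff)
  then have lim: "((\<lambda>t. (F (u + t *\<^sub>R (v - u)) - F u) / t) \<longlongrightarrow> inner D (v - u)) (at_right 0)"
    by (rule tendsto_mono[rotated]) (simp add: at_le)
  have "inner D (v - u) \<le> F v - F u"
  proof (rule tendsto_upperbound[OF lim])
    have "(F (u + t *\<^sub>R (v - u)) - F u) / t \<le> F v - F u" if t: "0 < t" "t < 1" for t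
    proof -
      have eq: "u + t *\<^sub>R (v - u) = (1 - t) *\<^sub>R u + t *\<^sub>R v" by (simp add: algebra_simps)
      have "F ((1 - t) *\<^sub>R u + t *\<^sub>R v) \<le> (1 - t) * F u + t * F v"
      proof (cases "u = v")
        case True
        then have "(1 - t) *\<^sub>R u + t *\<^sub>R v = v" by (simp add: scaleR_add_left[symmetric])
        then show ?thesis using True by (simp add: algebra_simps)
      next
        case False
        have "F ((1 - t) *\<^sub>R u + t *\<^sub>R v) < (1 - t) * F u + t * F v"
          using conv False t unfolding strictly_convex_def by auto
        then show ?thesis by simp
      qed
      then have "F (u + t *\<^sub>R (v - u)) - F u \<le> (F v - F u) * t"
        unfolding eq by (simp add: algebra_simps)
      then show ?thesis using t by (simp add: pos_divide_le_eq)
    qed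
    then show "eventually (\<lambda>t. (F (u + t *\<^sub>R (v - u)) - F u) / t \<le> F v - F u) (at_right 0)"
      by (intro eventually_at_rightI[of 0 1]) auto
  qed simp
  then show ?thesis by simp
qed

text \<open>The descent lemma, with the constant that the mean value theorem gives directly.\<close>

lemma descent:
  assumes grad: "\<And>y. GDERIV F y :> gradF y" and lip: "L-lipschitz_on C gradF" and C: "convex C"
    and u: "u \<in> C" "u + h \<in> C" and t: "0 \<le> t" "t \<le> 1"
  shows "F (u + t *\<^sub>R h) \<le> F u + t * inner (gradF u) h + L * (norm h)\<^sup>2 * t\<^sup>2"
proof (cases "t = 0")
  case False
  then have "0 < t" using t by simp
  then obtain \<xi> where \<xi>: "0 < \<xi>" "\<xi> < t"
    and mvt: "F (u + t *\<^sub>R h) - F (u + 0 *\<^sub>R h) = (t - 0) * inner (gradF (u + \<xi> *\<^sub>R h)) h"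
    using MVT2[of 0 t "\<lambda>t. F (u + t *\<^sub>R h)" "\<lambda>t. inner (gradF (u + t *\<^sub>R h)) h"] GDERIV_line[OF grad] by blast
  have "(1 - \<xi>) *\<^sub>R u + \<xi> *\<^sub>R (u + h) \<in> C"
    using C u \<xi> t by (intro convexD) auto
  moreover have "(1 - \<xi>) *\<^sub>R u + \<xi> *\<^sub>R (u + h) = u + \<xi> *\<^sub>R h" by (simp add: algebra_simps)
  ultimately have "u + \<xi> *\<^sub>R h \<in> C" by simp
  then have "norm (gradF (u + \<xi> *\<^sub>R h) - gradF u) \<le> L * (\<xi> * norm h)"
    using lipschitz_onD[OF lip _ u(1)] \<xi> by (fastforce simp: dist_norm)
  also have "\<dots> \<le> L * (t * norm h)"
    using \<xi> lipschitz_on_nonneg[OF lip] by (intro mult_left_mono mult_right_mono) auto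
  finally have "norm (gradF (u + \<xi> *\<^sub>R h) - gradF u) * norm h \<le> L * (t * norm h) * norm h"
    by (rule mult_right_mono) simp
  then have "inner (gradF (u + \<xi> *\<^sub>R h) - gradF u) h \<le> L * (t * norm h) * norm h"
    using norm_cauchy_schwarz order_trans by blast
  then have "t * inner (gradF (u + \<xi> *\<^sub>R h)) h \<le> t * (inner (gradF u) h + L * (t * norm h) * norm h)"
    using \<open>0 < t\<close> by (intro mult_left_mono) (simp_all add: inner_diff_left)
  then show ?thesis using mvt by (simp add: algebra_simps power2_eq_square)
qed simp

text \<open>With step length \<open>2/(k+2)\<close> the bound \<open>C/(k+1)\<close> reproduces itself as soon as \<open>4 * A \<le> C\<close>, and it
  holds initially if \<open>2 * r 1 \<le> C\<close>.\<close>

lemma conditional_gradient_rate: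
  fixes r :: "nat \<Rightarrow> real"
  assumes "\<And>k. 1 \<le> k \<Longrightarrow> r (Suc k) \<le> (1 - 2 / (real k + 2)) * r k + A * (2 / (real k + 2))\<^sup>2"
    and C: "2 * r 1 \<le> C" "4 * A \<le> C" "0 \<le> C" and "1 \<le> k"
  shows "r k \<le> C / (1 + real k)"
  using \<open>1 \<le> k\<close>
proof (induction k rule: dec_induct)
  case (step k)
  define x where "x = real k"
  have x: "1 \<le> x" using step.hyps by (simp add: x_def)
  have "r (Suc k) \<le> (1 - 2 / (x + 2)) * r k + A * (2 / (x + 2))\<^sup>2"
    using assms(1)[OF step.hyps(1)] by (simp add: x_def)
  also have "\<dots> \<le> (1 - 2 / (x + 2)) * (C / (1 + x)) + C / (x + 2)\<^sup>2"
  proof (rule add_mono)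
    show "(1 - 2 / (x + 2)) * r k \<le> (1 - 2 / (x + 2)) * (C / (1 + x))"
      using step.IH x by (intro mult_left_mono) (auto simp: x_def)
    have "A * (2 / (x + 2))\<^sup>2 = 4 * A / (x + 2)\<^sup>2" by (simp add: power_divide)
    also have "\<dots> \<le> C / (x + 2)\<^sup>2" using C(2) by (intro divide_right_mono) auto
    finally show "A * (2 / (x + 2))\<^sup>2 \<le> C / (x + 2)\<^sup>2" .
  qed
  also have "\<dots> = C * (x / ((x + 2) * (1 + x)) + 1 / (x + 2)\<^sup>2)"
    using x by (simp add: field_simps)
  also have "\<dots> \<le> C * (1 / (x + 2))"
  proof (rule mult_left_mono[OF _ C(3)])
    have "1 / (x + 2)\<^sup>2 \<le> 1 / ((x + 2) * (1 + x))"
      using x by (intro divide_left_mono) (auto simp: power2_eq_square)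
    moreover have "x / ((x + 2) * (1 + x)) + 1 / ((x + 2) * (1 + x)) = 1 / (x + 2)"
      using x by (simp add: add_divide_distrib[symmetric] add.commute)
    ultimately show "x / ((x + 2) * (1 + x)) + 1 / (x + 2)\<^sup>2 \<le> 1 / (x + 2)" by linarith
  qed
  finally show ?case by (simp add: x_def add.commute)
qed (use C in simp)

section \<open>The algorithm\<close>

locale AGCG_setting = KR_setting \<Omega> p \<alpha> \<beta>
  for \<Omega> :: "'a::euclidean_space set" and p \<alpha> \<beta> +
  fixes K :: "'a signed_measure \<Rightarrow> 'y::{real_inner, complete_space}"
    and Kpre :: "'y \<Rightarrow> 'a \<Rightarrow> real" and F :: "'y \<Rightarrow> real" and gradF :: "'y \<Rightarrow> 'y"
  assumes K_linear: "linear_on_measures \<Omega> K" and K_cont: "weak_star_to_strong_continuous \<Omega> K"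
    and K_pre: "is_preadjoint \<Omega> K Kpre"
    and F_convex: "strictly_convex F" and F_bdd: "bdd_below (range F)"
    and F_grad: "\<And>y. GDERIV F y :> gradF y"
    and F_lipschitz: "\<And>C. compact C \<Longrightarrow> \<exists>L. L-lipschitz_on C gradF"
begin

abbreviation Jfun :: "'a signed_measure \<Rightarrow> real" where
  "Jfun \<equiv> objective \<Omega> p \<alpha> \<beta> F K"

lemma Jfun_eq: "Jfun \<mu> = F (K \<mu>) + KR \<mu>"
  by (simp add: objective_def)

lemma K_add: "\<mu> \<in> measures_on \<Omega> \<Longrightarrow> \<nu> \<in> measures_on \<Omega> \<Longrightarrow> K (\<mu> + \<nu>) = K \<mu> + K \<nu>"
  and K_scaleR: "\<mu> \<in> measures_on \<Omega> \<Longrightarrow> K (c *\<^sub>R \<mu>) = c *\<^sub>R K \<mu>"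
  using K_linear by (auto simp: linear_on_measures_def)

lemma K_sum:
  assumes "\<And>\<nu>. \<nu> \<in> \<A> \<Longrightarrow> \<nu> \<in> measures_on \<Omega>"
  shows "K (\<Sum>\<nu>\<in>\<A>. c \<nu> *\<^sub>R \<nu>) = (\<Sum>\<nu>\<in>\<A>. c \<nu> *\<^sub>R K \<nu>)"
  using assms
proof (induction \<A> rule: infinite_finite_induct)
  case (insert \<nu> \<A>)
  then show ?case
    by (simp add: K_add K_scaleR measures_on_sum measures_on_scaleR)
qed (use K_scaleR[of 0 0] in simp_all)

definition KR_sublevel :: "real \<Rightarrow> 'a signed_measure set" where
  "KR_sublevel M = {\<nu> \<in> measures_on \<Omega>. KR \<nu> \<le> M}"

lemma K_convergent:
  assumes "\<And>k. s k \<in> measures_on \<Omega>" "weak_star_tendsto \<Omega> s \<mu>"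
  shows "(\<lambda>k. K (s k)) \<longlonglongrightarrow> K \<mu>"
  using K_cont assms unfolding weak_star_to_strong_continuous_def by blast

text \<open>This supplies the compact set on which the gradient of \<open>F\<close> is Lipschitz continuous; it is also
  convex, so that it contains the segments along which \<open>F\<close> is compared.\<close>

lemma compact_K_sublevel: "compact (K ` KR_sublevel M)"
  unfolding compact_eq_seq_compact_metric seq_compact_def
proof (intro allI impI)
  fix f :: "nat \<Rightarrow> 'y" assume "\<forall>n. f n \<in> K ` KR_sublevel M"
  then obtain s where s: "\<And>n. s n \<in> measures_on \<Omega>" "\<And>n. KR (s n) \<le> M" "\<And>n. f n = K (s n)"
    unfolding KR_sublevel_def image_iff by (metis (no_types, lifting) mem_Collect_eq)
  obtain r \<mu> where r: "strict_mono r" "weak_star_tendsto \<Omega> (s \<circ> r) \<mu>" "KR \<mu> \<le> M"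
    by (rule KR_compact[OF s(1,2) tendsto_const])
  have "(\<lambda>k. K ((s \<circ> r) k)) \<longlonglongrightarrow> K \<mu>" by (rule K_convergent[OF _ r(2)]) (simp add: s)
  then have "(f \<circ> r) \<longlonglongrightarrow> K \<mu>" by (simp add: comp_def s(3))
  moreover have "K \<mu> \<in> K ` KR_sublevel M"
    using r(2,3) by (auto simp: KR_sublevel_def weak_star_tendsto_def)
  ultimately show "\<exists>l\<in>K ` KR_sublevel M. \<exists>r. strict_mono r \<and> (f \<circ> r) \<longlonglongrightarrow> l"
    using r(1) by blast
qed

lemma convex_K_sublevel: "convex (K ` KR_sublevel M)"
proof (rule convexI)
  fix x y u v :: real and x' y' assume "x' \<in> K ` KR_sublevel M" "y' \<in> K ` KR_sublevel M"
    and uv: "0 \<le> u" "0 \<le> v" "u + v = 1"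
  then obtain \<mu> \<nu> where \<mu>: "\<mu> \<in> measures_on \<Omega>" "KR \<mu> \<le> M" "x' = K \<mu>"
    and \<nu>: "\<nu> \<in> measures_on \<Omega>" "KR \<nu> \<le> M" "y' = K \<nu>"
    by (auto simp: KR_sublevel_def)
  have on: "u *\<^sub>R \<mu> \<in> measures_on \<Omega>" "v *\<^sub>R \<nu> \<in> measures_on \<Omega>"
    by (intro measures_on_scaleR \<mu> \<nu>)+
  have "KR (u *\<^sub>R \<mu> + v *\<^sub>R \<nu>) \<le> u * KR \<mu> + v * KR \<nu>"
    using KR_add[OF on] KR_scaleR[OF \<mu>(1) uv(1)] KR_scaleR[OF \<nu>(1) uv(2)] by linarith
  also have "\<dots> \<le> u * M + v * M"
    using \<mu>(2) \<nu>(2) uv by (intro add_mono mult_left_mono)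
  also have "\<dots> = M" using uv(3) by (simp add: distrib_right[symmetric])
  finally have "u *\<^sub>R \<mu> + v *\<^sub>R \<nu> \<in> KR_sublevel M" using on by (simp add: KR_sublevel_def measures_on_add)
  moreover have "K (u *\<^sub>R \<mu> + v *\<^sub>R \<nu>) = u *\<^sub>R x' + v *\<^sub>R y'"
    using on \<mu> \<nu> by (simp add: K_add K_scaleR)
  ultimately show "u *\<^sub>R x' + v *\<^sub>R y' \<in> K ` KR_sublevel M" by (metis image_eqI)
qed

subsection \<open>Dual certificates\<close>

abbreviation dual :: "'a signed_measure \<Rightarrow> 'a \<Rightarrow> real" where
  "dual \<equiv> dual_variable gradF K Kpre"

lemma continuous_dual: "continuous_on \<Omega> (dual \<mu>)"
  using K_pre unfolding is_preadjoint_def dual_variable_def[abs_def]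
  by (intro continuous_intros) blast

lemma smeas_integral_dual:
  assumes "\<nu> \<in> measures_on \<Omega>"
  shows "smeas_integral \<Omega> \<nu> (dual \<mu>) = - inner (gradF (K \<mu>)) (K \<nu>)"
proof -
  have "smeas_integral \<Omega> \<nu> (dual \<mu>) = - smeas_integral \<Omega> \<nu> (Kpre (gradF (K \<mu>)))"
    using sint_cmult_fun[of \<nu> "-1" "\<lambda>x. indicator \<Omega> x * Kpre (gradF (K \<mu>)) x"]
    by (simp add: smeas_integral_eq_sint dual_variable_def)
  then show ?thesis using K_pre assms by (simp add: is_preadjoint_def)
qed

text \<open>The number \<open>s\<close> bounds the pairing of the dual variable at \<open>\<mu>\<close> with the unit ball.\<close>

definition dual_bound :: "'a signed_measure \<Rightarrow> real \<Rightarrow> bool" where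
  "dual_bound \<mu> s \<longleftrightarrow> (\<forall>z\<in>\<Omega>. \<bar>dual \<mu> z\<bar> \<le> s * \<alpha>) \<and>
     (\<forall>x\<in>\<Omega>. \<forall>y\<in>\<Omega>. dual \<mu> x - dual \<mu> y \<le> s * (dist x y powr p + \<beta>))"

text \<open>The tangent of \<open>F\<close> at \<open>K \<mu>\<close> bounds \<open>F (K \<nu>)\<close> from below, and duality bounds its slope by
  \<open>s * KR \<nu>\<close>.\<close>

lemma objective_lower_bound:
  assumes "dual_bound \<mu> s" "\<nu> \<in> measures_on \<Omega>"
  shows "F (K \<mu>) - inner (gradF (K \<mu>)) (K \<mu>) - (s - 1) * KR \<nu> \<le> Jfun \<nu>"
proof -
  have "- inner (gradF (K \<mu>)) (K \<nu>) \<le> s * KR \<nu>"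
    unfolding smeas_integral_dual[OF assms(2), symmetric]
    using assms(1) by (intro smeas_integral_le_KR[OF assms(2) continuous_dual]) (auto simp: dual_bound_def)
  moreover have "F (K \<mu>) + inner (gradF (K \<mu>)) (K \<nu> - K \<mu>) \<le> F (K \<nu>)"
    by (rule convex_gradient_le[OF F_convex F_grad])
  ultimately show ?thesis by (simp add: Jfun_eq inner_diff_right algebra_simps)
qed

lemma maximizers_bound:
  assumes "agcg_maximizers \<Omega> p \<beta> (dual \<mu>) z w" "\<bar>dual \<mu> z\<bar> \<le> s * \<alpha>" "Psi p \<beta> (dual \<mu>) w \<le> s"
  shows "dual_bound \<mu> s"
  unfolding dual_bound_def
proof (intro conjI ballI)
  fix x assume "x \<in> \<Omega>"
  then show "\<bar>dual \<mu> x\<bar> \<le> s * \<alpha>"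
    using assms(1,2) unfolding agcg_maximizers_def is_arg_max_def by (meson leI order_trans)
next
  fix x y assume "x \<in> \<Omega>" "y \<in> \<Omega>"
  then have "Psi p \<beta> (dual \<mu>) (x, y) \<le> s"
    using assms(1,3) unfolding agcg_maximizers_def is_arg_max_def by (meson leI order_trans SigmaI)
  moreover have "0 < dist x y powr p + \<beta>" using \<beta> by (simp add: add_nonneg_pos)
  ultimately show "dual \<mu> x - dual \<mu> y \<le> s * (dist x y powr p + \<beta>)"
    by (simp add: Psi_def pos_divide_le_eq)
qed

text \<open>The new point attains the maximum of the dual variable over the unit ball, and this maximum
  exceeds 1 because the stopping test has failed.\<close>

lemma new_point:
  assumes max: "agcg_maximizers \<Omega> p \<beta> (dual \<mu>) z w" and "\<not> agcg_stop p \<alpha> \<beta> (dual \<mu>) z w"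
  defines "h \<equiv> agcg_new_point p \<alpha> \<beta> (dual \<mu>) z w"
  shows "h \<in> KR_ball \<Omega> p \<alpha> \<beta>" "1 < - inner (gradF (K \<mu>)) (K h)"
    "dual_bound \<mu> (- inner (gradF (K \<mu>)) (K h))"
proof -
  define s where "s = max (\<bar>dual \<mu> z\<bar> / \<alpha>) (Psi p \<beta> (dual \<mu>) w)"
  have z: "z \<in> \<Omega>" and w: "fst w \<in> \<Omega>" "snd w \<in> \<Omega>"
    using max by (auto simp: agcg_maximizers_def is_arg_max_def)
  show h: "h \<in> KR_ball \<Omega> p \<alpha> \<beta>"
    unfolding h_def agcg_new_point_def
    using scaled_dirac_in_KR_ball[OF z] dipole_in_KR_ball[OF w] by simp
  have "smeas_integral \<Omega> h (dual \<mu>) = s"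
  proof (cases "\<bar>dual \<mu> z\<bar> / \<alpha> \<ge> Psi p \<beta> (dual \<mu>) w")
    case True
    then have "h = (sgn (dual \<mu> z) / \<alpha>) *\<^sub>R dirac z" by (simp add: h_def agcg_new_point_def)
    moreover have "sgn (dual \<mu> z) * dual \<mu> z = \<bar>dual \<mu> z\<bar>" by (simp add: abs_sgn mult.commute)
    ultimately show ?thesis
      using True by (simp add: smeas_integral_dirac[OF continuous_dual z] s_def max_def)
  next
    case False
    then have "h = KR_dipole p \<beta> (fst w) (snd w)" by (simp add: h_def agcg_new_point_def)
    then show ?thesis
      using False by (simp add: smeas_integral_dipole[OF continuous_dual w] s_def)
  qed
  moreover have "h \<in> measures_on \<Omega>" using h by (simp add: KR_ball_def)
  ultimately have s: "- inner (gradF (K \<mu>)) (K h) = s" by (simp add: smeas_integral_dual)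
  show "1 < - inner (gradF (K \<mu>)) (K h)"
    unfolding s s_def using assms(2) \<alpha> by (auto simp: agcg_stop_def less_max_iff_disj pos_less_divide_eq)
  have "\<bar>dual \<mu> z\<bar> / \<alpha> \<le> s" by (simp add: s_def)
  then have "\<bar>dual \<mu> z\<bar> \<le> s * \<alpha>" using \<alpha> by (simp add: pos_divide_le_eq)
  then show "dual_bound \<mu> (- inner (gradF (K \<mu>)) (K h))"
    unfolding s by (rule maximizers_bound[OF max]) (simp add: s_def)
qed

subsection \<open>Corrective steps\<close>

text \<open>Minimality of the coefficients along the ray through them forces their sum to be
  \<open>- inner (gradF (K \<mu>)) (K \<mu>)\<close>. The value of the coefficient problem is therefore a function of
  the iterate alone.\<close>

definition coeff_value :: "'a signed_measure \<Rightarrow> real" where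
  "coeff_value \<mu> = F (K \<mu>) - inner (gradF (K \<mu>)) (K \<mu>)"

definition iterate :: "'a signed_measure \<Rightarrow> 'a signed_measure set \<Rightarrow> bool" where
  "iterate \<mu> \<A> \<longleftrightarrow> finite \<A> \<and> \<A> \<subseteq> KR_ball \<Omega> p \<alpha> \<beta> \<and>
     (\<exists>c. (\<forall>\<nu>\<in>\<A>. 0 \<le> c \<nu>) \<and> \<mu> = (\<Sum>\<nu>\<in>\<A>. c \<nu> *\<^sub>R \<nu>) \<and> coeff_value \<mu> = F (K \<mu>) + (\<Sum>\<nu>\<in>\<A>. c \<nu>))"

lemma iterate_measures_on: "iterate \<mu> \<A> \<Longrightarrow> \<mu> \<in> measures_on \<Omega>"
  by (auto simp: iterate_def KR_ball_def intro!: measures_on_sum measures_on_scaleR)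

lemma iterate_KR_le: "iterate \<mu> \<A> \<Longrightarrow> KR \<mu> \<le> coeff_value \<mu> - F (K \<mu>)"
  unfolding iterate_def using KR_conic_combination by auto

lemma iterate_J_le: "iterate \<mu> \<A> \<Longrightarrow> Jfun \<mu> \<le> coeff_value \<mu>"
  using iterate_KR_le[of \<mu> \<A>] by (simp add: Jfun_eq)

lemma corrective_update_iterate:
  assumes \<A>: "finite \<A>" "\<A> \<subseteq> KR_ball \<Omega> p \<alpha> \<beta>" and upd: "corrective_update F K \<A> \<mu> \<A>'"
  shows "iterate \<mu> \<A>'"
    and "(\<And>\<nu>. \<nu> \<in> \<A> \<Longrightarrow> 0 \<le> d \<nu>) \<Longrightarrow>
      coeff_value \<mu> \<le> F (K (\<Sum>\<nu>\<in>\<A>. d \<nu> *\<^sub>R \<nu>)) + (\<Sum>\<nu>\<in>\<A>. d \<nu>)"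
proof -
  obtain c where sol: "solves_coeff_problem F K \<A> c"
    and c: "\<mu> = (\<Sum>\<nu>\<in>\<A>. c \<nu> *\<^sub>R \<nu>)" "\<A>' = \<A> - {\<nu> \<in> \<A>. c \<nu> = 0}"
    using upd unfolding corrective_update_def by blast
  have c0: "0 \<le> c \<nu>" if "\<nu> \<in> \<A>" for \<nu>
    using sol that by (simp add: solves_coeff_problem_def is_arg_min_def)
  have min: "coeff_objective F K \<A> c \<le> coeff_objective F K \<A> d" if "\<And>\<nu>. \<nu> \<in> \<A> \<Longrightarrow> 0 \<le> d \<nu>" for d
    using sol that by (auto simp: solves_coeff_problem_def is_arg_min_def not_less)
  have on: "\<nu> \<in> measures_on \<Omega>" if "\<nu> \<in> \<A>" for \<nu> using that \<A>(2) by (auto simp: KR_ball_def)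
  have obj: "coeff_objective F K \<A> d = F (K (\<Sum>\<nu>\<in>\<A>. d \<nu> *\<^sub>R \<nu>)) + (\<Sum>\<nu>\<in>\<A>. d \<nu>)" for d
    by (simp add: coeff_objective_def K_sum on)
  define \<Lambda> where "\<Lambda> = (\<Sum>\<nu>\<in>\<A>. c \<nu>)"
  have \<mu>_on: "\<mu> \<in> measures_on \<Omega>" unfolding c(1) by (intro measures_on_sum measures_on_scaleR on)
  have ray: "F (K \<mu>) + \<Lambda> \<le> F (t *\<^sub>R K \<mu>) + t * \<Lambda>" if "0 \<le> t" for t
  proof -
    have "(\<Sum>\<nu>\<in>\<A>. (t * c \<nu>) *\<^sub>R \<nu>) = t *\<^sub>R \<mu>" by (simp add: c(1) scaleR_sum_right)
    then show ?thesis
      using min[of "\<lambda>\<nu>. t * c \<nu>"] c0 that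
      by (simp add: obj c(1)[symmetric] K_scaleR \<mu>_on \<Lambda>_def sum_distrib_left)
  qed
  have "((\<lambda>t. F (0 + t *\<^sub>R K \<mu>) + t * \<Lambda>) has_real_derivative inner (gradF (0 + 1 *\<^sub>R K \<mu>)) (K \<mu>) + 1 * \<Lambda>) (at 1)"
    by (intro DERIV_add GDERIV_line F_grad DERIV_cmult_right DERIV_ident)
  then have "inner (gradF (0 + 1 *\<^sub>R K \<mu>)) (K \<mu>) + 1 * \<Lambda> = 0"
    by (rule DERIV_local_min[where d = 1]) (use ray in auto)
  then have \<Lambda>: "coeff_value \<mu> = F (K \<mu>) + \<Lambda>" by (simp add: coeff_value_def)
  show "coeff_value \<mu> \<le> F (K (\<Sum>\<nu>\<in>\<A>. d \<nu> *\<^sub>R \<nu>)) + (\<Sum>\<nu>\<in>\<A>. d \<nu>)" if "\<And>\<nu>. \<nu> \<in> \<A> \<Longrightarrow> 0 \<le> d \<nu>"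
    using min[OF that] by (simp add: obj c(1)[symmetric] \<Lambda> \<Lambda>_def)
  have "(\<Sum>\<nu>\<in>\<A>'. c \<nu> *\<^sub>R \<nu>) = \<mu>" "(\<Sum>\<nu>\<in>\<A>'. c \<nu>) = \<Lambda>"
    unfolding c \<Lambda>_def using \<A>(1) by (auto intro!: sum.mono_neutral_left)
  then show "iterate \<mu> \<A>'"
    unfolding iterate_def using \<A> c0 c(2) \<Lambda> by (intro conjI exI[of _ c]) auto
qed

abbreviation next_iterate ::
  "'a signed_measure \<Rightarrow> 'a signed_measure set \<Rightarrow> 'a signed_measure \<Rightarrow> 'a signed_measure set \<Rightarrow> bool" where
  "next_iterate \<equiv> agcg_step \<Omega> p \<alpha> \<beta> F gradF K Kpre"

lemma step_iterate:
  assumes it: "iterate \<mu> \<A>" and step: "next_iterate \<mu> \<A> \<mu>' \<A>'"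
  obtains h where "iterate \<mu>' \<A>'" "h \<in> KR_ball \<Omega> p \<alpha> \<beta>" "1 < - inner (gradF (K \<mu>)) (K h)"
    "dual_bound \<mu> (- inner (gradF (K \<mu>)) (K h))"
    "\<And>t m. 0 \<le> t \<Longrightarrow> t \<le> 1 \<Longrightarrow> 0 \<le> m \<Longrightarrow> coeff_value \<mu>'
       \<le> F ((1 - t) *\<^sub>R K \<mu> + (t * m) *\<^sub>R K h) + (1 - t) * (coeff_value \<mu> - F (K \<mu>)) + t * m"
proof -
  obtain z w where max: "agcg_maximizers \<Omega> p \<beta> (dual \<mu>) z w" "\<not> agcg_stop p \<alpha> \<beta> (dual \<mu>) z w"
    and upd: "corrective_update F K (\<A> \<union> {agcg_new_point p \<alpha> \<beta> (dual \<mu>) z w}) \<mu>' \<A>'"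
    using step by (auto simp: agcg_step_def Let_def)
  define h where "h = agcg_new_point p \<alpha> \<beta> (dual \<mu>) z w"
  note h = new_point[OF max, folded h_def]
  obtain c where \<A>: "finite \<A>" "\<A> \<subseteq> KR_ball \<Omega> p \<alpha> \<beta>"
    and c: "\<And>\<nu>. \<nu> \<in> \<A> \<Longrightarrow> 0 \<le> c \<nu>" "\<mu> = (\<Sum>\<nu>\<in>\<A>. c \<nu> *\<^sub>R \<nu>)" "coeff_value \<mu> = F (K \<mu>) + (\<Sum>\<nu>\<in>\<A>. c \<nu>)"
    using it by (auto simp: iterate_def)
  have \<A>h: "finite (\<A> \<union> {h})" "\<A> \<union> {h} \<subseteq> KR_ball \<Omega> p \<alpha> \<beta>" using \<A> h(1) by auto
  note upd' = corrective_update_iterate[OF \<A>h upd[folded h_def]]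
  show thesis
  proof (rule that[OF upd'(1) h])
    fix t m :: real assume t: "0 \<le> t" "t \<le> 1" and m: "0 \<le> m"
    \<comment> \<open>The two summands overlap when \<open>h\<close> already belongs to the active set.\<close>
    define d where "d \<nu> = (if \<nu> \<in> \<A> then (1 - t) * c \<nu> else 0) + (if \<nu> = h then t * m else 0)" for \<nu>
    have d: "0 \<le> d \<nu>" for \<nu> using t m c(1) by (simp add: d_def)
    have sum_d: "(\<Sum>\<nu>\<in>\<A> \<union> {h}. d \<nu> *\<^sub>R g \<nu>) = (1 - t) *\<^sub>R (\<Sum>\<nu>\<in>\<A>. c \<nu> *\<^sub>R g \<nu>) + (t * m) *\<^sub>R g h"
      for g :: "'a signed_measure \<Rightarrow> 'b::real_vector"
    proof -
      have "(\<Sum>\<nu>\<in>\<A> \<union> {h}. d \<nu> *\<^sub>R g \<nu>) = (\<Sum>\<nu>\<in>\<A> \<union> {h}. if \<nu> \<in> \<A> then ((1 - t) * c \<nu>) *\<^sub>R g \<nu> else 0)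
          + (\<Sum>\<nu>\<in>\<A> \<union> {h}. if \<nu> = h then (t * m) *\<^sub>R g \<nu> else 0)"
        unfolding sum.distrib[symmetric] by (intro sum.cong) (auto simp: d_def scaleR_add_left)
      also have "(\<Sum>\<nu>\<in>\<A> \<union> {h}. if \<nu> = h then (t * m) *\<^sub>R g \<nu> else 0) = (t * m) *\<^sub>R g h"
        using \<A>h(1) by (subst sum.delta) auto
      also have "(\<Sum>\<nu>\<in>\<A> \<union> {h}. if \<nu> \<in> \<A> then ((1 - t) * c \<nu>) *\<^sub>R g \<nu> else 0) = (\<Sum>\<nu>\<in>\<A>. ((1 - t) * c \<nu>) *\<^sub>R g \<nu>)"
        using \<A>h(1) by (intro sum.mono_neutral_cong_right) auto
      finally show ?thesis by (simp add: scaleR_sum_right)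
    qed
    have \<mu>_on: "\<mu> \<in> measures_on \<Omega>" by (rule iterate_measures_on[OF it])
    have h_on: "h \<in> measures_on \<Omega>" using h(1) by (simp add: KR_ball_def)
    have "(\<Sum>\<nu>\<in>\<A> \<union> {h}. d \<nu> *\<^sub>R \<nu>) = (1 - t) *\<^sub>R \<mu> + (t * m) *\<^sub>R h"
      using sum_d[of "\<lambda>\<nu>. \<nu>"] by (simp add: c(2))
    then have "K (\<Sum>\<nu>\<in>\<A> \<union> {h}. d \<nu> *\<^sub>R \<nu>) = (1 - t) *\<^sub>R K \<mu> + (t * m) *\<^sub>R K h"
      using \<mu>_on h_on by (simp add: K_add K_scaleR measures_on_scaleR)
    moreover have "(\<Sum>\<nu>\<in>\<A> \<union> {h}. d \<nu>) = (1 - t) * (coeff_value \<mu> - F (K \<mu>)) + t * m"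
      using sum_d[of "\<lambda>_. 1 :: real"] by (simp add: c(3))
    ultimately show "coeff_value \<mu>'
       \<le> F ((1 - t) *\<^sub>R K \<mu> + (t * m) *\<^sub>R K h) + (1 - t) * (coeff_value \<mu> - F (K \<mu>)) + t * m"
      using upd'(2)[of d] d by simp
  qed
qed

lemma step_coeff_value_le:
  assumes "iterate \<mu> \<A>" "next_iterate \<mu> \<A> \<mu>' \<A>'"
  shows "coeff_value \<mu>' \<le> coeff_value \<mu>"
proof -
  obtain h where "\<And>t m. 0 \<le> t \<Longrightarrow> t \<le> 1 \<Longrightarrow> 0 \<le> m \<Longrightarrow> coeff_value \<mu>'
       \<le> F ((1 - t) *\<^sub>R K \<mu> + (t * m) *\<^sub>R K h) + (1 - t) * (coeff_value \<mu> - F (K \<mu>)) + t * m"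
    using step_iterate[OF assms] by metis
  from this[of 0 0] show ?thesis by simp
qed

text \<open>The candidate that moves from \<open>\<mu>\<close> towards \<open>M *\<^sub>R h\<close> has slope at most
  \<open>Jfun \<nu> - coeff_value \<mu>\<close> for every competitor \<open>\<nu>\<close> of norm at most \<open>M\<close>.\<close>

lemma step_decrease:
  assumes it: "iterate \<mu> \<A>" and step: "next_iterate \<mu> \<A> \<mu>' \<A>'"
    and lip: "L-lipschitz_on (K ` KR_sublevel M) gradF"
    and R: "\<And>y. y \<in> K ` KR_sublevel M \<Longrightarrow> norm y \<le> R"
    and \<mu>M: "coeff_value \<mu> - F (K \<mu>) \<le> M"
    and \<nu>: "\<nu> \<in> KR_sublevel M" and t: "0 \<le> t" "t \<le> 1"
  shows "coeff_value \<mu>' \<le> (1 - t) * coeff_value \<mu> + t * Jfun \<nu> + L * (2 * R)\<^sup>2 * t\<^sup>2"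
proof -
  obtain h where h: "h \<in> KR_ball \<Omega> p \<alpha> \<beta>" "1 < - inner (gradF (K \<mu>)) (K h)"
    "dual_bound \<mu> (- inner (gradF (K \<mu>)) (K h))"
    and cand: "\<And>t m. 0 \<le> t \<Longrightarrow> t \<le> 1 \<Longrightarrow> 0 \<le> m \<Longrightarrow> coeff_value \<mu>'
       \<le> F ((1 - t) *\<^sub>R K \<mu> + (t * m) *\<^sub>R K h) + (1 - t) * (coeff_value \<mu> - F (K \<mu>)) + t * m"
    using step_iterate[OF it step] by metis
  define s where "s = - inner (gradF (K \<mu>)) (K h)"
  define e where "e = M *\<^sub>R K h - K \<mu>"
  have M: "0 \<le> M" using iterate_KR_le[OF it] KR_nonneg[of \<mu>] \<mu>M by linarith
  have \<nu>_on: "\<nu> \<in> measures_on \<Omega>" "KR \<nu> \<le> M" using \<nu> by (auto simp: KR_sublevel_def)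
  have h_on: "h \<in> measures_on \<Omega>" "KR h \<le> 1" using h(1) by (auto simp: KR_ball_def)
  have "M *\<^sub>R h \<in> KR_sublevel M"
    using KR_scaleR[OF h_on(1) M] mult_left_mono[OF h_on(2) M] h_on(1)
    by (simp add: KR_sublevel_def measures_on_scaleR)
  moreover have "K (M *\<^sub>R h) = M *\<^sub>R K h" using h_on(1) by (rule K_scaleR)
  ultimately have Mh: "M *\<^sub>R K h \<in> K ` KR_sublevel M" by (metis image_eqI)
  have \<mu>: "K \<mu> \<in> K ` KR_sublevel M"
    using iterate_measures_on[OF it] iterate_KR_le[OF it] \<mu>M by (auto simp: KR_sublevel_def)
  have L: "0 \<le> L" by (rule lipschitz_on_nonneg[OF lip])
  have ne: "norm e \<le> 2 * R"
    unfolding e_def using norm_triangle_ineq4[of "M *\<^sub>R K h" "K \<mu>"] R[OF Mh] R[OF \<mu>] by linarith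
  have "coeff_value \<mu>' \<le> F (K \<mu> + t *\<^sub>R e) + (1 - t) * (coeff_value \<mu> - F (K \<mu>)) + t * M"
    using cand[OF t M] by (simp add: e_def algebra_simps)
  moreover have "F (K \<mu> + t *\<^sub>R e) \<le> F (K \<mu>) + t * inner (gradF (K \<mu>)) e + L * (norm e)\<^sup>2 * t\<^sup>2"
    by (rule descent[OF F_grad lip convex_K_sublevel \<mu> _ t]) (use Mh in \<open>simp add: e_def\<close>)
  moreover have "L * (norm e)\<^sup>2 * t\<^sup>2 \<le> L * (2 * R)\<^sup>2 * t\<^sup>2"
    using ne L by (intro mult_right_mono mult_left_mono power_mono) auto
  moreover have "t * inner (gradF (K \<mu>)) e \<le> t * (Jfun \<nu> - F (K \<mu>) - M)"
  proof (rule mult_left_mono[OF _ t(1)])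
    have "inner (gradF (K \<mu>)) e = - s * M - inner (gradF (K \<mu>)) (K \<mu>)"
      by (simp add: e_def s_def inner_diff_right)
    moreover have "(s - 1) * KR \<nu> \<le> (s - 1) * M"
      using h(2) \<nu>_on(2) by (intro mult_left_mono) (auto simp: s_def)
    moreover have "F (K \<mu>) - inner (gradF (K \<mu>)) (K \<mu>) - (s - 1) * KR \<nu> \<le> Jfun \<nu>"
      unfolding s_def by (rule objective_lower_bound[OF h(3) \<nu>_on(1)])
    ultimately show "inner (gradF (K \<mu>)) e \<le> Jfun \<nu> - F (K \<mu>) - M"
      by (simp add: left_diff_distrib)
  qed
  ultimately show ?thesis by (simp add: algebra_simps)
qed

subsection \<open>Convergence\<close>

abbreviation minimizes :: "'a signed_measure \<Rightarrow> bool" where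
  "minimizes \<equiv> is_arg_min Jfun (\<lambda>\<nu>. \<nu> \<in> measures_on \<Omega>)"

abbreviation J_inf :: real where
  "J_inf \<equiv> (INF \<nu> \<in> measures_on \<Omega>. Jfun \<nu>)"

lemma F_lower: "Inf (range F) \<le> F y"
  by (intro cInf_lower F_bdd) simp

lemma J_inf_le: "\<nu> \<in> measures_on \<Omega> \<Longrightarrow> J_inf \<le> Jfun \<nu>"
proof (rule cINF_lower)
  show "bdd_below (Jfun ` measures_on \<Omega>)"
    using add_mono[OF F_lower KR_nonneg] by (auto simp: Jfun_eq intro!: bdd_belowI[of _ "Inf (range F) + 0"])
qed

lemma minimizerI: "\<nu> \<in> measures_on \<Omega> \<Longrightarrow> Jfun \<nu> \<le> J_inf \<Longrightarrow> minimizes \<nu>"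
  using J_inf_le by (fastforce simp: is_arg_min_def)

text \<open>When the stopping test succeeds, the dual variable is a certificate: the lower bound for
  the objective that it provides equals the value of the coefficient problem.\<close>

lemma terminates_minimizer:
  assumes it: "iterate \<mu> \<A>" and "agcg_terminates_at \<Omega> p \<alpha> \<beta> gradF K Kpre \<mu>"
  shows "minimizes \<mu>"
proof -
  obtain z w where "agcg_maximizers \<Omega> p \<beta> (dual \<mu>) z w" "agcg_stop p \<alpha> \<beta> (dual \<mu>) z w"
    using assms(2) by (auto simp: agcg_terminates_at_def Let_def)
  then have "dual_bound \<mu> 1" by (intro maximizers_bound) (auto simp: agcg_stop_def)
  then have "Jfun \<mu> \<le> Jfun \<nu>" if "\<nu> \<in> measures_on \<Omega>" for \<nu>
    using objective_lower_bound[of \<mu> 1 \<nu>] iterate_J_le[OF it] that by (simp add: coeff_value_def)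
  then show ?thesis
    using iterate_measures_on[OF it] by (fastforce simp: is_arg_min_def)
qed

lemma run_iterates:
  assumes \<A>\<^sub>0: "finite \<A>\<^sub>0" "\<A>\<^sub>0 \<subseteq> KR_ball \<Omega> p \<alpha> \<beta>"
    and run: "agcg_run \<Omega> p \<alpha> \<beta> F gradF K Kpre \<A>\<^sub>0 T \<mu> \<A>"
  shows "1 \<le> k \<Longrightarrow> enat k \<le> T \<Longrightarrow> iterate (\<mu> k) (\<A> k)"
proof (induction k rule: dec_induct)
  case base
  show ?case
    using run corrective_update_iterate(1)[OF \<A>\<^sub>0] by (simp add: agcg_run_def)
next
  case (step k)
  have kT: "enat k < T" using step.prems by (meson Suc_ile_eq)
  then have "agcg_step \<Omega> p \<alpha> \<beta> F gradF K Kpre (\<mu> k) (\<A> k) (\<mu> (Suc k)) (\<A> (Suc k))"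
    using run step.hyps(1) by (simp add: agcg_run_def)
  then show ?case using step_iterate[OF step.IH] kT by (metis less_imp_le)
qed

lemma weak_star_limit_minimizer:
  assumes "\<And>k. s k \<in> measures_on \<Omega>" "weak_star_tendsto \<Omega> s \<nu>" "(\<lambda>k. Jfun (s k)) \<longlonglongrightarrow> J_inf"
  shows "minimizes \<nu>"
proof (rule minimizerI)
  show "\<nu> \<in> measures_on \<Omega>" using assms(2) by (simp add: weak_star_tendsto_def)
  have "isCont F (K \<nu>)"
    using F_grad[of "K \<nu>"] unfolding gderiv_def by (rule has_derivative_continuous)
  then have "(\<lambda>k. F (K (s k))) \<longlonglongrightarrow> F (K \<nu>)"
    using K_convergent[OF assms(1,2)] isCont_tendsto_compose by blast
  with assms(3) have "(\<lambda>k. Jfun (s k) - F (K (s k))) \<longlonglongrightarrow> J_inf - F (K \<nu>)"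
    by (rule tendsto_diff)
  then have "(\<lambda>k. KR (s k)) \<longlonglongrightarrow> J_inf - F (K \<nu>)" by (simp add: Jfun_eq)
  from KR_lower_semicontinuous[OF assms(1,2) this] show "Jfun \<nu> \<le> J_inf" by (simp add: Jfun_eq)
qed

end

locale AGCG_infinite_run = AGCG_setting +
  fixes \<mu> :: "nat \<Rightarrow> 'a signed_measure" and \<A> :: "nat \<Rightarrow> 'a signed_measure set"
  assumes iterates: "\<And>k. 1 \<le> k \<Longrightarrow> iterate (\<mu> k) (\<A> k)"
    and steps: "\<And>k. 1 \<le> k \<Longrightarrow> agcg_step \<Omega> p \<alpha> \<beta> F gradF K Kpre (\<mu> k) (\<A> k) (\<mu> (Suc k)) (\<A> (Suc k))"
begin

text \<open>A bound for the norms of all iterates and of all competitors that are not worse than the first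
  value.\<close>

definition radius :: real where
  "radius = coeff_value (\<mu> 1) - Inf (range F)"

lemma coeff_value_le_initial: "1 \<le> k \<Longrightarrow> coeff_value (\<mu> k) \<le> coeff_value (\<mu> 1)"
  by (induction k rule: dec_induct) (use step_coeff_value_le[OF iterates steps] in \<open>auto intro: order_trans\<close>)

lemma iterates_radius: "1 \<le> k \<Longrightarrow> coeff_value (\<mu> k) - F (K (\<mu> k)) \<le> radius"
  using coeff_value_le_initial[of k] F_lower[of "K (\<mu> k)"] by (simp add: radius_def)

lemma iterates_KR_le: "1 \<le> k \<Longrightarrow> KR (\<mu> k) \<le> radius"
  using iterate_KR_le[OF iterates[of k]] iterates_radius[of k] by linarith

text \<open>A competitor whose objective exceeds the first value is worse than the first iterate, so it
  suffices to compare with competitors of bounded norm.\<close>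

lemma iterates_rate:
  obtains C where "0 < C" "\<And>k. 1 \<le> k \<Longrightarrow> coeff_value (\<mu> k) - J_inf \<le> C / (1 + real k)"
proof -
  obtain L where L: "L-lipschitz_on (K ` KR_sublevel radius) gradF"
    using F_lipschitz[OF compact_K_sublevel] by blast
  obtain R where R: "\<And>y. y \<in> K ` KR_sublevel radius \<Longrightarrow> norm y \<le> R"
    using compact_imp_bounded[OF compact_K_sublevel[of radius]] unfolding bounded_iff by blast
  define A where "A = L * (2 * R)\<^sup>2"
  have decrease: "coeff_value (\<mu> (Suc k)) \<le> (1 - t) * coeff_value (\<mu> k) + t * Jfun \<nu> + A * t\<^sup>2"
    if k: "1 \<le> k" and t: "0 \<le> t" "t \<le> 1" and \<nu>: "\<nu> \<in> measures_on \<Omega>" for k t \<nu>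
  proof -
    have dec: "coeff_value (\<mu> (Suc k)) \<le> (1 - t) * coeff_value (\<mu> k) + t * Jfun \<nu> + A * t\<^sup>2"
      if "\<nu> \<in> KR_sublevel radius" for \<nu>
      unfolding A_def by (rule step_decrease[OF iterates[OF k] steps[OF k] L R iterates_radius[OF k] that t])
    show ?thesis
    proof (cases "Jfun \<nu> \<le> coeff_value (\<mu> 1)")
      case True
      then have "KR \<nu> \<le> radius" using F_lower[of "K \<nu>"] by (simp add: Jfun_eq radius_def)
      then show ?thesis using \<nu> by (intro dec) (simp add: KR_sublevel_def)
    next
      case False
      have "t * Jfun (\<mu> 1) \<le> t * Jfun \<nu>"
        using False iterate_J_le[OF iterates[of 1]] t by (intro mult_left_mono) auto
      moreover have "\<mu> 1 \<in> KR_sublevel radius"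
        using iterates_KR_le[of 1] iterate_measures_on[OF iterates[of 1]] by (simp add: KR_sublevel_def)
      ultimately show ?thesis using dec[of "\<mu> 1"] by linarith
    qed
  qed
  define r where "r k = coeff_value (\<mu> k) - J_inf" for k
  have rec: "r (Suc k) \<le> (1 - t) * r k + A * t\<^sup>2" if k: "1 \<le> k" and t: "0 < t" "t \<le> 1" for k t
  proof -
    have "(coeff_value (\<mu> (Suc k)) - (1 - t) * coeff_value (\<mu> k) - A * t\<^sup>2) / t \<le> J_inf"
    proof (rule cINF_greatest)
      show "measures_on \<Omega> \<noteq> {}" using measures_on_0 by blast
      fix \<nu> assume "\<nu> \<in> measures_on \<Omega>"
      then show "(coeff_value (\<mu> (Suc k)) - (1 - t) * coeff_value (\<mu> k) - A * t\<^sup>2) / t \<le> Jfun \<nu>"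
        using decrease[OF k, of t \<nu>] t by (simp add: pos_divide_le_eq mult.commute[of t])
    qed
    then show ?thesis using t by (simp add: r_def pos_divide_le_eq algebra_simps)
  qed
  define C where "C = max 1 (max (2 * r 1) (4 * A))"
  have "r k \<le> C / (1 + real k)" if "1 \<le> k" for k
    by (rule conditional_gradient_rate[where A = A, OF _ _ _ _ that]) (use rec in \<open>auto simp: C_def\<close>)
  then show thesis using that[of C] by (simp add: C_def r_def)
qed

lemma iterates_J_tendsto: "(\<lambda>k. Jfun (\<mu> k)) \<longlonglongrightarrow> J_inf"
proof -
  obtain C where C: "\<And>k. 1 \<le> k \<Longrightarrow> coeff_value (\<mu> k) - J_inf \<le> C / (1 + real k)"
    using iterates_rate by metis
  have "(\<lambda>k. C * inverse (real (Suc k))) \<longlonglongrightarrow> C * 0"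
    by (intro tendsto_mult tendsto_const LIMSEQ_inverse_real_of_nat)
  then have up: "(\<lambda>k. J_inf + C / (1 + real k)) \<longlonglongrightarrow> J_inf"
    using tendsto_add[OF tendsto_const[of J_inf]] by (fastforce simp: divide_inverse)
  show ?thesis
  proof (rule tendsto_sandwich[OF _ _ tendsto_const up])
    show "\<forall>\<^sub>F k in sequentially. J_inf \<le> Jfun (\<mu> k)"
      using J_inf_le iterate_measures_on[OF iterates] by (auto intro!: eventually_sequentiallyI[of 1])
    show "\<forall>\<^sub>F k in sequentially. Jfun (\<mu> k) \<le> J_inf + C / (1 + real k)"
    proof (rule eventually_sequentiallyI[of 1])
      fix k :: nat assume "1 \<le> k"
      then show "Jfun (\<mu> k) \<le> J_inf + C / (1 + real k)"
        using C[of k] iterate_J_le[OF iterates[of k]] by linarith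
    qed
  qed
qed

text \<open>The shift by one discards \<open>\<mu> 0\<close>, which is not an iterate and may be any measure.\<close>

lemma accumulation_point_minimizer:
  assumes r: "strict_mono r" and lim: "weak_star_tendsto \<Omega> (\<mu> \<circ> r) \<nu>"
  shows "minimizes \<nu>"
proof (rule weak_star_limit_minimizer[of "(\<mu> \<circ> r) \<circ> Suc"])
  have Suc: "strict_mono Suc" by (simp add: strict_mono_Suc_iff)
  show "weak_star_tendsto \<Omega> (\<mu> \<circ> r \<circ> Suc) \<nu>" by (rule weak_star_subseq[OF lim Suc])
  have "1 \<le> r (Suc k)" for k using seq_suble[OF r, of "Suc k"] by simp
  then show "(\<mu> \<circ> r \<circ> Suc) k \<in> measures_on \<Omega>" for k
    using iterate_measures_on[OF iterates] by simp
  show "(\<lambda>k. Jfun ((\<mu> \<circ> r \<circ> Suc) k)) \<longlonglongrightarrow> J_inf"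
    using LIMSEQ_subseq_LIMSEQ[OF iterates_J_tendsto strict_mono_o[OF r Suc]] by (simp add: comp_def)
qed

lemma accumulation_point_exists:
  assumes r: "strict_mono (r :: nat \<Rightarrow> nat)"
  obtains r' \<nu> where "strict_mono r'" "weak_star_tendsto \<Omega> (\<mu> \<circ> r \<circ> r') \<nu>"
proof -
  have r1: "1 \<le> r (Suc k)" for k using seq_suble[OF r, of "Suc k"] by simp
  obtain r' \<nu> where r': "strict_mono r'" "weak_star_tendsto \<Omega> ((\<lambda>k. \<mu> (r (Suc k))) \<circ> r') \<nu>"
    by (rule KR_compact[of "\<lambda>k. \<mu> (r (Suc k))" "\<lambda>_. radius" radius])
       (use iterate_measures_on[OF iterates] iterates_KR_le r1 in auto)
  have "strict_mono (Suc \<circ> r')" using r'(1) by (simp add: strict_mono_def)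
  moreover have "(\<lambda>k. \<mu> (r (Suc k))) \<circ> r' = \<mu> \<circ> r \<circ> (Suc \<circ> r')" by (simp add: comp_def)
  ultimately show thesis using that[of "Suc \<circ> r'" \<nu>] r'(2) by simp
qed

text \<open>Otherwise a subsequence would stay away from \<open>\<mu>bar\<close> for some test function, although it has an
  accumulation point, which is a minimizer and hence equals \<open>\<mu>bar\<close>.\<close>

lemma unique_minimizer_convergence:
  assumes uniq: "\<And>\<nu>. minimizes \<nu> \<longleftrightarrow> \<nu> = \<mu>bar"
  shows "weak_star_tendsto \<Omega> \<mu> \<mu>bar"
  unfolding weak_star_tendsto_def
proof (intro conjI allI impI)
  show "\<mu>bar \<in> measures_on \<Omega>" using uniq[of \<mu>bar] by (simp add: is_arg_min_def)
  fix f :: "'a \<Rightarrow> real" assume f: "continuous_on \<Omega> f"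
  show "(\<lambda>k. smeas_integral \<Omega> (\<mu> k) f) \<longlonglongrightarrow> smeas_integral \<Omega> \<mu>bar f"
  proof (rule ccontr)
    assume "\<not> ?thesis"
    then obtain \<epsilon> where "0 < \<epsilon>"
      and often: "\<not> (\<forall>\<^sub>F k in sequentially. dist (smeas_integral \<Omega> (\<mu> k) f) (smeas_integral \<Omega> \<mu>bar f) < \<epsilon>)"
      unfolding tendsto_iff by blast
    obtain r :: "nat \<Rightarrow> nat" where r: "strict_mono r"
      and far: "\<And>k. \<not> dist (smeas_integral \<Omega> (\<mu> (r k)) f) (smeas_integral \<Omega> \<mu>bar f) < \<epsilon>"
      using not_eventually_sequentiallyD[OF often] by blast
    obtain r' \<nu> where r': "strict_mono r'" "weak_star_tendsto \<Omega> (\<mu> \<circ> r \<circ> r') \<nu>"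
      by (rule accumulation_point_exists[OF r])
    have "minimizes \<nu>"
      using accumulation_point_minimizer[OF strict_mono_o[OF r r'(1)]] r'(2) by (simp add: o_assoc)
    then have "(\<lambda>k. smeas_integral \<Omega> ((\<mu> \<circ> r \<circ> r') k) f) \<longlonglongrightarrow> smeas_integral \<Omega> \<mu>bar f"
      using r'(2) f uniq by (simp add: weak_star_tendsto_def)
    then have "\<forall>\<^sub>F k in sequentially. dist (smeas_integral \<Omega> ((\<mu> \<circ> r \<circ> r') k) f) (smeas_integral \<Omega> \<mu>bar f) < \<epsilon>"
      using \<open>0 < \<epsilon>\<close> by (rule tendstoD)
    then show False using far by (auto simp: eventually_sequentially)
  qed
qed

end

theorem theorem3p11:
  fixes \<Omega> :: "'a::euclidean_space set"
    and p \<alpha> \<beta> :: real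
    and K :: "'a signed_measure \<Rightarrow> 'y::{real_inner, complete_space}"
    and Kpre :: "'y \<Rightarrow> 'a \<Rightarrow> real"
    and F :: "'y \<Rightarrow> real"
    and gradF :: "'y \<Rightarrow> 'y"
    and \<A>\<^sub>0 :: "'a signed_measure set"
    and T :: enat
    and \<mu> :: "nat \<Rightarrow> 'a signed_measure"
    and \<A> :: "nat \<Rightarrow> 'a signed_measure set"
  defines "J \<equiv> objective \<Omega> p \<alpha> \<beta> F K"
  defines "minimizer \<equiv> is_arg_min J (\<lambda>\<nu>. \<nu> \<in> measures_on \<Omega>)"
  assumes "convex \<Omega>" and "compact \<Omega>"
    and "0 < p" and "p \<le> 1" and "0 < \<alpha>" and "0 < \<beta>" and "0 < 2 * \<alpha> - \<beta>"
    and "linear_on_measures \<Omega> K" and "weak_star_to_strong_continuous \<Omega> K"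
    and "is_preadjoint \<Omega> K Kpre"
    and "strictly_convex F" and "bdd_below (range F)"
    and "\<And>y. GDERIV F y :> gradF y"
    and "\<And>C. compact C \<Longrightarrow> \<exists>L. L-lipschitz_on C gradF"
    and "finite \<A>\<^sub>0" and "\<A>\<^sub>0 \<subseteq> {\<nu>. \<nu> extreme_point_of KR_ball \<Omega> p \<alpha> \<beta>}"
    and "agcg_run \<Omega> p \<alpha> \<beta> F gradF K Kpre \<A>\<^sub>0 T \<mu> \<A>"
  shows "(\<exists>N. T = enat N \<and> minimizer (\<mu> N)) \<or>
    (T = \<infinity> \<and>
     (\<exists>C>0. \<forall>k\<ge>1. J (\<mu> k) - (INF \<nu> \<in> measures_on \<Omega>. J \<nu>) \<le> C / (1 + real k)) \<and>
     (\<exists>r \<nu>. strict_mono r \<and> weak_star_tendsto \<Omega> (\<mu> \<circ> r) \<nu>) \<and>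
     (\<forall>r \<nu>. strict_mono r \<and> weak_star_tendsto \<Omega> (\<mu> \<circ> r) \<nu> \<longrightarrow> minimizer \<nu>) \<and>
     (\<forall>\<mu>bar. (\<forall>\<nu>. minimizer \<nu> \<longleftrightarrow> \<nu> = \<mu>bar) \<longrightarrow> weak_star_tendsto \<Omega> \<mu> \<mu>bar))"
proof -
  interpret AGCG_setting \<Omega> p \<alpha> \<beta> K Kpre F gradF
    by unfold_locales fact+
  have \<A>\<^sub>0: "\<A>\<^sub>0 \<subseteq> KR_ball \<Omega> p \<alpha> \<beta>"
    using assms(18) by (auto simp: extreme_point_of_def)
  note run = \<open>agcg_run \<Omega> p \<alpha> \<beta> F gradF K Kpre \<A>\<^sub>0 T \<mu> \<A>\<close>
  note it = run_iterates[OF \<open>finite \<A>\<^sub>0\<close> \<A>\<^sub>0 run]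
  show ?thesis
  proof (cases T)
    case (enat N)
    then have "1 \<le> N" "agcg_terminates_at \<Omega> p \<alpha> \<beta> gradF K Kpre (\<mu> N)"
      using run by (auto simp: agcg_run_def one_enat_def)
    then have "minimizer (\<mu> N)"
      unfolding minimizer_def J_def using terminates_minimizer[OF it[of N]] enat by simp
    then show ?thesis using enat by blast
  next
    case infinity
    interpret AGCG_infinite_run \<Omega> p \<alpha> \<beta> K Kpre F gradF \<mu> \<A>
    proof
      show "iterate (\<mu> k) (\<A> k)" if "1 \<le> k" for k using it[OF that] infinity by simp
      show "agcg_step \<Omega> p \<alpha> \<beta> F gradF K Kpre (\<mu> k) (\<A> k) (\<mu> (Suc k)) (\<A> (Suc k))"
        if "1 \<le> k" for k
        using run that infinity by (simp add: agcg_run_def)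
    qed
    obtain C where C: "0 < C" "\<And>k. 1 \<le> k \<Longrightarrow> coeff_value (\<mu> k) - J_inf \<le> C / (1 + real k)"
      using iterates_rate by blast
    have rate: "\<exists>C>0. \<forall>k\<ge>1. J (\<mu> k) - (INF \<nu> \<in> measures_on \<Omega>. J \<nu>) \<le> C / (1 + real k)"
    proof (intro exI conjI allI impI)
      fix k :: nat assume "1 \<le> k"
      then show "J (\<mu> k) - (INF \<nu> \<in> measures_on \<Omega>. J \<nu>) \<le> C / (1 + real k)"
        using C(2)[of k] iterate_J_le[OF iterates[of k]] by (simp add: J_def)
    qed (rule C(1))
    obtain r \<nu> where "strict_mono r" "weak_star_tendsto \<Omega> (\<mu> \<circ> id \<circ> r) \<nu>"
      by (rule accumulation_point_exists[OF strict_mono_id])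
    then have acc: "\<exists>r \<nu>. strict_mono r \<and> weak_star_tendsto \<Omega> (\<mu> \<circ> r) \<nu>"
      by auto
    have acc_min: "minimizer \<nu>" if "strict_mono r" "weak_star_tendsto \<Omega> (\<mu> \<circ> r) \<nu>" for r \<nu>
      unfolding minimizer_def J_def by (rule accumulation_point_minimizer[OF that])
    have uniq: "weak_star_tendsto \<Omega> \<mu> \<mu>bar" if "\<forall>\<nu>. minimizer \<nu> \<longleftrightarrow> \<nu> = \<mu>bar" for \<mu>bar
      using that unfolding minimizer_def J_def
      by (intro unique_minimizer_convergence) auto
    show ?thesis using infinity rate acc acc_min uniq by blast
  qed
qed

end
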